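(* Let $n\ge2$ be an integer. Assume that the coupling operators $C_{i\,i-1}$, $i=2,\dots,n$, satisfy the Coupling hypothesis of order $n$ with $\Pi_i=C_{i\,i-1}$ for all $i=2,\dots,n$. Let $\mathbf{B}_n^{*}$ be any given operator satisfying the Admissibility hypothesis of index $n$. Assume that either $\mathbf{B}_n^{*}$ does not satisfy the Observability hypothesis of index $n$, or the operators $(C_{i\,i-1})_{i\in\{2,\dots,n\}}=(\Pi_i)_{i\in\{2,\dots,n\}}$ do not satisfy the Coupling observability hypothesis of order $n$. Then there does not exist $T_n^{*}>0$ such that for all $T>T_n^{*}$ the following property holds: there exists $C>0$ such that for all $U^0\in\mathcal H_n$ the solution $U=(u_1,\dots,u_n,u_1',\dots,u_n')$ of the bi-diagonal cascade system with initial data $U^0$ satisfies $$C\sum_{i=1}^ne_{1+i-n}(U_i)(0)\le\int_0^T\|\mathbf{B}_n^{*}U_n\|_{G_n}^2\,dt.$$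
   Context: Abstract setting. $H$ is a Hilbert space with norm $|\cdot|$ and scalar product $\langle\cdot,\cdot\rangle$. $A:D(A)\subset H\to H$ is a positive self-adjoint operator with compact resolvent such that, for some $\omega>0$, $|Au|\ge\omega|u|$ for all $u\in D(A)$. For $k\in\mathbb N$, $H_k=D(A^{k/2})$ with norm $|A^{k/2}\cdot|$ ($H_0=H$), and $H_{-k}$ is the dual of $H_k$ with pivot space $H$, with norm $|A^{-k/2}\cdot|$. For $k\in\mathbb Z$ and a pair $W=(w,w')$, $e_k(W)=\frac12\big(|A^{k/2}w|^2+|A^{(k-1)/2}w'|^2\big)$. Coupling hypothesis of order $n$. For all $i\in\{2,\dots,n\}$: $C_{i\,i-1}$ is a bounded operator on $H$; $C_{i\,i-1}^{*}\in\mathcal L(H_k)$ for $k\in\{0,1,\dots,n-i+1\}$; $\|C_{i\,i-1}\|=\beta_i$ and $|C_{i\,i-1}w|^2\le\beta_i\langle C_{i\,i-1}w,w\rangle$ for all $w\in H$; there exists $\alpha_i>0$ such that $\alpha_i|\Pi_iw|^2\le\langle C_{i\,i-1}w,w\rangle$ for all $w\in H$. Coupling observability hypothesis of order $n$. For all $i\in\{2,\dots,n\}$: $\Pi_i\in\mathcal L(H)$ and there exists $T_{0,i}>0$ such that for all $T>T_{0,i}$ there exists $\gamma_i(T)>0$ such that all solutions $w$ of $w''+Aw=0$ satisfy $\int_0^T|\Pi_iw'|^2dt\ge\gamma_i(T)e_1(W)(0)$, where $W=(w,w')$. Admissibility hypothesis of index $n$. $G_n$ is a Hilbert space (identified with its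 dual), $\mathbf{B}_n^{*}\in\mathcal L(H_2\times H;G_n)$, and for all $T>0$ there exists $D_n(T)>0$ such that all solutions $w$ of $w''+Aw=f\in L^2([0,T];H)$ satisfy, with $W=(w,w')$, $$\int_0^T\|\mathbf{B}_n^{*}(w,w')\|_{G_n}^2dt\le D_n(T)\Big(e_1(W)(0)+e_1(W)(T)+\int_0^Te_1(W)(t)\,dt+\int_0^T|f|^2dt\Big).$$ For solutions of energy regularity ($(w,w')(0)\in H_1\times H$) the function $\mathbf{B}_n^{*}(w,w')\in L^2(0,T;G_n)$ is understood through the extension by density given by this inequality. Observability hypothesis of index $n$. There exists $T_{0,n}>0$ such that for all $T>T_{0,n}$ there exists $R_n(T)>0$ such that all solutions $w$ of $w''+Aw=0$ satisfy $\int_0^T\|\mathbf{B}_n^{*}(w,w')\|_{G_n}^2dt\ge R_n(T)e_1(W)(0)$. Bi-diagonal cascade system of order $n$: $$u_1''+Au_1=0,\qquad u_i''+Au_i+C_{i\,i-1}u_{i-1}=0\quad(2\le i\le n),$$ with initial data $U^0=(u_1,\dots,u_n,u_1',\dots,u_n')(0)\in\mathcal H_n=H_1^n\times H^n$. For a solution, $U_i=(u_i,u_i')$. *)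

theory Defs
  imports "HOL-Analysis.Analysis"
begin

section \<open>The operator \<open>A\<close> and the spaces \<open>H\<^sub>k\<close>\<close>

text \<open>
  Hilbert spaces are types of class \<open>{real_inner, complete_space}\<close>. An unbounded operator is given
  by its domain \<open>D\<close> and a function \<open>A\<close>, whose values outside \<open>D\<close> are irrelevant.
\<close>

definition linear_on :: "'a::real_vector set \<Rightarrow> ('a \<Rightarrow> 'b::real_vector) \<Rightarrow> bool" where
  "linear_on V F \<longleftrightarrow> subspace V
     \<and> (\<forall>x\<in>V. \<forall>y\<in>V. F (x + y) = F x + F y)
     \<and> (\<forall>c. \<forall>x\<in>V. F (c *\<^sub>R x) = c *\<^sub>R F x)"

definition adjoint_dom :: "'h::real_inner set \<Rightarrow> ('h \<Rightarrow> 'h) \<Rightarrow> 'h set" where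
  "adjoint_dom D A = {y. \<exists>z. \<forall>x\<in>D. A x \<bullet> y = x \<bullet> z}"

definition self_adjoint_op :: "'h::real_inner set \<Rightarrow> ('h \<Rightarrow> 'h) \<Rightarrow> bool" where
  "self_adjoint_op D A \<longleftrightarrow> linear_on D A \<and> closure D = UNIV
     \<and> (\<forall>x\<in>D. \<forall>y\<in>D. A x \<bullet> y = x \<bullet> A y)
     \<and> adjoint_dom D A = D"

definition positive_op :: "'h::real_inner set \<Rightarrow> ('h \<Rightarrow> 'h) \<Rightarrow> bool" where
  "positive_op D A \<longleftrightarrow> (\<forall>x\<in>D. 0 \<le> A x \<bullet> x)"

definition compact_op :: "('h::real_normed_vector \<Rightarrow> 'h) \<Rightarrow> bool" where
  "compact_op K \<longleftrightarrow> bounded_linear K \<and> compact (closure (K ` cball 0 1))"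

text \<open>
  Compactness of \<open>(A - \<lambda>)\<inverse>\<close> for one \<open>\<lambda>\<close> in the resolvent set is equivalent to compactness for all.
\<close>

definition compact_resolvent :: "'h::real_normed_vector set \<Rightarrow> ('h \<Rightarrow> 'h) \<Rightarrow> bool" where
  "compact_resolvent D A \<longleftrightarrow> (\<exists>(l::real) R. compact_op R
     \<and> (\<forall>x. R x \<in> D \<and> A (R x) - l *\<^sub>R R x = x)
     \<and> (\<forall>x\<in>D. R (A x - l *\<^sub>R x) = x))"

definition abstract_setting :: "'h::{real_inner,complete_space} set \<Rightarrow> ('h \<Rightarrow> 'h) \<Rightarrow> bool" where
  "abstract_setting D A \<longleftrightarrow> self_adjoint_op D A \<and> positive_op D A \<and> compact_resolvent D A
     \<and> (\<exists>\<omega>>0. \<forall>x\<in>D. \<omega> * norm x \<le> norm (A x))"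

text \<open>
  \<open>A\<^bsup>1/2\<^esup>\<close> is the positive self-adjoint square root of \<open>A\<close>; it is unique as an operator, i.e.
  its domain is determined and its values are determined on this domain.
\<close>

definition is_positive_sqrt ::
  "'h::real_inner set \<Rightarrow> ('h \<Rightarrow> 'h) \<Rightarrow> 'h set \<Rightarrow> ('h \<Rightarrow> 'h) \<Rightarrow> bool" where
  "is_positive_sqrt D A E S \<longleftrightarrow> self_adjoint_op E S \<and> positive_op E S
     \<and> {x\<in>E. S x \<in> E} = D \<and> (\<forall>x\<in>D. S (S x) = A x)"

definition sqrt_op :: "'h::real_inner set \<Rightarrow> ('h \<Rightarrow> 'h) \<Rightarrow> 'h set \<times> ('h \<Rightarrow> 'h)" where
  "sqrt_op D A = (SOME p. is_positive_sqrt D A (fst p) (snd p))"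

definition sqrt_dom :: "'h::real_inner set \<Rightarrow> ('h \<Rightarrow> 'h) \<Rightarrow> 'h set" where
  "sqrt_dom D A = fst (sqrt_op D A)"

definition sqrt_fun :: "'h::real_inner set \<Rightarrow> ('h \<Rightarrow> 'h) \<Rightarrow> 'h \<Rightarrow> 'h" where
  "sqrt_fun D A = snd (sqrt_op D A)"

text \<open>\<open>Hsp D A k\<close> is \<open>H\<^sub>k = D(A\<^bsup>k/2\<^esup>)\<close> for \<open>k \<ge> 0\<close>; in particular \<open>Hsp D A 2 = D\<close>.\<close>

fun Hsp :: "'h::real_inner set \<Rightarrow> ('h \<Rightarrow> 'h) \<Rightarrow> nat \<Rightarrow> 'h set" where
  "Hsp D A 0 = UNIV"
| "Hsp D A (Suc k) = {x \<in> sqrt_dom D A. sqrt_fun D A x \<in> Hsp D A k}"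

text \<open>
  \<open>half_pow D A k\<close> is \<open>A\<^bsup>k/2\<^esup>\<close>, on \<open>H\<^sub>k\<close> if \<open>k \<ge> 0\<close> and on all of \<open>H\<close> if \<open>k < 0\<close>. In the latter case
  \<open>norm (half_pow D A k x)\<close> is the norm of \<open>H\<^sub>k\<close> restricted to the pivot space \<open>H\<close>; only elements of
  \<open>H\<close> are ever measured in a norm of negative index below.
\<close>

definition half_pow :: "'h::real_inner set \<Rightarrow> ('h \<Rightarrow> 'h) \<Rightarrow> int \<Rightarrow> 'h \<Rightarrow> 'h" where
  "half_pow D A k = (if 0 \<le> k then sqrt_fun D A ^^ nat k
                     else inv_into (sqrt_dom D A) (sqrt_fun D A) ^^ nat (- k))"

definition energy :: "'h::real_inner set \<Rightarrow> ('h \<Rightarrow> 'h) \<Rightarrow> int \<Rightarrow> 'h \<Rightarrow> 'h \<Rightarrow> real" where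
  "energy D A k w w' = ((norm (half_pow D A k w))\<^sup>2 + (norm (half_pow D A (k - 1) w'))\<^sup>2) / 2"


section \<open>Solutions of \<open>w'' + A w = f\<close>\<close>

text \<open>
  Under the standing assumptions \<open>H\<close> is separable, so that Borel measurability of an \<open>H\<close>-valued
  function is strong measurability.
\<close>

definition L2_on :: "real \<Rightarrow> (real \<Rightarrow> 'h::real_normed_vector) \<Rightarrow> bool" where
  "L2_on T f \<longleftrightarrow> set_borel_measurable lebesgue {0..T} f
     \<and> set_integrable lebesgue {0..T} (\<lambda>t. (norm (f t))\<^sup>2)"

text \<open>
  Solutions of energy regularity, \<open>w \<in> C([0,T];H\<^sub>1) \<inter> C\<^sup>1([0,T];H)\<close> with derivative \<open>w'\<close>, of
  \<open>w'' + A w = f \<in> L\<^sup>2([0,T];H)\<close>. The equation holds in \<open>H\<^bsub>-1\<^esub>\<close>: it is tested against \<open>H\<^sub>1\<close> and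
  integrated once in time.
\<close>

definition wave_solution :: "'h::{real_inner,complete_space} set \<Rightarrow> ('h \<Rightarrow> 'h) \<Rightarrow> real \<Rightarrow>
    (real \<Rightarrow> 'h) \<Rightarrow> (real \<Rightarrow> 'h) \<Rightarrow> (real \<Rightarrow> 'h) \<Rightarrow> bool" where
  "wave_solution D A T f w w' \<longleftrightarrow> L2_on T f
     \<and> (\<forall>t\<in>{0..T}. w t \<in> Hsp D A 1)
     \<and> continuous_on {0..T} (\<lambda>t. half_pow D A 1 (w t))
     \<and> (\<forall>t\<in>{0..T}. (w has_vector_derivative w' t) (at t within {0..T}))
     \<and> continuous_on {0..T} w'
     \<and> (\<forall>\<phi>\<in>Hsp D A 1. \<forall>t\<in>{0..T}. w' t \<bullet> \<phi> = w' 0 \<bullet> \<phi>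
          + (LINT s:{0..t}|lebesgue. f s \<bullet> \<phi> - half_pow D A 1 (w s) \<bullet> half_pow D A 1 \<phi>))"

text \<open>Regular solutions: in addition \<open>w \<in> C([0,T];H\<^sub>2) \<inter> C\<^sup>1([0,T];H\<^sub>1)\<close>.\<close>

definition regular_solution :: "'h::{real_inner,complete_space} set \<Rightarrow> ('h \<Rightarrow> 'h) \<Rightarrow> real \<Rightarrow>
    (real \<Rightarrow> 'h) \<Rightarrow> (real \<Rightarrow> 'h) \<Rightarrow> (real \<Rightarrow> 'h) \<Rightarrow> bool" where
  "regular_solution D A T f w w' \<longleftrightarrow> wave_solution D A T f w w'
     \<and> (\<forall>t\<in>{0..T}. w t \<in> Hsp D A 2)
     \<and> continuous_on {0..T} (\<lambda>t. half_pow D A 2 (w t))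
     \<and> (\<forall>t\<in>{0..T}. w' t \<in> Hsp D A 1)
     \<and> continuous_on {0..T} (\<lambda>t. half_pow D A 1 (w' t))"


section \<open>Coupling operators\<close>

text \<open>\<open>C i\<close> stands for \<open>C\<^bsub>i i-1\<^esub>\<close>, and \<open>P i\<close> for \<open>\<Pi>\<^sub>i\<close>.\<close>

definition coupling_hyp :: "'h::{real_inner,complete_space} set \<Rightarrow> ('h \<Rightarrow> 'h) \<Rightarrow> nat \<Rightarrow>
    (nat \<Rightarrow> 'h \<Rightarrow> 'h) \<Rightarrow> (nat \<Rightarrow> 'h \<Rightarrow> 'h) \<Rightarrow> bool" where
  "coupling_hyp D A n C P \<longleftrightarrow> (\<forall>i\<in>{2..n}. bounded_linear (C i)
     \<and> (\<forall>k\<in>{0..n - i + 1}.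
          (\<forall>x\<in>Hsp D A k. adjoint (C i) x \<in> Hsp D A k)
          \<and> (\<exists>K. \<forall>x\<in>Hsp D A k.
               norm (half_pow D A (int k) (adjoint (C i) x)) \<le> K * norm (half_pow D A (int k) x)))
     \<and> (\<forall>w. (norm (C i w))\<^sup>2 \<le> onorm (C i) * (C i w \<bullet> w))
     \<and> (\<exists>\<alpha>>0. \<forall>w. \<alpha> * (norm (P i w))\<^sup>2 \<le> C i w \<bullet> w))"

definition coupling_observability_hyp :: "'h::{real_inner,complete_space} set \<Rightarrow> ('h \<Rightarrow> 'h) \<Rightarrow>
    nat \<Rightarrow> (nat \<Rightarrow> 'h \<Rightarrow> 'h) \<Rightarrow> bool" where
  "coupling_observability_hyp D A n P \<longleftrightarrow> (\<forall>i\<in>{2..n}. bounded_linear (P i)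
     \<and> (\<exists>T0>0. \<forall>T>T0. \<exists>\<gamma>>0. \<forall>w w'. wave_solution D A T (\<lambda>t. 0) w w' \<longrightarrow>
          (LINT t:{0..T}|lebesgue. (norm (P i (w' t)))\<^sup>2) \<ge> \<gamma> * energy D A 1 (w 0) (w' 0)))"


section \<open>The observation operator\<close>

text \<open>
  \<open>B\<close> stands for \<open>\<^bold>B\<^sub>n\<^sup>*\<close>; only its values on \<open>H\<^sub>2 \<times> H\<close> matter. The admissibility inequality is required
  for regular solutions, for which \<open>B (w t, w' t)\<close> makes sense pointwise.
\<close>

definition admissibility_hyp :: "'h::{real_inner,complete_space} set \<Rightarrow> ('h \<Rightarrow> 'h) \<Rightarrow>
    ('h \<times> 'h \<Rightarrow> 'g::{real_inner,complete_space}) \<Rightarrow> bool" where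
  "admissibility_hyp D A B \<longleftrightarrow> linear_on (Hsp D A 2 \<times> UNIV) B
     \<and> (\<exists>K. \<forall>x\<in>Hsp D A 2. \<forall>y. norm (B (x, y)) \<le> K * sqrt ((norm (half_pow D A 2 x))\<^sup>2 + (norm y)\<^sup>2))
     \<and> (\<forall>T>0. \<exists>d>0. \<forall>f w w'. regular_solution D A T f w w' \<longrightarrow>
          (LINT t:{0..T}|lebesgue. (norm (B (w t, w' t)))\<^sup>2)
            \<le> d * (energy D A 1 (w 0) (w' 0) + energy D A 1 (w T) (w' T)
                   + (LINT t:{0..T}|lebesgue. energy D A 1 (w t) (w' t))
                   + (LINT t:{0..T}|lebesgue. (norm (f t))\<^sup>2)))"

text \<open>
  Extension by density: \<open>g\<close> is \<open>B (w, w') \<in> L\<^sup>2(0,T;G)\<close> for a solution of energy regularity if regular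
  solutions converge to \<open>(w, w')\<close> in \<open>C([0,T]; H\<^sub>1 \<times> H)\<close>, with right-hand sides converging in
  \<open>L\<^sup>2(0,T;H)\<close>, and their observations converge to \<open>g\<close> in \<open>L\<^sup>2(0,T;G)\<close>. Under the admissibility
  hypothesis such a \<open>g\<close> exists and is unique almost everywhere. No separability of \<open>G\<close> is needed:
  \<open>g\<close> is an \<open>L\<^sup>2\<close>-limit of continuous functions, hence strongly measurable.
\<close>

definition is_observation :: "'h::{real_inner,complete_space} set \<Rightarrow> ('h \<Rightarrow> 'h) \<Rightarrow>
    ('h \<times> 'h \<Rightarrow> 'g::{real_inner,complete_space}) \<Rightarrow> real \<Rightarrow> (real \<Rightarrow> 'h) \<Rightarrow> (real \<Rightarrow> 'h) \<Rightarrow>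
    (real \<Rightarrow> 'g) \<Rightarrow> bool" where
  "is_observation D A B T w w' g \<longleftrightarrow> (\<exists>f fs ws ws'.
       wave_solution D A T f w w'
     \<and> (\<forall>m::nat. regular_solution D A T (fs m) (ws m) (ws' m))
     \<and> uniform_limit {0..T} (\<lambda>m t. half_pow D A 1 (ws m t)) (\<lambda>t. half_pow D A 1 (w t)) sequentially
     \<and> uniform_limit {0..T} ws' w' sequentially
     \<and> (\<lambda>m. LINT t:{0..T}|lebesgue. (norm (fs m t - f t))\<^sup>2) \<longlonglongrightarrow> 0
     \<and> (\<forall>m. set_integrable lebesgue {0..T} (\<lambda>t. (norm (B (ws m t, ws' m t) - g t))\<^sup>2))
     \<and> (\<lambda>m. LINT t:{0..T}|lebesgue. (norm (B (ws m t, ws' m t) - g t))\<^sup>2) \<longlonglongrightarrow> 0)"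

definition observation :: "'h::{real_inner,complete_space} set \<Rightarrow> ('h \<Rightarrow> 'h) \<Rightarrow>
    ('h \<times> 'h \<Rightarrow> 'g::{real_inner,complete_space}) \<Rightarrow> real \<Rightarrow> (real \<Rightarrow> 'h) \<Rightarrow> (real \<Rightarrow> 'h) \<Rightarrow>
    real \<Rightarrow> 'g" where
  "observation D A B T w w' = (SOME g. is_observation D A B T w w' g)"

definition observability_hyp :: "'h::{real_inner,complete_space} set \<Rightarrow> ('h \<Rightarrow> 'h) \<Rightarrow>
    ('h \<times> 'h \<Rightarrow> 'g::{real_inner,complete_space}) \<Rightarrow> bool" where
  "observability_hyp D A B \<longleftrightarrow>
     (\<exists>T0>0. \<forall>T>T0. \<exists>R>0. \<forall>w w'. wave_solution D A T (\<lambda>t. 0) w w' \<longrightarrow>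
        (LINT t:{0..T}|lebesgue. (norm (observation D A B T w w' t))\<^sup>2)
          \<ge> R * energy D A 1 (w 0) (w' 0))"


section \<open>The cascade system\<close>

text \<open>
  \<open>(u, u')\<close> is the solution on \<open>[0,T]\<close> with initial data \<open>u i 0 = u0 i\<close>, \<open>u' i 0 = u1 i\<close>
  (\<open>1 \<le> i \<le> n\<close>).
\<close>

definition cascade_solution :: "'h::{real_inner,complete_space} set \<Rightarrow> ('h \<Rightarrow> 'h) \<Rightarrow> nat \<Rightarrow>
    (nat \<Rightarrow> 'h \<Rightarrow> 'h) \<Rightarrow> real \<Rightarrow> (nat \<Rightarrow> 'h) \<Rightarrow> (nat \<Rightarrow> 'h) \<Rightarrow>
    (nat \<Rightarrow> real \<Rightarrow> 'h) \<Rightarrow> (nat \<Rightarrow> real \<Rightarrow> 'h) \<Rightarrow> bool" where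
  "cascade_solution D A n C T u0 u1 u u' \<longleftrightarrow>
       (\<forall>i\<in>{1..n}. u i 0 = u0 i \<and> u' i 0 = u1 i)
     \<and> wave_solution D A T (\<lambda>t. 0) (u 1) (u' 1)
     \<and> (\<forall>i\<in>{2..n}. wave_solution D A T (\<lambda>t. - C i (u (i - 1) t)) (u i) (u' i))"

end

theory Submission
  imports Defs
begin

text \<open>
  By contraposition. Exciting only the last component of the cascade gives the observability
  of \<open>B\<close>. For \<open>2 \<le> i \<le> n\<close> put \<open>P = C i\<close> and \<open>k = n - i\<close>, start from zero data in all
  components but \<open>u\<^sub>i\<^sub>-\<^sub>1 = v\<close>, and estimate the remaining components successively in the
  scale of spaces of negative index; the cascade inequality and the admissibility of \<open>B\<close> then
  bound the energy of \<open>v\<close> of index \<open>-k\<close> by the square norm of \<open>P v\<close> in \<open>L\<^sup>2(0,T; H\<^bsub>-k\<^esub>)\<close>. For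
  a free solution \<open>w\<close>, taking for \<open>v\<close> the time derivative of \<open>w'\<close> of order \<open>k\<close> turns the
  left-hand side into \<open>e\<^sub>1(w)\<close>, and the right-hand side involves the \<open>k\<close>-th derivative of \<open>g =
  P w'\<close> measured in \<open>H\<^bsub>-k\<^esub>\<close>. Now \<open>g\<close> itself is to be measured in \<open>H\<close>, while its derivative of
  order \<open>k+1\<close> is bounded in \<open>H\<^bsub>-k-1\<^esub>\<close> by \<open>e\<^sub>1(w)\<close>, because \<open>P\<close> is bounded on \<open>H\<^bsub>-k-1\<^esub>\<close>.
  Interpolating between these two derivatives, with a small constant in front of the latter,
  absorbs \<open>e\<^sub>1(w)\<close> and leaves the observability inequality for \<open>P\<close>.

  Everything is done in coordinates with respect to an orthonormal basis of eigenvectors of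
  \<open>A\<close>, first for solutions with finitely many modes.
\<close>

section \<open>Orthonormal bases\<close>

text \<open>The obstacle is that \<open>P\<close> need not commute with \<open>A\<close>, so powers
  of \<open>A\<close> cannot carry an estimate from index -k up to index 0. Time differentiation
  does commute with \<open>P\<close>, and on a free solution each derivative costs exactly one
  index: the j-th derivative of w', measured in index -j, is bounded by the energy uniformly in the
  frequency. This is why the order of differentiation and the negative index are tied together
  everywhere. The index -k is forced. Component i-1 enters the cascade sum with index 1+(i-1)-n =
  -k, and each of the k+1 equations for u_i, ..., u_n gains one index over its source, so that a
  source in index -k ends in the energy of index 1 of u_n. The derivative of order k+1 needs
  \<open>P\<close> in index -(n-i+1), the last one covered by the coupling hypothesis. The
  interpolation integrates by parts against a weight that vanishes at both ends of the time
  interval. The interval is therefore lengthened by 1 on each side, so that the weight is at least 1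
  on the original window after a translation in time. Finitely many modes provide derivatives of all
  orders; a general free solution is reached by projection, uniformly on the compact orbit of
  w'.\<close>

definition orthonormal :: "'h::real_inner set \<Rightarrow> bool" where
  "orthonormal E \<longleftrightarrow> (\<forall>\<phi>\<in>E. \<forall>\<psi>\<in>E. \<phi> \<bullet> \<psi> = (if \<phi> = \<psi> then 1 else 0))"

definition proj :: "'h::real_inner set \<Rightarrow> 'h \<Rightarrow> 'h" where
  "proj F x = (\<Sum>\<phi>\<in>F. (x \<bullet> \<phi>) *\<^sub>R \<phi>)"

lemma linear_proj: "linear (proj F)"
  by (rule linearI) (simp_all add: proj_def inner_add_left scaleR_add_left sum.distrib scaleR_sum_right)

lemma inner_sum_orthonormal:
  assumes "orthonormal E" "finite F" "F \<subseteq> E" "\<phi> \<in> E"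
  shows "(\<Sum>\<psi>\<in>F. c \<psi> *\<^sub>R \<psi>) \<bullet> \<phi> = (if \<phi> \<in> F then c \<phi> else 0)"
proof -
  have "(\<Sum>\<psi>\<in>F. c \<psi> *\<^sub>R \<psi>) \<bullet> \<phi> = (\<Sum>\<psi>\<in>F. if \<psi> = \<phi> then c \<psi> else 0)"
    unfolding inner_sum_left using assms by (intro sum.cong) (auto simp: orthonormal_def)
  then show ?thesis using assms by simp
qed

lemma norm_sum_orthonormal:
  assumes "orthonormal E" "finite F" "F \<subseteq> E"
  shows "(norm (\<Sum>\<psi>\<in>F. c \<psi> *\<^sub>R \<psi>))^2 = (\<Sum>\<psi>\<in>F. (c \<psi>)^2)"
proof -
  have "(norm (\<Sum>\<psi>\<in>F. c \<psi> *\<^sub>R \<psi>))^2 = (\<Sum>\<phi>\<in>F. c \<phi> * ((\<Sum>\<psi>\<in>F. c \<psi> *\<^sub>R \<psi>) \<bullet> \<phi>))"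
    by (simp add: power2_norm_eq_inner inner_sum_right)
  also have "\<dots> = (\<Sum>\<psi>\<in>F. (c \<psi>)^2)"
    using assms by (intro sum.cong) (simp_all add: inner_sum_orthonormal[of E F] power2_eq_square subset_iff)
  finally show ?thesis .
qed

lemma norm_proj:
  assumes "orthonormal E" "finite F" "F \<subseteq> E"
  shows "(norm (proj F x))^2 = (\<Sum>\<phi>\<in>F. (x \<bullet> \<phi>)^2)"
  unfolding proj_def using assms by (rule norm_sum_orthonormal)

lemma inner_proj:
  assumes "orthonormal E" "finite F" "F \<subseteq> E" "\<phi> \<in> E"
  shows "proj F x \<bullet> \<phi> = (if \<phi> \<in> F then x \<bullet> \<phi> else 0)"
  unfolding proj_def using inner_sum_orthonormal[OF assms] .

lemma norm_diff_proj:
  assumes "orthonormal E" "finite F" "F \<subseteq> E"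
  shows "(norm (x - proj F x))^2 = (norm x)^2 - (\<Sum>\<phi>\<in>F. (x \<bullet> \<phi>)^2)"
proof -
  have "x \<bullet> proj F x = (\<Sum>\<phi>\<in>F. (x \<bullet> \<phi>)^2)"
    by (simp add: proj_def inner_sum_right power2_eq_square)
  moreover have "(norm (x - proj F x))^2 = (norm x)^2 - 2 * (x \<bullet> proj F x) + (norm (proj F x))^2"
    by (simp add: power2_norm_eq_inner inner_diff_left inner_diff_right inner_commute algebra_simps)
  ultimately show ?thesis using norm_proj[OF assms] by simp
qed

lemma bessel:
  assumes "orthonormal E" "finite F" "F \<subseteq> E"
  shows "(\<Sum>\<phi>\<in>F. (x \<bullet> \<phi>)^2) \<le> (norm x)^2"
  using norm_diff_proj[OF assms, of x] zero_le_power2[of "norm (x - proj F x)"] by simp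

lemma norm_proj_le:
  assumes "orthonormal E" "finite F" "F \<subseteq> E"
  shows "norm (proj F x) \<le> norm x"
  using bessel[OF assms, of x] norm_proj[OF assms, of x] by (simp add: power2_le_imp_le)

lemma summable_on_sq_bound:
  fixes c :: "'a \<Rightarrow> real"
  assumes "\<And>F. finite F \<Longrightarrow> F \<subseteq> E \<Longrightarrow> (\<Sum>\<phi>\<in>F. (c \<phi>)^2) \<le> K"
  shows "(\<lambda>\<phi>. (c \<phi>)^2) summable_on E"
  by (rule nonneg_bdd_above_summable_on) (use assms in \<open>auto intro!: bdd_aboveI[of _ K]\<close>)

lemma summable_on_sq_tail:
  fixes c :: "'a \<Rightarrow> real"
  assumes "(\<lambda>\<phi>. (c \<phi>)^2) summable_on E" "0 < e"
  obtains F where "finite F" "F \<subseteq> E"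
    "\<And>G. finite G \<Longrightarrow> G \<subseteq> E \<Longrightarrow> F \<inter> G = {} \<Longrightarrow> (\<Sum>\<phi>\<in>G. (c \<phi>)^2) < e"
proof -
  obtain S where S: "((\<lambda>\<phi>. (c \<phi>)^2) has_sum S) E"
    using assms(1) by (auto simp: summable_on_def)
  then obtain F where F: "finite F" "F \<subseteq> E" "dist (\<Sum>\<phi>\<in>F. (c \<phi>)^2) S < e"
    using assms(2) has_sum_finite_approximation[OF S, of "e/2"] by fastforce
  have "(\<Sum>\<phi>\<in>G. (c \<phi>)^2) < e" if G: "finite G" "G \<subseteq> E" "F \<inter> G = {}" for G
  proof -
    have "(\<Sum>\<phi>\<in>F. (c \<phi>)^2) + (\<Sum>\<phi>\<in>G. (c \<phi>)^2) = (\<Sum>\<phi>\<in>F \<union> G. (c \<phi>)^2)"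
      using F G by (simp add: sum.union_disjoint)
    also have "\<dots> \<le> S"
      by (rule finite_sum_le_has_sum[OF S]) (use F G in auto)
    finally show ?thesis using F(3) by (simp add: dist_real_def)
  qed
  with F that show thesis by blast
qed

text \<open>\<open>E\<close> may be uncountable here, so the series is a limit along finite subsets.
  Increasing finite sets \<open>F n\<close> with tails below \<open>(1 / real (Suc n))^2\<close>
  give Cauchy partial sums, and the partial sum over any finite set containing \<open>F n\<close>
  stays within \<open>1 / real (Suc n)\<close> of them, which carries the sequential limit over to
  the net.\<close>

lemma riesz_fischer:
  fixes E :: "'h::{real_inner,complete_space} set"
  assumes on: "orthonormal E" and c: "(\<lambda>\<phi>. (c \<phi>)^2) summable_on E"
  obtains x where "\<And>\<phi>. \<phi> \<in> E \<Longrightarrow> x \<bullet> \<phi> = c \<phi>"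
    and "((\<lambda>F. \<Sum>\<phi>\<in>F. c \<phi> *\<^sub>R \<phi>) \<longlongrightarrow> x) (finite_subsets_at_top E)"
proof -
  have "\<exists>F. finite F \<and> F \<subseteq> E \<and>
      (\<forall>G. finite G \<longrightarrow> G \<subseteq> E \<longrightarrow> F \<inter> G = {} \<longrightarrow> (\<Sum>\<phi>\<in>G. (c \<phi>)^2) < (1 / real (Suc n))^2)" for n
    by (rule summable_on_sq_tail[OF c, of "(1 / real (Suc n))^2"]) auto
  then obtain F0 where F0: "\<And>n. finite (F0 n)" "\<And>n. F0 n \<subseteq> E"
    "\<And>n G. finite G \<Longrightarrow> G \<subseteq> E \<Longrightarrow> F0 n \<inter> G = {} \<Longrightarrow> (\<Sum>\<phi>\<in>G. (c \<phi>)^2) < (1 / real (Suc n))^2"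
    by metis
  define F where "F n = (\<Union>m\<le>n. F0 m)" for n
  have F: "finite (F n)" "F n \<subseteq> E" for n
    using F0 by (auto simp: F_def)
  have F_mono: "F m \<subseteq> F n" if "m \<le> n" for m n
    using that by (force simp: F_def)
  have tail: "(\<Sum>\<phi>\<in>G. (c \<phi>)^2) < (1 / real (Suc n))^2" if "finite G" "G \<subseteq> E" "F n \<inter> G = {}" for n G
  proof (rule F0(3)[OF that(1,2)])
    show "F0 n \<inter> G = {}" using that(3) by (auto simp: F_def)
  qed
  define X where "X F' = (\<Sum>\<phi>\<in>F'. c \<phi> *\<^sub>R \<phi>)" for F'
  have X_diff: "norm (X F' - X (F m)) < 1 / real (Suc m)" if F': "F m \<subseteq> F'" "finite F'" "F' \<subseteq> E" for m F'
  proof -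
    have "X F' - X (F m) = (\<Sum>\<phi>\<in>F' - F m. c \<phi> *\<^sub>R \<phi>)"
      using sum.subset_diff[OF F'(1,2), of "\<lambda>\<phi>. c \<phi> *\<^sub>R \<phi>"] by (simp add: X_def)
    then have "(norm (X F' - X (F m)))^2 = (\<Sum>\<phi>\<in>F' - F m. (c \<phi>)^2)"
      using norm_sum_orthonormal[OF on, of "F' - F m" c] F' by auto
    also have "\<dots> < (1 / real (Suc m))^2"
      by (rule tail) (use F' in auto)
    finally show ?thesis by (rule power_less_imp_less_base) simp
  qed
  have "Cauchy (\<lambda>n. X (F n))"
  proof (rule CauchyI)
    fix e :: real assume "0 < e"
    then obtain N where N: "1 / real (Suc N) < e / 2"
      using nat_approx_posE[of "e / 2"] by auto
    have "norm (X (F m) - X (F n)) < e" if "m \<ge> N" "n \<ge> N" for m n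
      using X_diff[OF F_mono[OF that(1)] F] X_diff[OF F_mono[OF that(2)] F] N
        norm_triangle_ineq4[of "X (F m) - X (F N)" "X (F n) - X (F N)"] by simp
    then show "\<exists>N. \<forall>m\<ge>N. \<forall>n\<ge>N. norm (X (F m) - X (F n)) < e" by blast
  qed
  then obtain x where x: "(\<lambda>n. X (F n)) \<longlonglongrightarrow> x"
    using Cauchy_convergent convergent_def by blast
  have x_near: "norm (x - X (F m)) \<le> 1 / real (Suc m)" for m
  proof (rule tendsto_upperbound)
    show "(\<lambda>n. norm (X (F n) - X (F m))) \<longlonglongrightarrow> norm (x - X (F m))"
      by (intro tendsto_intros x)
    show "\<forall>\<^sub>F n in sequentially. norm (X (F n) - X (F m)) \<le> 1 / real (Suc m)"
      using X_diff[OF F_mono F] by (intro eventually_sequentiallyI[of m]) (simp add: less_imp_le)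
  qed simp
  have lim: "(X \<longlongrightarrow> x) (finite_subsets_at_top E)"
  proof (rule tendstoI)
    fix e :: real assume "0 < e"
    then obtain N where N: "1 / real (Suc N) < e / 2"
      using nat_approx_posE[of "e / 2"] by auto
    have "dist (X F') x < e" if "finite F'" "F N \<subseteq> F'" "F' \<subseteq> E" for F'
      using X_diff[OF that(2,1,3)] x_near[of N] N norm_triangle_ineq4[of "X F' - X (F N)" "x - X (F N)"]
      by (simp add: dist_norm)
    then show "\<forall>\<^sub>F F' in finite_subsets_at_top E. dist (X F') x < e"
      using F[of N] unfolding eventually_finite_subsets_at_top by blast
  qed
  have "x \<bullet> \<phi> = c \<phi>" if \<phi>: "\<phi> \<in> E" for \<phi>
  proof (rule tendsto_unique)
    show "((\<lambda>F'. X F' \<bullet> \<phi>) \<longlongrightarrow> x \<bullet> \<phi>) (finite_subsets_at_top E)"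
      by (intro tendsto_intros lim)
    have "X F' \<bullet> \<phi> = c \<phi>" if "finite F'" "{\<phi>} \<subseteq> F'" "F' \<subseteq> E" for F'
      using inner_sum_orthonormal[OF on that(1,3) \<phi>, of c] that(2) by (simp add: X_def)
    then have "\<forall>\<^sub>F F' in finite_subsets_at_top E. X F' \<bullet> \<phi> = c \<phi>"
      unfolding eventually_finite_subsets_at_top using \<phi> by (intro exI[of _ "{\<phi>}"]) auto
    then show "((\<lambda>F'. X F' \<bullet> \<phi>) \<longlongrightarrow> c \<phi>) (finite_subsets_at_top E)" by (rule tendsto_eventually)
  qed simp
  then show thesis by (rule that) (use lim in \<open>simp_all add: X_def[abs_def]\<close>)
qed

section \<open>Parseval, dominated convergence and adjoints in coordinates\<close>

locale orthonormal_basis =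
  fixes E :: "'h::{real_inner,complete_space} set"
  assumes on: "orthonormal E"
    and total: "(\<And>\<phi>. \<phi> \<in> E \<Longrightarrow> x \<bullet> \<phi> = 0) \<Longrightarrow> x = 0"
begin

lemma coords_eqI: "(\<And>\<phi>. \<phi> \<in> E \<Longrightarrow> x \<bullet> \<phi> = y \<bullet> \<phi>) \<Longrightarrow> x = y"
  using total[of "x - y"] by (simp add: inner_diff_left)

lemma inner_basis: "\<phi> \<in> E \<Longrightarrow> \<psi> \<in> E \<Longrightarrow> \<phi> \<bullet> \<psi> = (if \<phi> = \<psi> then 1 else 0)"
  using on by (simp add: orthonormal_def)

lemma summable_coords: "(\<lambda>\<phi>. (x \<bullet> \<phi>)^2) summable_on E"
  by (rule summable_on_sq_bound) (rule bessel[OF on])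

lemma proj_tendsto: "((\<lambda>F. proj F x) \<longlongrightarrow> x) (finite_subsets_at_top E)"
proof -
  obtain y where y: "\<And>\<phi>. \<phi> \<in> E \<Longrightarrow> y \<bullet> \<phi> = x \<bullet> \<phi>"
    "((\<lambda>F. \<Sum>\<phi>\<in>F. (x \<bullet> \<phi>) *\<^sub>R \<phi>) \<longlongrightarrow> y) (finite_subsets_at_top E)"
    using riesz_fischer[OF on summable_coords[of x]] by blast
  have "y = x" by (rule coords_eqI) (rule y(1))
  with y(2) show ?thesis by (simp add: proj_def)
qed

lemma has_sum_inner: "((\<lambda>\<phi>. (x \<bullet> \<phi>) * (y \<bullet> \<phi>)) has_sum (x \<bullet> y)) E"
proof -
  have "((\<lambda>F. proj F x \<bullet> y) \<longlongrightarrow> x \<bullet> y) (finite_subsets_at_top E)"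
    by (intro tendsto_intros proj_tendsto)
  moreover have "proj F x \<bullet> y = (\<Sum>\<phi>\<in>F. (x \<bullet> \<phi>) * (y \<bullet> \<phi>))" for F
    by (simp add: proj_def inner_sum_left inner_commute[of y])
  ultimately show ?thesis by (simp add: has_sum_def)
qed

lemma parseval: "((\<lambda>\<phi>. (x \<bullet> \<phi>)^2) has_sum (norm x)^2) E"
  using has_sum_inner[of x x] by (simp only: power2_eq_square[of "x \<bullet> _"] power2_norm_eq_inner)

lemma norm_sq_le:
  assumes "\<And>F. finite F \<Longrightarrow> F \<subseteq> E \<Longrightarrow> (\<Sum>\<phi>\<in>F. (x \<bullet> \<phi>)^2) \<le> K"
  shows "(norm x)^2 \<le> K"
  by (rule has_sum_le_finite_sums[OF parseval]) (use assms in auto)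

lemma norm_le_coords:
  assumes "\<And>\<phi>. \<phi> \<in> E \<Longrightarrow> \<bar>x \<bullet> \<phi>\<bar> \<le> \<bar>y \<bullet> \<phi>\<bar>"
  shows "norm x \<le> norm y"
proof -
  have "(norm x)^2 \<le> (norm y)^2"
    by (rule has_sum_mono[OF parseval parseval]) (use assms in \<open>simp add: abs_le_square_iff\<close>)
  then show ?thesis by (rule power2_le_imp_le) simp
qed

text \<open>Dominated convergence over \<open>E\<close>: finitely many coordinates converge, and the
  others are small uniformly in \<open>s\<close> because of the square-summable majorant
  \<open>b\<close>. It turns statements about scalar modes into limits in the Hilbert space.\<close>

lemma tendsto_coords:
  assumes lim: "\<And>\<phi>. \<phi> \<in> E \<Longrightarrow> ((\<lambda>s. x s \<bullet> \<phi>) \<longlongrightarrow> y \<bullet> \<phi>) Fl"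
    and dom: "\<forall>\<^sub>F s in Fl. \<forall>\<phi>\<in>E. \<bar>x s \<bullet> \<phi>\<bar> \<le> b \<phi>" "\<And>\<phi>. \<phi> \<in> E \<Longrightarrow> \<bar>y \<bullet> \<phi>\<bar> \<le> b \<phi>"
    and b: "(\<lambda>\<phi>. (b \<phi>)^2) summable_on E"
  shows "(x \<longlongrightarrow> y) Fl"
proof (rule tendstoI)
  fix e :: real assume e: "0 < e"
  \<comment> \<open>Coordinates of the difference are at most \<open>2 * b \<phi>\<close>, so
    squaring multiplies the tail by 4; tail and head then contribute \<open>e^2 / 4\<close>
    each.\<close>
  obtain F where F: "finite F" "F \<subseteq> E"
    "\<And>G. finite G \<Longrightarrow> G \<subseteq> E \<Longrightarrow> F \<inter> G = {} \<Longrightarrow> (\<Sum>\<phi>\<in>G. (b \<phi>)^2) < e^2 / 16"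
    by (rule summable_on_sq_tail[OF b, of "e^2 / 16"]) (use e in auto)
  have "((\<lambda>s. \<Sum>\<phi>\<in>F. ((x s - y) \<bullet> \<phi>)^2) \<longlongrightarrow> (\<Sum>\<phi>\<in>F. (y \<bullet> \<phi> - y \<bullet> \<phi>)^2)) Fl"
    unfolding inner_diff_left by (intro tendsto_intros lim) (use F(2) in auto)
  then have "\<forall>\<^sub>F s in Fl. (\<Sum>\<phi>\<in>F. ((x s - y) \<bullet> \<phi>)^2) < e^2 / 4"
    by (rule order_tendstoD) (use e in auto)
  then show "\<forall>\<^sub>F s in Fl. dist (x s) y < e"
    using dom(1)
  proof eventually_elim
    case (elim s)
    have "(norm (x s - y))^2 \<le> e^2 / 2"
    proof (rule norm_sq_le)
      fix G assume G: "finite G" "G \<subseteq> E"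
      have "(\<Sum>\<phi>\<in>G - F. ((x s - y) \<bullet> \<phi>)^2) \<le> (\<Sum>\<phi>\<in>G - F. 4 * (b \<phi>)^2)"
      proof (rule sum_mono)
        fix \<phi> assume "\<phi> \<in> G - F"
        then have "\<bar>(x s - y) \<bullet> \<phi>\<bar> \<le> 2 * b \<phi>"
          using elim(2) dom(2)[of \<phi>] G by (force simp: inner_diff_left)
        then have "((x s - y) \<bullet> \<phi>)^2 \<le> (2 * b \<phi>)^2" by (metis abs_ge_zero power2_abs power_mono)
        then show "((x s - y) \<bullet> \<phi>)^2 \<le> 4 * (b \<phi>)^2" by (simp add: power_mult_distrib)
      qed
      also have "\<dots> \<le> e^2 / 4"
      proof -
        have "(\<Sum>\<phi>\<in>G - F. (b \<phi>)^2) < e^2 / 16"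
          using G by (intro F(3)) auto
        then show ?thesis by (simp add: sum_distrib_left[symmetric])
      qed
      finally have 1: "(\<Sum>\<phi>\<in>G - F. ((x s - y) \<bullet> \<phi>)^2) \<le> e^2 / 4" .
      have "(\<Sum>\<phi>\<in>G. ((x s - y) \<bullet> \<phi>)^2) = (\<Sum>\<phi>\<in>G \<inter> F. ((x s - y) \<bullet> \<phi>)^2) + (\<Sum>\<phi>\<in>G - F. ((x s - y) \<bullet> \<phi>)^2)"
        using G by (metis sum.Int_Diff)
      moreover have "(\<Sum>\<phi>\<in>G \<inter> F. ((x s - y) \<bullet> \<phi>)^2) \<le> (\<Sum>\<phi>\<in>F. ((x s - y) \<bullet> \<phi>)^2)"
        using F by (intro sum_mono2) auto
      ultimately show "(\<Sum>\<phi>\<in>G. ((x s - y) \<bullet> \<phi>)^2) \<le> e^2 / 2" using 1 elim(1) by simp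
    qed
    also have "\<dots> < e^2" using e by simp
    finally have "norm (x s - y) < e" by (rule power_less_imp_less_base) (use e in simp)
    then show ?case by (simp add: dist_norm)
  qed
qed

lemma vector_from_coords:
  assumes "(\<lambda>\<phi>. (c \<phi>)^2) summable_on E"
  shows "\<exists>x. \<forall>\<phi>\<in>E. x \<bullet> \<phi> = c \<phi>"
  using riesz_fischer[OF on assms] by metis

text \<open>\<open>adjoint\<close> is defined by choice, so an adjoint has to be exhibited first.
  This is Riesz representation in coordinates: evaluating the functional at the finite sum
  \<open>v\<close> of its own coefficients bounds their sum of squares by
  \<open>(K * norm y)^2\<close>.\<close>

lemma adjoint_works_complete:
  fixes C :: "'h \<Rightarrow> 'k::real_inner"
  assumes "bounded_linear C"
  shows "C x \<bullet> y = x \<bullet> adjoint C y"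
proof -
  interpret C: bounded_linear C by fact
  have "\<exists>z. \<forall>x. C x \<bullet> y = x \<bullet> z" for y
  proof -
    obtain K where K: "\<And>x. norm (C x) \<le> norm x * K" "0 < K" using C.pos_bounded by blast
    have "(\<Sum>\<phi>\<in>F. (C \<phi> \<bullet> y)^2) \<le> (K * norm y)^2" if F: "finite F" "F \<subseteq> E" for F
    proof -
      define v where "v = (\<Sum>\<phi>\<in>F. (C \<phi> \<bullet> y) *\<^sub>R \<phi>)"
      have v: "(norm v)^2 = (\<Sum>\<phi>\<in>F. (C \<phi> \<bullet> y)^2)"
        unfolding v_def by (rule norm_sum_orthonormal[OF on F])
      have "(norm v)^2 = C v \<bullet> y"
        unfolding v by (simp add: v_def C.sum C.scaleR inner_sum_left power2_eq_square)
      also have "\<dots> \<le> (norm v * K) * norm y"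
        using K norm_cauchy_schwarz[of "C v" y] by (meson mult_right_mono norm_ge_zero order_trans)
      finally have "norm v * norm v \<le> norm v * (K * norm y)" by (simp add: power2_eq_square ac_simps)
      then have "norm v \<le> K * norm y"
        using K(2) by (cases "norm v = 0") (simp_all add: mult_le_cancel_left)
      then show ?thesis unfolding v[symmetric] by (rule power_mono) simp
    qed
    then have "(\<lambda>\<phi>. (C \<phi> \<bullet> y)^2) summable_on E" by (rule summable_on_sq_bound)
    then obtain z where z: "\<And>\<phi>. \<phi> \<in> E \<Longrightarrow> z \<bullet> \<phi> = C \<phi> \<bullet> y" using vector_from_coords[of "\<lambda>\<phi>. C \<phi> \<bullet> y"] by blast
    have "C x \<bullet> y = x \<bullet> z" for x
    proof (rule tendsto_unique)
      show "((\<lambda>F. C (proj F x) \<bullet> y) \<longlongrightarrow> C x \<bullet> y) (finite_subsets_at_top E)"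
        by (intro tendsto_intros C.tendsto proj_tendsto)
      have eq: "C (proj F x) \<bullet> y = proj F x \<bullet> z" if "F \<subseteq> E" for F
      proof -
        have "(x \<bullet> \<phi>) * (C \<phi> \<bullet> y) = (x \<bullet> \<phi>) * (\<phi> \<bullet> z)" if "\<phi> \<in> F" for \<phi>
          using z[of \<phi>] that \<open>F \<subseteq> E\<close> by (auto simp: inner_commute)
        then have "(\<Sum>\<phi>\<in>F. (x \<bullet> \<phi>) * (C \<phi> \<bullet> y)) = (\<Sum>\<phi>\<in>F. (x \<bullet> \<phi>) * (\<phi> \<bullet> z))" by (rule sum.cong[OF refl])
        then show ?thesis by (simp add: proj_def C.sum C.scaleR inner_sum_left)
      qed
      have "((\<lambda>F. proj F x \<bullet> z) \<longlongrightarrow> x \<bullet> z) (finite_subsets_at_top E)"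
        by (intro tendsto_intros proj_tendsto)
      then show "((\<lambda>F. C (proj F x) \<bullet> y) \<longlongrightarrow> x \<bullet> z) (finite_subsets_at_top E)"
        by (rule Lim_transform_eventually)
          (use eq in \<open>auto intro!: eventually_finite_subsets_at_top_weakI\<close>)
    qed simp
    then show ?thesis by blast
  qed
  then obtain C' where "\<forall>x y. C x \<bullet> y = x \<bullet> C' y" by metis
  then have "\<forall>x y. C x \<bullet> y = x \<bullet> adjoint C y"
    unfolding adjoint_def by (rule someI[where P = "\<lambda>C'. \<forall>x y. C x \<bullet> y = x \<bullet> C' y"])
  then show ?thesis by blast
qed

text \<open>Pointwise convergence of contractions is uniform on compact sets, by a finite
  \<open>e/3\<close>-net. Applied to the range of a continuous velocity, it makes the truncation
  error uniform in time.\<close>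

lemma proj_tendsto_uniform:
  assumes "compact S" "0 < e"
  shows "\<forall>\<^sub>F F in finite_subsets_at_top E. \<forall>x\<in>S. norm (proj F x - x) < e"
proof -
  obtain K where K: "finite K" "K \<subseteq> S" "S \<subseteq> (\<Union>x\<in>K. ball x (e/3))"
  proof (rule compactE_image[OF assms(1), of S "\<lambda>x. ball x (e/3)"])
    show "S \<subseteq> (\<Union>x\<in>S. ball x (e/3))" using assms(2) by force
  qed auto
  have "\<forall>\<^sub>F F in finite_subsets_at_top E. \<forall>x\<in>K. norm (proj F x - x) < e/3"
    using tendstoD[OF proj_tendsto, of "e/3"] assms(2)
    by (intro eventually_ball_finite K(1)) (auto simp: dist_norm)
  moreover have "\<forall>\<^sub>F F in finite_subsets_at_top E. finite F \<and> F \<subseteq> E"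
    by (rule eventually_finite_subsets_at_top_weakI) simp
  ultimately show ?thesis
  proof eventually_elim
    case (elim F)
    show ?case
    proof
      fix x assume "x \<in> S"
      then obtain k where k: "k \<in> K" "norm (x - k) < e/3"
        using K(3) by (auto simp: dist_norm norm_minus_commute)
      have "norm (proj F (x - k)) < e/3"
        using norm_proj_le[OF on, of F "x - k"] elim(2) k by simp
      moreover have "proj F x - x = (proj F (x - k) + (proj F k - k)) - (x - k)"
        by (simp add: linear_diff[OF linear_proj])
      moreover have "norm (proj F k - k) < e/3" using elim(1) k by blast
      ultimately show "norm (proj F x - x) < e"
        using k(2) norm_triangle_ineq4[of "proj F (x - k) + (proj F k - k)" "x - k"]
          norm_triangle_ineq[of "proj F (x - k)" "proj F k - k"] by auto
    qed
  qed
qed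

end

section \<open>The spectral theorem for compact symmetric operators\<close>

lemma orthonormal_norm_eq_1: "orthonormal E \<Longrightarrow> \<phi> \<in> E \<Longrightarrow> norm \<phi> = 1"
  by (simp add: orthonormal_def norm_eq_sqrt_inner)

text \<open>The classical argument: a maximising sequence for \<open>norm (R x)\<close> on the unit sphere of \<open>M\<close>
  accumulates at an eigenvector of \<open>R\<^sup>2\<close> with eigenvalue \<open>s\<^sup>2\<close>, and \<open>R\<^sup>2 - s\<^sup>2 = (R - s) (R + s)\<close>.\<close>

lemma compact_symmetric_eigenvector:
  fixes R :: "'h::real_inner \<Rightarrow> 'h"
  assumes R: "bounded_linear R" and cpt: "compact (closure (R ` cball 0 1))"
    and sym: "\<And>x y. R x \<bullet> y = x \<bullet> R y"
    and M: "subspace M" "closed M" "\<And>x. x \<in> M \<Longrightarrow> R x \<in> M" "M \<noteq> {0}"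
  obtains v r where "v \<in> M" "norm v = 1" "R v = r *\<^sub>R v"
proof -
  interpret R: bounded_linear R by fact
  have norm_unit: "norm (x /\<^sub>R norm x) = 1" if "x \<noteq> 0" for x :: 'h
    using that by simp
  obtain x0 where x0: "x0 \<in> M" "norm x0 = 1"
  proof -
    obtain x where "x \<in> M" "x \<noteq> 0" using M(1,4) subspace_0 by blast
    then show thesis using that[of "x /\<^sub>R norm x"] M(1) norm_unit by (simp add: subspace_mul)
  qed
  define Q where "Q = {norm (R x) | x. x \<in> M \<and> norm x = 1}"
  define s where "s = Sup Q"
  obtain K where K: "\<And>x. norm (R x) \<le> norm x * K" using R.bounded by blast
  have bdd: "bdd_above Q" proof (rule bdd_aboveI[of _ K])
    fix q assume "q \<in> Q"
    then obtain x where "q = norm (R x)" "norm x = 1" by (auto simp: Q_def)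
    then show "q \<le> K" using K[of x] by simp
  qed
  have ne: "Q \<noteq> {}" using x0 by (auto simp: Q_def)
  have s_upper: "norm (R x) \<le> s * norm x" if "x \<in> M" for x
  proof (cases "x = 0")
    case False
    have "norm (R (x /\<^sub>R norm x)) \<le> s"
      unfolding s_def using that False M(1) norm_unit[OF False]
      by (intro cSup_upper bdd) (auto simp: Q_def subspace_mul)
    then show ?thesis using False by (simp add: R.scaleR field_simps)
  qed (simp add: R.zero)
  have s0: "0 \<le> s"  proof -
    have "norm (R x0) \<le> s" using s_upper[OF x0(1)] x0(2) by simp
    then show ?thesis by (rule order_trans[OF norm_ge_zero])
  qed
  show thesis
  proof (cases "s = 0")
    case True
    then have "R x0 = 0" using s_upper[OF x0(1)] by simp
    then show thesis using that[of x0 0] x0 by simp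
  next
    case False
    then have s: "0 < s" using s0 by simp
    have "\<exists>x. x \<in> M \<and> norm x = 1 \<and> s - 1 / real (Suc n) < norm (R x)" for n
      using less_cSup_iff[OF ne bdd, of "s - 1 / real (Suc n)"] by (auto simp: s_def Q_def)
    then obtain x where x: "\<And>n. x n \<in> M" "\<And>n. norm (x n) = 1"
      "\<And>n. s - 1 / real (Suc n) < norm (R (x n))" by metis
    have lim_s: "(\<lambda>n. norm (R (x n))) \<longlonglongrightarrow> s"
    proof (rule tendsto_sandwich)
      show "(\<lambda>n. s - 1 / real (Suc n)) \<longlonglongrightarrow> s"
        using tendsto_diff[OF tendsto_const[of s] LIMSEQ_inverse_real_of_nat]
        by (simp add: inverse_eq_divide)
      show "\<forall>\<^sub>F n in sequentially. s - 1 / real (Suc n) \<le> norm (R (x n))"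
        using x(3) by (simp add: less_imp_le)
      show "\<forall>\<^sub>F n in sequentially. norm (R (x n)) \<le> s"
        using s_upper[OF x(1)] x(2) by simp
    qed simp
    have "R (x n) \<in> closure (R ` cball 0 1)" for n
    proof -
      have "R (x n) \<in> R ` cball 0 1" by (rule imageI) (simp add: x(2))
      then show ?thesis by (rule subsetD[OF closure_subset])
    qed
    then obtain z and \<sigma> :: "nat \<Rightarrow> nat" where z: "strict_mono \<sigma>" "(\<lambda>n. R (x (\<sigma> n))) \<longlonglongrightarrow> z"
      using cpt seq_compactE[of "closure (R ` cball 0 1)" "\<lambda>n. R (x n)"]
      unfolding compact_eq_seq_compact_metric o_def by blast
    have lim_s': "(\<lambda>n. norm (R (x (\<sigma> n)))) \<longlonglongrightarrow> s"
      using LIMSEQ_subseq_LIMSEQ[OF lim_s z(1)] by (simp add: o_def)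
    have "(\<lambda>n. norm (R (R (x (\<sigma> n))) - s^2 *\<^sub>R x (\<sigma> n))) \<longlonglongrightarrow> 0"
    proof (rule tendsto_sandwich)
      show "\<forall>\<^sub>F n in sequentially. 0 \<le> norm (R (R (x (\<sigma> n))) - s^2 *\<^sub>R x (\<sigma> n))" by simp
      show "(\<lambda>n. 0) \<longlonglongrightarrow> (0::real)" by simp
      have "(\<lambda>n. sqrt (s^2 * (s^2 - (norm (R (x (\<sigma> n))))^2))) \<longlonglongrightarrow> sqrt (s^2 * (s^2 - s^2))"
        by (intro tendsto_intros lim_s')
      then show "(\<lambda>n. sqrt (s^2 * (s^2 - (norm (R (x (\<sigma> n))))^2))) \<longlonglongrightarrow> 0" by simp
      \<comment> \<open>Expanding the square gives
        \<open>(norm (R (R y)))^2 - 2 * s^2 * (norm (R y))^2 + s^4\<close>, and the first term is at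
        most \<open>s^2 * (norm (R y))^2\<close> because \<open>R y\<close> lies in \<open>M\<close>
        as well. The bound tends to 0 along the maximising sequence.\<close>
      have "norm (R (R y) - s^2 *\<^sub>R y) \<le> sqrt (s^2 * (s^2 - (norm (R y))^2))" if y: "y \<in> M" "norm y = 1" for y
      proof (rule real_le_rsqrt)
        have "R (R y) \<bullet> (s^2 *\<^sub>R y) = s^2 * (norm (R y))^2"
          by (simp add: sym[of "R y" y] power2_norm_eq_inner)
        moreover have "norm (s^2 *\<^sub>R y) = s^2" using y(2) by simp
        ultimately have 1: "(norm (R (R y) - s^2 *\<^sub>R y))^2 = (norm (R (R y)))^2 + s^2 * s^2 - 2 * (s^2 * (norm (R y))^2)"
          using dot_norm_neg[of "R (R y)" "s^2 *\<^sub>R y"] by (simp only:) (simp add: power2_eq_square[of "s^2"])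
        have "(norm (R (R y)))^2 \<le> (s * norm (R y))^2"
          by (rule power_mono[OF s_upper]) (use M(3) y in auto)
        with 1 show "(norm (R (R y) - s^2 *\<^sub>R y))^2 \<le> s^2 * (s^2 - (norm (R y))^2)"
          by (simp add: power_mult_distrib right_diff_distrib)
      qed
      then show "\<forall>\<^sub>F n in sequentially. norm (R (R (x (\<sigma> n))) - s^2 *\<^sub>R x (\<sigma> n)) \<le> sqrt (s^2 * (s^2 - (norm (R (x (\<sigma> n))))^2))"
        using x by simp
    qed
    then have "(\<lambda>n. R (R (x (\<sigma> n))) - s^2 *\<^sub>R x (\<sigma> n)) \<longlonglongrightarrow> 0"
      by (simp add: tendsto_norm_zero_iff)
    \<comment> \<open>Compactness gives convergence of \<open>R (x (\<sigma> n))\<close> only;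
      convergence of \<open>x (\<sigma> n)\<close> itself is recovered by solving for it in the
      difference that tends to 0, which is possible since \<open>s\<close> is positive.\<close>
    then have "(\<lambda>n. (R (R (x (\<sigma> n))) - (R (R (x (\<sigma> n))) - s^2 *\<^sub>R x (\<sigma> n))) /\<^sub>R s^2) \<longlonglongrightarrow> (R z - 0) /\<^sub>R s^2"
      by (intro tendsto_intros R.tendsto z(2))
    then have lim_x: "(\<lambda>n. x (\<sigma> n)) \<longlonglongrightarrow> R z /\<^sub>R s^2"
      using s by simp
    define y where "y = R z /\<^sub>R s^2"
    have yM: "y \<in> M"
      using closed_sequentially[OF M(2) _ lim_x] x(1) by (simp add: y_def)
    have ny: "norm y = 1"
      using tendsto_norm[OF lim_x] x(2) by (simp add: y_def LIMSEQ_const_iff)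
    have "(\<lambda>n. R (x (\<sigma> n))) \<longlonglongrightarrow> R y"
      unfolding y_def by (intro R.tendsto lim_x)
    then have "R y = z" using z(2) LIMSEQ_unique by blast
    then have RRy: "R (R y) = s^2 *\<^sub>R y" using s by (simp add: y_def)
    define u where "u = R y + s *\<^sub>R y"
    have Ru: "R u = s *\<^sub>R u"
      by (simp add: u_def R.add R.scaleR RRy scaleR_add_right power2_eq_square)
    have uM: "u \<in> M" unfolding u_def using M(1,3) yM by (simp add: subspace_add subspace_mul)
    show thesis
    proof (cases "u = 0")
      case True
      then have "R y = (- s) *\<^sub>R y" by (simp add: u_def add_eq_0_iff2)
      then show thesis using that yM ny by blast
    next
      case False
      then show thesis
        using that[of "u /\<^sub>R norm u" s] uM Ru M(1) by (simp add: subspace_mul R.scaleR)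
    qed
  qed
qed

text \<open>Zorn's lemma gives a maximal orthonormal set of eigenvectors, the eigenvalue 0 being
  allowed. Its orthogonal complement is closed and invariant under \<open>R\<close> by symmetry; a
  nonzero complement would contain a further unit eigenvector, against maximality.\<close>

lemma compact_symmetric_eigenbasis:
  fixes R :: "'h::{real_inner,complete_space} \<Rightarrow> 'h"
  assumes R: "bounded_linear R" and cpt: "compact (closure (R ` cball 0 1))"
    and sym: "\<And>x y. R x \<bullet> y = x \<bullet> R y"
  obtains E where "orthonormal_basis E" "\<And>\<phi>. \<phi> \<in> E \<Longrightarrow> \<exists>r. R \<phi> = r *\<^sub>R \<phi>"
proof -
  interpret R: bounded_linear R by fact
  define P where "P = {E. orthonormal E \<and> (\<forall>\<phi>\<in>E. \<exists>r. R \<phi> = r *\<^sub>R \<phi>)}"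
  have "\<exists>E\<in>P. \<forall>X\<in>P. E \<subseteq> X \<longrightarrow> X = E"
  proof (rule subset_Zorn')
    fix Ch assume ch: "subset.chain P Ch"
    have "\<phi> \<bullet> \<psi> = (if \<phi> = \<psi> then 1 else 0)" if un: "\<phi> \<in> \<Union>Ch" "\<psi> \<in> \<Union>Ch" for \<phi> \<psi>
    proof -
      obtain X Y where "X \<in> Ch" "\<phi> \<in> X" "Y \<in> Ch" "\<psi> \<in> Y" using un by blast
      moreover have "X \<subseteq> Y \<or> Y \<subseteq> X" using ch calculation by (auto simp: subset.chain_def)
      ultimately obtain Z where "Z \<in> Ch" "\<phi> \<in> Z" "\<psi> \<in> Z" by blast
      then show ?thesis using ch by (auto simp: subset.chain_def P_def orthonormal_def)
    qed
    then show "\<Union>Ch \<in> P"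
      using ch by (auto simp: P_def orthonormal_def subset.chain_def)
  qed
  then obtain E where E: "E \<in> P" "\<And>X. X \<in> P \<Longrightarrow> E \<subseteq> X \<Longrightarrow> X = E" by blast
  define M where "M = {x. \<forall>\<phi>\<in>E. x \<bullet> \<phi> = 0}"
  have M_sub: "subspace M"
    by (auto simp: M_def subspace_def inner_add_left)
  have "M = (\<Inter>\<phi>\<in>E. {x. x \<bullet> \<phi> = 0})" by (auto simp: M_def)
  then have M_closed: "closed M"
    by (auto intro!: closed_INT closed_Collect_eq continuous_intros)
  have M_R: "R x \<in> M" if "x \<in> M" for x
    using that E(1) by (force simp: M_def P_def sym)
  have "M = {0}"
  proof (rule ccontr)
    assume "M \<noteq> {0}"
    then obtain v r where v: "v \<in> M" "norm v = 1" "R v = r *\<^sub>R v"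
      using compact_symmetric_eigenvector[OF R cpt sym M_sub M_closed M_R] by blast
    have vv: "v \<bullet> v = 1" using v(2) by (simp add: norm_eq_1)
    then have "v \<notin> E" using v(1) by (auto simp: M_def)
    moreover have "insert v E \<in> P"
    proof -
      have "v \<bullet> \<phi> = 0" "\<phi> \<bullet> v = 0" if "\<phi> \<in> E" for \<phi>
        using v(1) that by (auto simp: M_def inner_commute)
      then show ?thesis using v(3) vv E(1) \<open>v \<notin> E\<close> by (auto simp: P_def orthonormal_def)
    qed
    ultimately show False using E(2)[of "insert v E"] by blast
  qed
  then have "orthonormal_basis E"
    using E(1) by unfold_locales (auto simp: P_def M_def)
  then show thesis using that E(1) by (auto simp: P_def)
qed

text \<open>By Pythagoras the images of two distinct basis vectors are at squared distance
  \<open>(r \<phi>)^2 + (r \<psi>)^2\<close>. Hence those with \<open>\<bar>r \<phi>\<bar>\<close>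
  above a fixed threshold have uniformly separated images in a compact set and are finite in
  number.\<close>

lemma countable_eigenbasis:
  fixes R :: "'h::real_inner \<Rightarrow> 'h"
  assumes cpt: "compact (closure (R ` cball 0 1))" and on: "orthonormal E"
    and eig: "\<And>\<phi>. \<phi> \<in> E \<Longrightarrow> R \<phi> = r \<phi> *\<^sub>R \<phi> \<and> r \<phi> \<noteq> 0"
  shows "countable E"
proof -
  define En where "En n = {\<phi>\<in>E. 1 / real (Suc n) < \<bar>r \<phi>\<bar>}" for n
  have "finite (En n)" for n
  proof -
    have dist: "1 / real (Suc n) \<le> dist (R \<phi>) (R \<psi>)" if "\<phi> \<in> En n" "\<psi> \<in> En n" "\<phi> \<noteq> \<psi>" for \<phi> \<psi>
    proof -
      have e: "\<phi> \<in> E" "\<psi> \<in> E" using that by (auto simp: En_def)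
      have "(dist (R \<phi>) (R \<psi>))^2 = (r \<phi>)^2 + (r \<psi>)^2"
      proof -
        have "\<phi> \<bullet> \<phi> = 1" "\<psi> \<bullet> \<psi> = 1" "\<phi> \<bullet> \<psi> = 0" "\<psi> \<bullet> \<phi> = 0"
          using on e that(3) by (auto simp: orthonormal_def)
        then show ?thesis
          by (simp only: eig[OF e(1), THEN conjunct1] eig[OF e(2), THEN conjunct1] dist_norm
            power2_norm_eq_inner inner_diff_left inner_diff_right inner_scaleR_left inner_scaleR_right)
            (simp add: power2_eq_square)
      qed
      then have "\<bar>r \<phi>\<bar>^2 \<le> (dist (R \<phi>) (R \<psi>))^2" by simp
      then have "\<bar>r \<phi>\<bar> \<le> dist (R \<phi>) (R \<psi>)" by (rule power2_le_imp_le) simp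
      then show ?thesis using that(1) by (simp add: En_def)
    qed
    have ge: "0 < 1 / real (Suc n)" by simp
    have "uniform_discrete (R ` En n)"
      unfolding uniform_discrete_def
    proof (intro exI[of _ "1 / real (Suc n)"] conjI ge ballI impI)
      fix x y assume "x \<in> R ` En n" "y \<in> R ` En n" "dist x y < 1 / real (Suc n)"
      then obtain \<phi> \<psi> where "\<phi> \<in> En n" "\<psi> \<in> En n" "x = R \<phi>" "y = R \<psi>" "dist (R \<phi>) (R \<psi>) < 1 / real (Suc n)"
        by blast
      then show "x = y" using dist[of \<phi> \<psi>] by (cases "\<phi> = \<psi>") auto
    qed
    then have "discrete (R ` En n)" "closed (R ` En n)"
      by (auto intro: uniform_discrete_imp_discrete uniform_discrete_imp_closed)
    moreover have "R ` En n \<subseteq> closure (R ` cball 0 1)"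
    proof -
      have "En n \<subseteq> cball 0 1" using on by (auto simp: En_def orthonormal_norm_eq_1)
      then have "R ` En n \<subseteq> R ` cball 0 1" by (rule image_mono)
      then show ?thesis by (rule order_trans[OF _ closure_subset])
    qed
    ultimately have "finite (R ` En n)"
      using compact_Int_closed[OF cpt, of "R ` En n"] discrete_compact_finite_iff[of "R ` En n"]
      by (simp add: Int_absorb1)
    moreover have "inj_on R (En n)"
    proof (rule inj_onI)
      fix \<phi> \<psi> assume "\<phi> \<in> En n" "\<psi> \<in> En n" "R \<phi> = R \<psi>"
      then show "\<phi> = \<psi>" using dist[of \<phi> \<psi>] ge by (cases "\<phi> = \<psi>") auto
    qed
    ultimately show ?thesis by (simp add: finite_image_iff)
  qed
  moreover have "E = (\<Union>n. En n)"
  proof -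
    have "\<exists>n. 1 / real (Suc n) < \<bar>r \<phi>\<bar>" if "\<phi> \<in> E" for \<phi>
    proof -
      have "0 < \<bar>r \<phi>\<bar>" using eig[OF that] by simp
      then show ?thesis by (rule nat_approx_posE) blast
    qed
    then show ?thesis by (auto simp: En_def)
  qed
  ultimately show ?thesis by (simp add: countable_finite)
qed

section \<open>Powers of the operator in the eigenbasis\<close>

text \<open>Symmetry against eigenvectors gives the coordinates of \<open>T x\<close>. The
  description of the domain uses the maximality contained in self-adjointness: square-summability
  produces a vector \<open>z\<close> that places \<open>x\<close> in the domain of the adjoint,
  which is \<open>V\<close>.\<close>

lemma (in orthonormal_basis) self_adjoint_diagonal:
  assumes T: "self_adjoint_op V T" and eig: "\<And>\<phi>. \<phi> \<in> E \<Longrightarrow> \<phi> \<in> V \<and> T \<phi> = \<tau> \<phi> *\<^sub>R \<phi>"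
  shows "x \<in> V \<Longrightarrow> \<phi> \<in> E \<Longrightarrow> T x \<bullet> \<phi> = \<tau> \<phi> * (x \<bullet> \<phi>)"
    and "x \<in> V \<longleftrightarrow> (\<lambda>\<phi>. (\<tau> \<phi> * (x \<bullet> \<phi>))^2) summable_on E"
proof -
  have sym: "T x \<bullet> y = x \<bullet> T y" if "x \<in> V" "y \<in> V" for x y
    using T that by (auto simp: self_adjoint_op_def)
  show coord: "T x \<bullet> \<phi> = \<tau> \<phi> * (x \<bullet> \<phi>)" if "x \<in> V" "\<phi> \<in> E" for x \<phi>
    using sym[of x \<phi>] that eig[OF that(2)] by simp
  show "x \<in> V \<longleftrightarrow> (\<lambda>\<phi>. (\<tau> \<phi> * (x \<bullet> \<phi>))^2) summable_on E"
  proof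
    assume "x \<in> V"
    have "(\<lambda>\<phi>. (T x \<bullet> \<phi>)^2) summable_on E" by (rule summable_coords)
    then show "(\<lambda>\<phi>. (\<tau> \<phi> * (x \<bullet> \<phi>))^2) summable_on E"
      by (rule summable_on_cong[THEN iffD1, rotated]) (simp add: coord \<open>x \<in> V\<close>)
  next
    assume "(\<lambda>\<phi>. (\<tau> \<phi> * (x \<bullet> \<phi>))^2) summable_on E"
    then obtain z where z: "\<And>\<phi>. \<phi> \<in> E \<Longrightarrow> z \<bullet> \<phi> = \<tau> \<phi> * (x \<bullet> \<phi>)"
      using vector_from_coords[of "\<lambda>\<phi>. \<tau> \<phi> * (x \<bullet> \<phi>)"] by blast
    have "T y \<bullet> x = y \<bullet> z" if "y \<in> V" for y
    proof (rule has_sum_unique[OF has_sum_inner])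
      have eq: "(T y \<bullet> \<phi>) * (x \<bullet> \<phi>) = (y \<bullet> \<phi>) * (z \<bullet> \<phi>)" if "\<phi> \<in> E" for \<phi>
        by (simp add: coord[OF \<open>y \<in> V\<close> that] z[OF that])
      show "((\<lambda>\<phi>. (T y \<bullet> \<phi>) * (x \<bullet> \<phi>)) has_sum (y \<bullet> z)) E"
        using has_sum_inner[of y z] by (rule has_sum_cong[THEN iffD1, rotated]) (simp add: eq)
    qed
    then have "x \<in> adjoint_dom V T" by (auto simp: adjoint_dom_def)
    then show "x \<in> V" using T by (simp add: self_adjoint_op_def)
  qed
qed

lemma (in orthonormal_basis) closure_dom_diagonal:
  assumes "subspace V" "E \<subseteq> V"
  shows "closure V = UNIV"
proof -
  have "x \<in> closure V" for x
  proof (rule Lim_in_closed_set[OF closed_closure _ _ proj_tendsto[of x]])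
    show "\<forall>\<^sub>F F in finite_subsets_at_top E. proj F x \<in> closure V"
    proof (rule eventually_finite_subsets_at_top_weakI)
      fix F assume F: "finite F" "F \<subseteq> E"
      have "proj F x \<in> V" unfolding proj_def
        by (rule subspace_sum[OF assms(1)], rule subspace_mul[OF assms(1)]) (use F(2) assms(2) in auto)
      then show "proj F x \<in> closure V" by (rule subsetD[OF closure_subset])
    qed
  qed simp
  then show ?thesis by auto
qed

text \<open>A diagonal operator on its maximal domain is self-adjoint: pairing with basis vectors
  shows that \<open>z\<close> in the adjoint relation has coordinates
  \<open>\<tau> \<phi> * (y \<bullet> \<phi>)\<close>, which forces \<open>y\<close> into
  \<open>V\<close>. It serves to construct a square root of \<open>A\<close>.\<close>

lemma (in orthonormal_basis) self_adjoint_diagonalI: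
  assumes V: "V = {x. (\<lambda>\<phi>. (\<tau> \<phi> * (x \<bullet> \<phi>))^2) summable_on E}"
    and T: "\<And>x \<phi>. x \<in> V \<Longrightarrow> \<phi> \<in> E \<Longrightarrow> T x \<bullet> \<phi> = \<tau> \<phi> * (x \<bullet> \<phi>)"
  shows "self_adjoint_op V T"
proof -
  have basis: "\<psi> \<in> V" if "\<psi> \<in> E" for \<psi>
  proof -
    have "(\<Sum>\<phi>\<in>F. (\<tau> \<phi> * (\<psi> \<bullet> \<phi>))^2) \<le> (\<tau> \<psi>)^2" if F: "finite F" "F \<subseteq> E" for F
    proof -
      have "(\<Sum>\<phi>\<in>F. (\<tau> \<phi> * (\<psi> \<bullet> \<phi>))^2) = (\<Sum>\<phi>\<in>F. if \<phi> = \<psi> then (\<tau> \<psi>)^2 else 0)"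
        using F \<open>\<psi> \<in> E\<close> by (intro sum.cong) (auto simp: inner_basis subset_iff)
      also have "\<dots> \<le> (\<tau> \<psi>)^2" using F by simp
      finally show ?thesis .
    qed
    then show ?thesis unfolding V mem_Collect_eq by (rule summable_on_sq_bound)
  qed
  have sub: "subspace V"
    unfolding subspace_def
  proof (intro conjI allI ballI)
    show "0 \<in> V" by (simp add: V)
    show "x + y \<in> V" if "x \<in> V" "y \<in> V" for x y
    proof -
      have "(\<lambda>\<phi>. 2 * (\<tau> \<phi> * (x \<bullet> \<phi>))^2 + 2 * (\<tau> \<phi> * (y \<bullet> \<phi>))^2) summable_on E"
        using that unfolding V by (intro summable_on_add summable_on_cmult_right) auto
      then have "(\<lambda>\<phi>. (\<tau> \<phi> * ((x + y) \<bullet> \<phi>))^2) summable_on E"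
      proof (rule summable_on_comparison_test)
        fix \<phi>
        show "(\<tau> \<phi> * ((x + y) \<bullet> \<phi>))^2 \<le> 2 * (\<tau> \<phi> * (x \<bullet> \<phi>))^2 + 2 * (\<tau> \<phi> * (y \<bullet> \<phi>))^2"
          using sum_squares_bound[of "\<tau> \<phi> * (x \<bullet> \<phi>)" "\<tau> \<phi> * (y \<bullet> \<phi>)"]
          by (simp add: inner_add_left distrib_left power2_sum)
      qed simp
      then show ?thesis by (simp add: V)
    qed
    show "c *\<^sub>R x \<in> V" if "x \<in> V" for c x
    proof -
      have "(\<lambda>\<phi>. c^2 * (\<tau> \<phi> * (x \<bullet> \<phi>))^2) summable_on E"
        using that unfolding V by (intro summable_on_cmult_right) auto
      then show ?thesis by (simp add: V power_mult_distrib ac_simps)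
    qed
  qed
  have lin: "linear_on V T"
    unfolding linear_on_def
  proof (intro conjI sub ballI allI)
    show "T (x + y) = T x + T y" if "x \<in> V" "y \<in> V" for x y
      by (rule coords_eqI) (simp add: T that subspace_add[OF sub] inner_add_left distrib_left)
    show "T (c *\<^sub>R x) = c *\<^sub>R T x" if "x \<in> V" for c x
      by (rule coords_eqI) (simp add: T that subspace_mul[OF sub])
  qed
  have sym: "T x \<bullet> y = x \<bullet> T y" if "x \<in> V" "y \<in> V" for x y
  proof (rule has_sum_unique[OF has_sum_inner])
    have eq: "(T x \<bullet> \<phi>) * (y \<bullet> \<phi>) = (x \<bullet> \<phi>) * (T y \<bullet> \<phi>)" if "\<phi> \<in> E" for \<phi>
      by (simp add: T[OF \<open>x \<in> V\<close> that] T[OF \<open>y \<in> V\<close> that])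
    show "((\<lambda>\<phi>. (T x \<bullet> \<phi>) * (y \<bullet> \<phi>)) has_sum (x \<bullet> T y)) E"
      using has_sum_inner[of x "T y"] by (rule has_sum_cong[THEN iffD1, rotated]) (simp add: eq)
  qed
  have "adjoint_dom V T \<subseteq> V"
  proof
    fix y assume "y \<in> adjoint_dom V T"
    then obtain z where z: "\<And>x. x \<in> V \<Longrightarrow> T x \<bullet> y = x \<bullet> z" by (auto simp: adjoint_dom_def)
    have "T \<phi> = \<tau> \<phi> *\<^sub>R \<phi>" if "\<phi> \<in> E" for \<phi>
      by (rule coords_eqI) (use that in \<open>auto simp: T basis inner_basis\<close>)
    then have "z \<bullet> \<phi> = \<tau> \<phi> * (y \<bullet> \<phi>)" if "\<phi> \<in> E" for \<phi>
      using z[OF basis[OF that]] that by (simp add: inner_commute)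
    moreover have "(\<lambda>\<phi>. (z \<bullet> \<phi>)^2) summable_on E" by (rule summable_coords)
    ultimately have "(\<lambda>\<phi>. (\<tau> \<phi> * (y \<bullet> \<phi>))^2) summable_on E"
      by (metis (mono_tags, lifting) summable_on_cong)
    then show "y \<in> V" by (simp add: V)
  qed
  moreover have "V \<subseteq> adjoint_dom V T"
    using sym by (auto simp: adjoint_dom_def)
  ultimately show ?thesis
    unfolding self_adjoint_op_def using lin sym closure_dom_diagonal[OF sub] basis by auto
qed

text \<open>The diagonal model in which the later arguments take place. \<open>lam\<close> lists the
  eigenvalues of the square root of \<open>A\<close>, so those of \<open>A\<close> are
  \<open>(lam \<phi>)^2\<close>. For negative \<open>z\<close>, \<open>nat z\<close> is 0 and the
  membership condition of the last assumption holds for every \<open>x\<close>.\<close>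

locale wave_setting = orthonormal_basis E for E :: "'h::{real_inner,complete_space} set" +
  fixes D :: "'h set" and A :: "'h \<Rightarrow> 'h" and lam :: "'h \<Rightarrow> real" and l0 :: real
  assumes l0: "0 < l0" and lam_ge: "\<phi> \<in> E \<Longrightarrow> l0 \<le> lam \<phi>" and countable_basis: "countable E"
    and Hsp_iff: "x \<in> Hsp D A k \<longleftrightarrow> (\<lambda>\<phi>. (lam \<phi> ^ k * (x \<bullet> \<phi>))^2) summable_on E"
    and half_pow_coord: "x \<in> Hsp D A (nat z) \<Longrightarrow> \<phi> \<in> E \<Longrightarrow> half_pow D A z x \<bullet> \<phi> = lam \<phi> powi z * (x \<bullet> \<phi>)"

lemma (in orthonormal_basis) wave_settingI:
  fixes lam :: "'h \<Rightarrow> real"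
  assumes l0: "0 < l0" and lam_ge: "\<And>\<phi>. \<phi> \<in> E \<Longrightarrow> l0 \<le> lam \<phi>" and count: "countable E"
    and S: "self_adjoint_op (sqrt_dom D A) (sqrt_fun D A)"
    and eig: "\<And>\<phi>. \<phi> \<in> E \<Longrightarrow> \<phi> \<in> sqrt_dom D A \<and> sqrt_fun D A \<phi> = lam \<phi> *\<^sub>R \<phi>"
  shows "wave_setting E D A lam l0"
proof
  show "0 < l0" "\<phi> \<in> E \<Longrightarrow> l0 \<le> lam \<phi>" "countable E" for \<phi> by fact+
  let ?V = "sqrt_dom D A" and ?S = "sqrt_fun D A"
  have lam_pos: "0 < lam \<phi>" if "\<phi> \<in> E" for \<phi> using lam_ge[OF that] l0 by simp
  have coord: "?S x \<bullet> \<phi> = lam \<phi> * (x \<bullet> \<phi>)" if "x \<in> ?V" "\<phi> \<in> E" for x \<phi>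
    using self_adjoint_diagonal(1)[OF S eig that(1,2)] .
  have dom: "x \<in> ?V \<longleftrightarrow> (\<lambda>\<phi>. (lam \<phi> * (x \<bullet> \<phi>))^2) summable_on E" for x
    using self_adjoint_diagonal(2)[OF S eig] .
  show Hsp_iff: "x \<in> Hsp D A k \<longleftrightarrow> (\<lambda>\<phi>. (lam \<phi> ^ k * (x \<bullet> \<phi>))^2) summable_on E" for x k
  proof (induction k arbitrary: x)
    case 0
    then show ?case using summable_coords by simp
  next
    case (Suc k)
    have "x \<in> ?V" if "(\<lambda>\<phi>. (lam \<phi> ^ Suc k * (x \<bullet> \<phi>))^2) summable_on E"
    proof -
      have "(\<lambda>\<phi>. (1 / l0 ^ k)^2 * (lam \<phi> ^ Suc k * (x \<bullet> \<phi>))^2) summable_on E"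
        using that by (rule summable_on_cmult_right)
      then have "(\<lambda>\<phi>. (lam \<phi> * (x \<bullet> \<phi>))^2) summable_on E"
      proof (rule summable_on_comparison_test)
        fix \<phi> assume "\<phi> \<in> E"
        have "l0 ^ k \<le> lam \<phi> ^ k" using lam_ge[OF \<open>\<phi> \<in> E\<close>] l0 by (intro power_mono) auto
        then have "1 \<le> 1 / l0 ^ k * lam \<phi> ^ k" using l0 by (simp add: field_simps)
        then have "1 * (lam \<phi> * (x \<bullet> \<phi>))^2 \<le> (1 / l0 ^ k * lam \<phi> ^ k)^2 * (lam \<phi> * (x \<bullet> \<phi>))^2"
          by (intro mult_right_mono) auto
        then show "(lam \<phi> * (x \<bullet> \<phi>))^2 \<le> (1 / l0 ^ k)^2 * (lam \<phi> ^ Suc k * (x \<bullet> \<phi>))^2"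
          by (simp add: power_mult_distrib power_divide ac_simps)
      qed simp
      then show ?thesis by (simp add: dom)
    qed
    moreover have "(\<lambda>\<phi>. (lam \<phi> ^ k * (?S x \<bullet> \<phi>))^2) summable_on E \<longleftrightarrow>
        (\<lambda>\<phi>. (lam \<phi> ^ Suc k * (x \<bullet> \<phi>))^2) summable_on E" if "x \<in> ?V"
      by (rule summable_on_cong) (simp add: coord[OF that] ac_simps)
    ultimately show ?case by (auto simp: Suc.IH)
  qed
  have pos: "half_pow D A (int k) x \<bullet> \<phi> = lam \<phi> ^ k * (x \<bullet> \<phi>)" if "x \<in> Hsp D A k" "\<phi> \<in> E" for x \<phi> k
    using that(1)
  proof (induction k arbitrary: x)
    case 0
    then show ?case by (simp add: half_pow_def)
  next
    case (Suc k)
    have "half_pow D A (int (Suc k)) x = half_pow D A (int k) (?S x)"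
      unfolding half_pow_def by (simp only: of_nat_0_le_iff if_True nat_int funpow_Suc_right o_def)
    then show ?case using Suc \<open>\<phi> \<in> E\<close> by (simp add: coord)
  qed
  \<comment> \<open>Negative powers are iterates of \<open>inv_into\<close>, which inverts
    \<open>?S\<close> only on its range, so the range has to be the whole space.\<close>
  have surj: "?S ` ?V = UNIV"
  proof -
    have "y \<in> ?S ` ?V" for y
    proof -
      have "(\<lambda>\<phi>. (1 / l0)^2 * (y \<bullet> \<phi>)^2) summable_on E"
        using summable_coords by (rule summable_on_cmult_right)
      then have "(\<lambda>\<phi>. (y \<bullet> \<phi> / lam \<phi>)^2) summable_on E"
      proof (rule summable_on_comparison_test)
        fix \<phi> assume "\<phi> \<in> E"
        then show "(y \<bullet> \<phi> / lam \<phi>)^2 \<le> (1 / l0)^2 * (y \<bullet> \<phi>)^2"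
          using lam_ge[of \<phi>] l0 by (simp add: power_divide frac_le)
      qed simp
      then obtain x where x: "\<And>\<phi>. \<phi> \<in> E \<Longrightarrow> x \<bullet> \<phi> = y \<bullet> \<phi> / lam \<phi>"
        using vector_from_coords[of "\<lambda>\<phi>. y \<bullet> \<phi> / lam \<phi>"] by blast
      have lx: "lam \<phi> * (x \<bullet> \<phi>) = y \<bullet> \<phi>" if "\<phi> \<in> E" for \<phi> using x[OF that] lam_pos[OF that] by simp
      then have "(\<lambda>\<phi>. (lam \<phi> * (x \<bullet> \<phi>))^2) summable_on E"
        using summable_coords[of y] by (subst summable_on_cong[of E _ "\<lambda>\<phi>. (y \<bullet> \<phi>)^2"]) auto
      then have "x \<in> ?V" by (simp add: dom)
      moreover from this have "?S x = y" by (intro coords_eqI) (simp add: coord lx)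
      ultimately show ?thesis by blast
    qed
    then show ?thesis by auto
  qed
  have neg: "(inv_into ?V ?S ^^ k) x \<bullet> \<phi> = x \<bullet> \<phi> / lam \<phi> ^ k" if "\<phi> \<in> E" for x \<phi> k
  proof (induction k)
    case (Suc k)
    let ?y = "(inv_into ?V ?S ^^ k) x"
    have "?S (inv_into ?V ?S ?y) = ?y" "inv_into ?V ?S ?y \<in> ?V"
      using surj by (simp_all add: f_inv_into_f inv_into_into)
    then have "lam \<phi> * (inv_into ?V ?S ?y \<bullet> \<phi>) = ?y \<bullet> \<phi>" using coord that by metis
    then show ?case using Suc lam_pos[OF that] by (simp add: field_simps)
  qed simp
  show "half_pow D A z x \<bullet> \<phi> = lam \<phi> powi z * (x \<bullet> \<phi>)"
    if "x \<in> Hsp D A (nat z)" "\<phi> \<in> E" for x \<phi> z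
  proof (cases "0 \<le> z")
    case True
    then show ?thesis using pos[OF that] by (simp add: power_int_def)
  next
    case False
    then show ?thesis using neg[OF that(2), of "nat (- z)" x]
      by (simp add: half_pow_def power_int_def field_simps)
  qed
qed

lemma abstract_setting_diagonalizable:
  fixes D :: "'h::{real_inner,complete_space} set"
  assumes "abstract_setting D A"
  obtains E lam l0 where "wave_setting E D A lam l0"
proof -
  obtain \<omega> where \<omega>: "0 < \<omega>" "\<And>x. x \<in> D \<Longrightarrow> \<omega> * norm x \<le> norm (A x)"
    using assms by (auto simp: abstract_setting_def)
  have sa: "self_adjoint_op D A" and pos: "\<And>x. x \<in> D \<Longrightarrow> 0 \<le> A x \<bullet> x"
    using assms by (auto simp: abstract_setting_def positive_op_def)
  obtain l R where R: "bounded_linear R" "compact (closure (R ` cball 0 1))"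
    "\<And>x. R x \<in> D" "\<And>x. A (R x) - l *\<^sub>R R x = x"
    using assms by (auto simp: abstract_setting_def compact_resolvent_def compact_op_def)
  interpret R: bounded_linear R by fact
  have Dsub: "subspace D" and Ascale: "\<And>c x. x \<in> D \<Longrightarrow> A (c *\<^sub>R x) = c *\<^sub>R A x"
    and Asym: "\<And>x y. x \<in> D \<Longrightarrow> y \<in> D \<Longrightarrow> A x \<bullet> y = x \<bullet> A y"
    using sa by (auto simp: self_adjoint_op_def linear_on_def)
  have Rsym: "R x \<bullet> y = x \<bullet> R y" for x y
  proof -
    have "R x \<bullet> (A (R y) - l *\<^sub>R R y) = (A (R x) - l *\<^sub>R R x) \<bullet> R y"
      by (simp add: inner_diff_left inner_diff_right Asym R(3))
    then show ?thesis by (simp add: R(4))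
  qed
  obtain E where E: "orthonormal_basis E" "\<And>\<phi>. \<phi> \<in> E \<Longrightarrow> \<exists>r. R \<phi> = r *\<^sub>R \<phi>"
    using compact_symmetric_eigenbasis[OF R(1,2) Rsym] by blast
  then obtain r where r: "\<And>\<phi>. \<phi> \<in> E \<Longrightarrow> R \<phi> = r \<phi> *\<^sub>R \<phi>" by metis
  interpret orthonormal_basis E by (rule E(1))
  have nz: "norm \<phi> = 1" if "\<phi> \<in> E" for \<phi> using on that by (rule orthonormal_norm_eq_1)
  have r_nz: "r \<phi> \<noteq> 0" if "\<phi> \<in> E" for \<phi>
  proof
    assume "r \<phi> = 0"
    then have "R \<phi> = 0" using r[OF that] by simp
    moreover have "A 0 = 0" using Ascale[OF subspace_0[OF Dsub], of 0] by simp
    ultimately have "\<phi> = 0" using R(4)[of \<phi>] by simp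
    then show False using nz[OF that] by simp
  qed
  have \<phi>D: "\<phi> \<in> D" if "\<phi> \<in> E" for \<phi>
  proof -
    have "\<phi> = (1 / r \<phi>) *\<^sub>R R \<phi>" using r[OF that] r_nz[OF that] by simp
    then show ?thesis using R(3) subspace_mul[OF Dsub] by metis
  qed
  \<comment> \<open>Read off from \<open>A (R \<phi>) - l *\<^sub>R R \<phi> = \<phi>\<close> with
    \<open>R \<phi> = r \<phi> *\<^sub>R \<phi>\<close>.\<close>
  define \<mu> where "\<mu> \<phi> = l + 1 / r \<phi>" for \<phi>
  have A\<phi>: "A \<phi> = \<mu> \<phi> *\<^sub>R \<phi>" if "\<phi> \<in> E" for \<phi>
  proof -
    have "r \<phi> *\<^sub>R A \<phi> - (l * r \<phi>) *\<^sub>R \<phi> = \<phi>"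
      using R(4)[of \<phi>] r[OF that] Ascale[OF \<phi>D[OF that], of "r \<phi>"] by simp
    then have "r \<phi> *\<^sub>R A \<phi> = (1 + l * r \<phi>) *\<^sub>R \<phi>" by (simp add: algebra_simps)
    then have "(1 / r \<phi>) *\<^sub>R (r \<phi> *\<^sub>R A \<phi>) = (1 / r \<phi>) *\<^sub>R ((1 + l * r \<phi>) *\<^sub>R \<phi>)" by simp
    then show ?thesis using r_nz[OF that] by (simp add: \<mu>_def add_divide_distrib add.commute)
  qed
  \<comment> \<open>The coercivity bound controls only the absolute value of
    \<open>\<mu> \<phi>\<close>; positivity of \<open>A\<close> supplies the sign.\<close>
  have \<mu>_ge: "\<omega> \<le> \<mu> \<phi>" if "\<phi> \<in> E" for \<phi>
    using pos[OF \<phi>D[OF that]] \<omega>(2)[OF \<phi>D[OF that]] A\<phi>[OF that] nz[OF that] on that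
    by (simp add: orthonormal_def)
  have \<mu>_pos: "0 < \<mu> \<phi>" if "\<phi> \<in> E" for \<phi> using \<mu>_ge[OF that] \<omega>(1) by simp
  have Aeig: "\<phi> \<in> D \<and> A \<phi> = \<mu> \<phi> *\<^sub>R \<phi>" if "\<phi> \<in> E" for \<phi> using \<phi>D A\<phi> that by blast
  have Acoord: "A x \<bullet> \<phi> = \<mu> \<phi> * (x \<bullet> \<phi>)" if "x \<in> D" "\<phi> \<in> E" for x \<phi>
    using self_adjoint_diagonal(1)[OF sa Aeig that(1,2)] .
  have Adom: "x \<in> D \<longleftrightarrow> (\<lambda>\<phi>. (\<mu> \<phi> * (x \<bullet> \<phi>))^2) summable_on E" for x
    using self_adjoint_diagonal(2)[OF sa Aeig] .
  \<comment> \<open>An explicit diagonal square root. It shows that the choice in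
    \<open>sqrt_op\<close> is made from a nonempty set, so that the chosen pair really is a positive
    square root.\<close>
  define V0 where "V0 = {x. (\<lambda>\<phi>. (sqrt (\<mu> \<phi>) * (x \<bullet> \<phi>))^2) summable_on E}"
  define S0 where "S0 x = (SOME y. \<forall>\<phi>\<in>E. y \<bullet> \<phi> = sqrt (\<mu> \<phi>) * (x \<bullet> \<phi>))" for x
  have S0: "S0 x \<bullet> \<phi> = sqrt (\<mu> \<phi>) * (x \<bullet> \<phi>)" if "x \<in> V0" "\<phi> \<in> E" for x \<phi>
    using someI_ex[OF vector_from_coords[of "\<lambda>\<phi>. sqrt (\<mu> \<phi>) * (x \<bullet> \<phi>)"]] that
    by (simp add: V0_def S0_def)
  have "is_positive_sqrt D A V0 S0"
    unfolding is_positive_sqrt_def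
  proof (intro conjI ballI)
    show "self_adjoint_op V0 S0" by (rule self_adjoint_diagonalI[OF V0_def S0])
    show "positive_op V0 S0"
      unfolding positive_op_def
    proof
      fix x assume x: "x \<in> V0"
      show "0 \<le> S0 x \<bullet> x"
        by (rule has_sum_nonneg[OF has_sum_inner]) (simp add: S0[OF x] \<mu>_pos less_imp_le mult.assoc)
    qed
    have D_V0: "x \<in> V0" if "x \<in> D" for x
    proof -
      have "(\<lambda>\<phi>. (1 / \<omega>) * (\<mu> \<phi> * (x \<bullet> \<phi>))^2) summable_on E"
        using that Adom[of x] by (intro summable_on_cmult_right) auto
      then have "(\<lambda>\<phi>. (sqrt (\<mu> \<phi>) * (x \<bullet> \<phi>))^2) summable_on E"
      proof (rule summable_on_comparison_test)
        fix \<phi> assume "\<phi> \<in> E"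
        have "\<mu> \<phi> * (x \<bullet> \<phi>)^2 * \<omega> \<le> \<mu> \<phi> * (x \<bullet> \<phi>)^2 * \<mu> \<phi>"
          using \<mu>_ge[OF \<open>\<phi> \<in> E\<close>] \<mu>_pos[OF \<open>\<phi> \<in> E\<close>] by (intro mult_left_mono) auto
        then show "(sqrt (\<mu> \<phi>) * (x \<bullet> \<phi>))^2 \<le> (1 / \<omega>) * (\<mu> \<phi> * (x \<bullet> \<phi>))^2"
          using \<omega>(1) \<mu>_pos[OF \<open>\<phi> \<in> E\<close>] by (simp add: power_mult_distrib field_simps power2_eq_square)
      qed simp
      then show ?thesis by (simp add: V0_def)
    qed
    have S0_iff: "S0 x \<in> V0 \<longleftrightarrow> x \<in> D" if "x \<in> V0" for x
    proof -
      have "S0 x \<in> V0 \<longleftrightarrow> (\<lambda>\<phi>. (\<mu> \<phi> * (x \<bullet> \<phi>))^2) summable_on E"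
        unfolding V0_def mem_Collect_eq
        by (rule summable_on_cong) (simp add: S0[OF that] \<mu>_pos less_imp_le mult.assoc[symmetric])
      then show ?thesis using Adom[of x] by simp
    qed
    show "{x \<in> V0. S0 x \<in> V0} = D" using D_V0 S0_iff by auto
    show "S0 (S0 x) = A x" if "x \<in> D" for x
      using that D_V0[OF that] S0_iff[of x]
      by (intro coords_eqI) (simp add: S0 Acoord \<mu>_pos less_imp_le mult.assoc[symmetric])
  qed
  then have "is_positive_sqrt D A (fst (V0, S0)) (snd (V0, S0))" by simp
  then have sq: "is_positive_sqrt D A (sqrt_dom D A) (sqrt_fun D A)"
    unfolding sqrt_dom_def sqrt_fun_def sqrt_op_def
    by (rule someI[where P = "\<lambda>p. is_positive_sqrt D A (fst p) (snd p)"])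
  let ?V = "sqrt_dom D A" and ?S = "sqrt_fun D A"
  have Sadd: "?S (x + c *\<^sub>R y) = ?S x + c *\<^sub>R ?S y" and Vadd: "x + c *\<^sub>R y \<in> ?V"
    if "x \<in> ?V" "y \<in> ?V" for x y c
    using sq that by (auto simp: is_positive_sqrt_def self_adjoint_op_def linear_on_def subspace_add subspace_mul)
  have eig: "\<phi> \<in> ?V \<and> ?S \<phi> = sqrt (\<mu> \<phi>) *\<^sub>R \<phi>" if "\<phi> \<in> E" for \<phi>
  proof -
    have V: "\<phi> \<in> ?V" "?S \<phi> \<in> ?V" "?S (?S \<phi>) = \<mu> \<phi> *\<^sub>R \<phi>"
      using sq \<phi>D[OF that] A\<phi>[OF that] by (auto simp: is_positive_sqrt_def)
    \<comment> \<open>The chosen root is diagonal in the same basis: from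
      \<open>?S (?S \<phi>) = \<mu> \<phi> *\<^sub>R \<phi>\<close> this \<open>y\<close> is an
      eigenvector of \<open>?S\<close> for a negative value unless it is 0, and positivity excludes
      the former.\<close>
    define y where "y = ?S \<phi> + (- sqrt (\<mu> \<phi>)) *\<^sub>R \<phi>"
    have "?S y = (- sqrt (\<mu> \<phi>)) *\<^sub>R y"
      unfolding y_def Sadd[OF V(2,1)] V(3) using \<mu>_pos[OF that] by (simp add: scaleR_diff_right)
    moreover have "0 \<le> ?S y \<bullet> y"
      using sq Vadd[OF V(2,1)] unfolding is_positive_sqrt_def positive_op_def y_def by blast
    ultimately have "sqrt (\<mu> \<phi>) * (y \<bullet> y) \<le> 0" by simp
    then have "y = 0" using \<mu>_pos[OF that] inner_ge_zero[of y] inner_eq_zero_iff[of y]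
      by (auto simp: mult_le_0_iff)
    then show ?thesis using V(1) by (simp add: y_def)
  qed
  have "countable E" using R(2) on by (rule countable_eigenbasis) (use r r_nz in blast)
  then have "wave_setting E D A (\<lambda>\<phi>. sqrt (\<mu> \<phi>)) (sqrt \<omega>)"
    using \<omega>(1) \<mu>_ge sq eig by (intro wave_settingI) (auto simp: is_positive_sqrt_def)
  then show thesis by (rule that)
qed

section \<open>Calculus in coordinates\<close>

lemma LINT_continuous:
  fixes h :: "real \<Rightarrow> real"
  assumes "continuous_on {a..b} h"
  shows "set_integrable lebesgue {a..b} h" "(LINT t:{a..b}|lebesgue. h t) = integral {a..b} h"
  using absolutely_integrable_continuous_real[OF assms] set_lebesgue_integral_eq_integral by blast+

lemma integral_mono_continuous:
  fixes f g :: "real \<Rightarrow> real"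
  assumes "continuous_on {a..b} f" "continuous_on {a..b} g" "\<And>t. t \<in> {a..b} \<Longrightarrow> f t \<le> g t"
  shows "integral {a..b} f \<le> integral {a..b} g"
  by (rule integral_le) (use assms in \<open>auto intro: integrable_continuous_real\<close>)

lemma integral_mono_interval:
  fixes f :: "real \<Rightarrow> real"
  assumes "continuous_on {a..b} f" "\<And>t. t \<in> {a..b} \<Longrightarrow> 0 \<le> f t" "{c..d} \<subseteq> {a..b}"
  shows "integral {c..d} f \<le> integral {a..b} f"
proof (rule integral_subset_le[OF assms(3)])
  show "f integrable_on {c..d}" "f integrable_on {a..b}"
    using assms(1) continuous_on_subset[OF assms(1,3)] by (auto intro: integrable_continuous_real)
qed (use assms(2) in auto)

lemma integral_le_const:
  fixes f :: "real \<Rightarrow> real"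
  assumes "0 \<le> T" "continuous_on {0..T} f" "\<And>t. t \<in> {0..T} \<Longrightarrow> f t \<le> K"
  shows "integral {0..T} f \<le> T * K"
  using integral_mono_continuous[OF assms(2) continuous_on_const, of K] assms(1,3) by simp

text \<open>Cauchy-Schwarz against the constant 1, obtained by integrating the square of the
  deviation of \<open>g\<close> from its mean \<open>I / t\<close>.\<close>

lemma integral_square_le:
  fixes g :: "real \<Rightarrow> real"
  assumes t: "0 \<le> t" and g: "continuous_on {0..t} g"
  shows "(integral {0..t} g)^2 \<le> t * integral {0..t} (\<lambda>s. (g s)^2)"
proof (cases "t = 0")
  case False
  define I where "I = integral {0..t} g"
  define J where "J = integral {0..t} (\<lambda>s. (g s)^2)"
  have int: "(g has_integral I) {0..t}" "((\<lambda>s. (g s)^2) has_integral J) {0..t}"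
    unfolding I_def J_def
    by (rule integrable_integral, rule integrable_continuous_real, intro continuous_intros g)+
  have "((\<lambda>s. ((g s)^2 - (2 * I / t) * g s) + (I / t)^2) has_integral (J - (2 * I / t) * I) + t * (I / t)^2) {0..t}"
    using has_integral_const_real[of "(I / t)^2" 0 t] t
    by (intro has_integral_add has_integral_diff has_integral_mult_right int) simp
  note int' = integral_unique[OF this]
  have "0 \<le> integral {0..t} (\<lambda>s. (g s - I / t)^2)"
    by (rule integral_nonneg) (auto intro!: integrable_continuous_real continuous_intros g)
  also have "integral {0..t} (\<lambda>s. (g s - I / t)^2) = integral {0..t} (\<lambda>s. ((g s)^2 - (2 * I / t) * g s) + (I / t)^2)"
    by (rule arg_cong[where f = "integral _"]) (auto simp: power2_diff field_simps)
  also have "\<dots> = J - I^2 / t"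
    unfolding int' using False by (simp add: power2_eq_square field_simps)
  finally show ?thesis using t False by (simp add: I_def J_def field_simps)
qed simp

text \<open>Rotating the phase vector \<open>(y', lam y)\<close> back along the free flow turns the equation into a
  quadrature.\<close>

lemma oscillator_energy:
  fixes y y' h :: "real \<Rightarrow> real"
  assumes T: "t \<in> {0..T}" and h: "continuous_on {0..T} h"
    and y: "\<And>t. t \<in> {0..T} \<Longrightarrow> (y has_real_derivative y' t) (at t within {0..T})"
    and y': "\<And>t. t \<in> {0..T} \<Longrightarrow> (y' has_real_derivative h t - lam^2 * y t) (at t within {0..T})"
  shows "(lam * y t)^2 + (y' t)^2 \<le> 2 * ((lam * y 0)^2 + (y' 0)^2) + 2 * T * integral {0..T} (\<lambda>s. (h s)^2)"
proof -
  have t: "0 \<le> t" "{0..t} \<subseteq> {0..T}" using T by auto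
  define p where "p s = cos (lam * s) * y' s + lam * sin (lam * s) * y s" for s
  define q where "q s = sin (lam * s) * y' s - lam * cos (lam * s) * y s" for s
  have "((\<lambda>s. cos (lam * s) * h s) has_integral p t - p 0) {0..t}"
  proof (rule fundamental_theorem_of_calculus[OF t(1)])
    fix s assume s: "s \<in> {0..t}"
    then have "(p has_real_derivative cos (lam * s) * h s) (at s within {0..T})"
      unfolding p_def using t(2)
      by (auto intro!: derivative_eq_intros y y' simp: algebra_simps power2_eq_square)
    then show "(p has_vector_derivative cos (lam * s) * h s) (at s within {0..t})"
      using t(2) by (auto simp: has_real_derivative_iff_has_vector_derivative intro: has_vector_derivative_within_subset)
  qed
  then have p: "p t = p 0 + integral {0..t} (\<lambda>s. cos (lam * s) * h s)" by (auto dest: integral_unique)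
  have "((\<lambda>s. sin (lam * s) * h s) has_integral q t - q 0) {0..t}"
  proof (rule fundamental_theorem_of_calculus[OF t(1)])
    fix s assume s: "s \<in> {0..t}"
    then have "(q has_real_derivative sin (lam * s) * h s) (at s within {0..T})"
      unfolding q_def using t(2)
      by (auto intro!: derivative_eq_intros y y' simp: algebra_simps power2_eq_square)
    then show "(q has_vector_derivative sin (lam * s) * h s) (at s within {0..t})"
      using t(2) by (auto simp: has_real_derivative_iff_has_vector_derivative intro: has_vector_derivative_within_subset)
  qed
  then have q: "q t = q 0 + integral {0..t} (\<lambda>s. sin (lam * s) * h s)" by (auto dest: integral_unique)
  have pq: "(p s)^2 + (q s)^2 = (lam * y s)^2 + (y' s)^2" for s
  proof -
    have "(p s)^2 + (q s)^2 = ((cos (lam * s))^2 + (sin (lam * s))^2) * ((lam * y s)^2 + (y' s)^2)"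
      unfolding p_def q_def by algebra
    then show ?thesis by simp
  qed
  have ht: "continuous_on {0..t} h" using h t(2) by (rule continuous_on_subset)
  define a where "a = integral {0..t} (\<lambda>s. cos (lam * s) * h s)"
  define b where "b = integral {0..t} (\<lambda>s. sin (lam * s) * h s)"
  have "a^2 + b^2 \<le> t * integral {0..t} (\<lambda>s. (cos (lam * s) * h s)^2) + t * integral {0..t} (\<lambda>s. (sin (lam * s) * h s)^2)"
    unfolding a_def b_def
    by (intro add_mono integral_square_le t(1)) (auto intro!: continuous_intros ht)
  also have "\<dots> = t * integral {0..t} (\<lambda>s. (cos (lam * s) * h s)^2 + (sin (lam * s) * h s)^2)"
    unfolding distrib_left[symmetric]
    by (subst integral_add) (auto intro!: integrable_continuous_real continuous_intros ht)
  also have "(\<lambda>s. (cos (lam * s) * h s)^2 + (sin (lam * s) * h s)^2) = (\<lambda>s. (h s)^2)"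
    by (auto simp: power_mult_distrib distrib_right[symmetric])
  also have "t * integral {0..t} (\<lambda>s. (h s)^2) \<le> T * integral {0..T} (\<lambda>s. (h s)^2)"
    using T t(2) by (intro mult_mono integral_mono_interval)
      (auto intro!: continuous_intros h integral_nonneg integrable_continuous_real continuous_on_subset[OF h])
  finally have ab: "a^2 + b^2 \<le> T * integral {0..T} (\<lambda>s. (h s)^2)" .
  have "(p t)^2 \<le> 2 * (p 0)^2 + 2 * a^2" "(q t)^2 \<le> 2 * (q 0)^2 + 2 * b^2"
    unfolding p q a_def[symmetric] b_def[symmetric]
    using sum_squares_bound[of "p 0" a] sum_squares_bound[of "q 0" b] by (auto simp: power2_sum)
  then show ?thesis unfolding pq[symmetric] using ab by (simp add: distrib_left)
qed

text \<open>Variation of constants: the solution is the integral of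
  \<open>sin (lam * (t - s)) * h s / lam\<close> over \<open>s\<close>. The addition formula
  separates \<open>t\<close> from \<open>s\<close>, so that only the primitives \<open>c\<close> and
  \<open>d\<close> have to be differentiated.\<close>

lemma oscillator_exists:
  fixes h :: "real \<Rightarrow> real"
  assumes h: "continuous_on {0..T} h" and lam: "lam \<noteq> 0"
  shows "\<exists>y y'. y 0 = 0 \<and> y' 0 = 0 \<and> (\<forall>t\<in>{0..T}. (y has_real_derivative y' t) (at t within {0..T}) \<and>
    (y' has_real_derivative h t - lam^2 * y t) (at t within {0..T}))"
proof -
  define c where "c t = integral {0..t} (\<lambda>s. cos (lam * s) * h s)" for t
  define d where "d t = integral {0..t} (\<lambda>s. sin (lam * s) * h s)" for t
  have c: "(c has_real_derivative cos (lam * t) * h t) (at t within {0..T})" if "t \<in> {0..T}" for t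
    unfolding has_real_derivative_iff_has_vector_derivative c_def
    by (rule integral_has_vector_derivative[OF _ that]) (intro continuous_intros h)
  have d: "(d has_real_derivative sin (lam * t) * h t) (at t within {0..T})" if "t \<in> {0..T}" for t
    unfolding has_real_derivative_iff_has_vector_derivative d_def
    by (rule integral_has_vector_derivative[OF _ that]) (intro continuous_intros h)
  define y where "y t = (sin (lam * t) * c t - cos (lam * t) * d t) / lam" for t
  define y' where "y' t = cos (lam * t) * c t + sin (lam * t) * d t" for t
  have "(y has_real_derivative y' t) (at t within {0..T})" if "t \<in> {0..T}" for t
    unfolding y_def y'_def using that lam
    by (auto intro!: derivative_eq_intros c d simp: field_simps)
  moreover have "(y' has_real_derivative h t - lam^2 * y t) (at t within {0..T})" if "t \<in> {0..T}" for t
  proof -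
    have "lam * (h t * (cos (lam * t) * cos (lam * t))) + lam * (h t * (sin (lam * t) * sin (lam * t))) =
        lam * (h t * (cos (lam * t) * cos (lam * t) + sin (lam * t) * sin (lam * t)))"
      by (simp only: distrib_left)
    then show ?thesis unfolding y'_def y_def sin_cos_squared_add3 using that lam
      by (auto intro!: derivative_eq_intros c d simp: field_simps power2_eq_square)
  qed
  moreover have "y 0 = 0" "y' 0 = 0" by (simp_all add: y_def y'_def c_def d_def)
  ultimately show ?thesis by blast
qed

section \<open>Continuity, derivatives and integrals of Hilbert-valued maps from their
  coordinates\<close>

context orthonormal_basis
begin

lemma continuous_on_coords:
  assumes "\<And>\<phi>. \<phi> \<in> E \<Longrightarrow> continuous_on S (\<lambda>t. x t \<bullet> \<phi>)"
    and bd: "\<And>\<phi> t. \<phi> \<in> E \<Longrightarrow> t \<in> S \<Longrightarrow> \<bar>x t \<bullet> \<phi>\<bar> \<le> b \<phi>"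
    and b: "(\<lambda>\<phi>. (b \<phi>)^2) summable_on E"
  shows "continuous_on S x"
  unfolding continuous_on_def
proof
  fix t assume t: "t \<in> S"
  show "(x \<longlongrightarrow> x t) (at t within S)"
  proof (rule tendsto_coords[OF _ _ _ b])
    show "((\<lambda>s. x s \<bullet> \<phi>) \<longlongrightarrow> x t \<bullet> \<phi>) (at t within S)" if "\<phi> \<in> E" for \<phi>
      using assms(1)[OF that] t by (auto simp: continuous_on_def)
    show "\<forall>\<^sub>F s in at t within S. \<forall>\<phi>\<in>E. \<bar>x s \<bullet> \<phi>\<bar> \<le> b \<phi>"
      using bd by (auto simp: eventually_at_filter)
    show "\<bar>x t \<bullet> \<phi>\<bar> \<le> b \<phi>" if "\<phi> \<in> E" for \<phi> using bd[OF that t] .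
  qed
qed

text \<open>The mean value theorem on the convex set \<open>S\<close> bounds each coordinate of a
  difference quotient by \<open>b \<phi>\<close>, and subtracting the derivative at \<open>t\<close>
  at most doubles the bound; dominated convergence then applies to the remainder
  \<open>q\<close>.\<close>

lemma has_vector_derivative_coords:
  fixes S :: "real set"
  assumes S: "convex S" "t \<in> S"
    and d: "\<And>\<phi> s. \<phi> \<in> E \<Longrightarrow> s \<in> S \<Longrightarrow> ((\<lambda>t. x t \<bullet> \<phi>) has_real_derivative x' s \<bullet> \<phi>) (at s within S)"
    and bd: "\<And>\<phi> s. \<phi> \<in> E \<Longrightarrow> s \<in> S \<Longrightarrow> \<bar>x' s \<bullet> \<phi>\<bar> \<le> b \<phi>"
    and b: "(\<lambda>\<phi>. (b \<phi>)^2) summable_on E"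
  shows "(x has_vector_derivative x' t) (at t within S)"
  unfolding has_vector_derivative_def has_derivative_within
proof (intro conjI bounded_linear_scaleR_left)
  define q where "q s = (1 / norm (s - t)) *\<^sub>R (x s - (x t + (s - t) *\<^sub>R x' t))" for s
  have "(q \<longlongrightarrow> 0) (at t within S)"
  proof (rule tendsto_coords[where b = "\<lambda>\<phi>. 2 * b \<phi>"])
    show "((\<lambda>s. q s \<bullet> \<phi>) \<longlongrightarrow> 0 \<bullet> \<phi>) (at t within S)" if \<phi>: "\<phi> \<in> E" for \<phi>
    proof -
      have "((\<lambda>t. x t \<bullet> \<phi>) has_vector_derivative x' t \<bullet> \<phi>) (at t within S)"
        using d[OF \<phi> S(2)] by (simp add: has_real_derivative_iff_has_vector_derivative)
      then show ?thesis
        unfolding has_vector_derivative_def has_derivative_within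
        by (simp add: q_def inner_diff_left inner_add_left)
    qed
    have "\<bar>q s \<bullet> \<phi>\<bar> \<le> 2 * b \<phi>" if s: "s \<in> S" "\<phi> \<in> E" "s \<noteq> t" for s \<phi>
    proof -
      have "\<bar>x s \<bullet> \<phi> - x t \<bullet> \<phi>\<bar> \<le> b \<phi> * \<bar>s - t\<bar>"
        using field_differentiable_bound[OF S(1) d[OF s(2)], of "b \<phi>" s t] bd[OF s(2)] s(1) S(2)
        by (simp add: real_norm_def)
      moreover have "\<bar>(s - t) * (x' t \<bullet> \<phi>)\<bar> \<le> b \<phi> * \<bar>s - t\<bar>"
        using mult_right_mono[OF bd[OF s(2) S(2)] abs_ge_zero[of "s - t"]] by (simp add: abs_mult mult.commute)
      ultimately have "\<bar>(x s \<bullet> \<phi> - x t \<bullet> \<phi>) - (s - t) * (x' t \<bullet> \<phi>)\<bar> \<le> 2 * b \<phi> * \<bar>s - t\<bar>"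
        by linarith
      moreover have "\<bar>q s \<bullet> \<phi>\<bar> = \<bar>(x s \<bullet> \<phi> - x t \<bullet> \<phi>) - (s - t) * (x' t \<bullet> \<phi>)\<bar> / \<bar>s - t\<bar>"
        by (simp add: q_def inner_diff_left inner_add_left abs_mult diff_diff_eq)
      ultimately show ?thesis using s(3) by (simp add: pos_divide_le_eq)
    qed
    then show "\<forall>\<^sub>F s in at t within S. \<forall>\<phi>\<in>E. \<bar>q s \<bullet> \<phi>\<bar> \<le> 2 * b \<phi>"
      by (auto simp: eventually_at_filter)
    show "\<bar>0 \<bullet> \<phi>\<bar> \<le> 2 * b \<phi>" if "\<phi> \<in> E" for \<phi> using bd[OF that S(2)] by simp
    show "(\<lambda>\<phi>. (2 * b \<phi>)^2) summable_on E"
      using summable_on_cmult_right[OF b, of 4] by (simp add: power_mult_distrib)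
  qed
  then show "((\<lambda>s. (1 / norm (s - t)) *\<^sub>R (x s - (x t + (s - t) *\<^sub>R x' t))) \<longlongrightarrow> 0) (at t within S)"
    unfolding q_def[abs_def] .
qed

lemma sum_integral_coords_le:
  fixes g :: "real \<Rightarrow> 'h"
  assumes g: "continuous_on {a..b} g" and F: "finite F" "F \<subseteq> E"
  shows "(\<Sum>\<phi>\<in>F. integral {a..b} (\<lambda>s. (g s \<bullet> \<phi>)^2)) \<le> integral {a..b} (\<lambda>s. (norm (g s))^2)"
proof -
  have "(\<Sum>\<phi>\<in>F. integral {a..b} (\<lambda>s. (g s \<bullet> \<phi>)^2)) = integral {a..b} (\<lambda>s. \<Sum>\<phi>\<in>F. (g s \<bullet> \<phi>)^2)"
    by (rule integral_sum[symmetric, OF F(1)]) (rule integrable_continuous_real, intro continuous_intros g)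
  also have "\<dots> \<le> integral {a..b} (\<lambda>s. (norm (g s))^2)"
    by (rule integral_mono_continuous) (intro continuous_intros g bessel[OF on F])+
  finally show ?thesis .
qed

end

section \<open>Solutions of the wave equation\<close>

context wave_setting
begin

text \<open>The operator A^(-m/2), bounded on the whole of H; \<open>norm (neg_pow m x)\<close> is
  the norm of index -m. All estimates of negative index are expressed through it.\<close>

definition neg_pow :: "nat \<Rightarrow> 'h \<Rightarrow> 'h" where
  "neg_pow m = half_pow D A (- int m)"

lemma lam_pos: "\<phi> \<in> E \<Longrightarrow> 0 < lam \<phi>"
  using lam_ge l0 by fastforce

lemma neg_pow_coord: "\<phi> \<in> E \<Longrightarrow> neg_pow m x \<bullet> \<phi> = x \<bullet> \<phi> / lam \<phi> ^ m"
  using half_pow_coord[of x "- int m" \<phi>] by (simp add: neg_pow_def power_int_minus divide_inverse)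

lemma half_pow_coord_nat: "x \<in> Hsp D A k \<Longrightarrow> \<phi> \<in> E \<Longrightarrow> half_pow D A (int k) x \<bullet> \<phi> = lam \<phi> ^ k * (x \<bullet> \<phi>)"
  using half_pow_coord[of x "int k" \<phi>] by simp

lemma half_pow_coord_1: "x \<in> Hsp D A 1 \<Longrightarrow> \<phi> \<in> E \<Longrightarrow> half_pow D A 1 x \<bullet> \<phi> = lam \<phi> * (x \<bullet> \<phi>)"
  using half_pow_coord_nat[of x 1 \<phi>] by (simp del: Hsp.simps)

lemma half_pow_coord_2: "x \<in> Hsp D A 2 \<Longrightarrow> \<phi> \<in> E \<Longrightarrow> half_pow D A 2 x \<bullet> \<phi> = (lam \<phi>)^2 * (x \<bullet> \<phi>)"
  using half_pow_coord_nat[of x 2 \<phi>] by (simp del: Hsp.simps)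

lemma neg_pow_0: "neg_pow 0 x = x"
  by (rule coords_eqI) (simp add: neg_pow_coord)

lemma half_pow_0: "half_pow D A 0 x = x"
  using neg_pow_0 by (simp add: neg_pow_def)

lemma norm_neg_pow_le: "norm (neg_pow m x) \<le> norm x / l0 ^ m"
proof -
  have "norm (neg_pow m x) \<le> norm ((1 / l0 ^ m) *\<^sub>R x)"
  proof (rule norm_le_coords)
    fix \<phi> assume \<phi>: "\<phi> \<in> E"
    have "l0 ^ m \<le> lam \<phi> ^ m" using lam_ge[OF \<phi>] l0 by (intro power_mono) auto
    then show "\<bar>neg_pow m x \<bullet> \<phi>\<bar> \<le> \<bar>((1 / l0 ^ m) *\<^sub>R x) \<bullet> \<phi>\<bar>"
      using l0 lam_pos[OF \<phi>] by (simp add: neg_pow_coord \<phi> abs_mult frac_le)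
  qed
  then show ?thesis using l0 by simp
qed

lemma bounded_linear_neg_pow: "bounded_linear (neg_pow m)"
proof (rule bounded_linear_intro)
  show "neg_pow m (x + y) = neg_pow m x + neg_pow m y" for x y
    by (rule coords_eqI) (simp add: neg_pow_coord inner_add_left add_divide_distrib)
  show "neg_pow m (c *\<^sub>R x) = c *\<^sub>R neg_pow m x" for c x
    by (rule coords_eqI) (simp add: neg_pow_coord)
  show "norm (neg_pow m x) \<le> norm x * (1 / l0 ^ m)" for x
    using norm_neg_pow_le[of m x] by simp
qed

lemma neg_pow_add: "neg_pow m (neg_pow k x) = neg_pow (m + k) x"
  by (rule coords_eqI) (simp add: neg_pow_coord power_add mult.commute)

lemma neg_pow_sym: "neg_pow m x \<bullet> y = x \<bullet> neg_pow m y"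
proof (rule has_sum_unique[OF has_sum_inner])
  show "((\<lambda>\<phi>. (neg_pow m x \<bullet> \<phi>) * (y \<bullet> \<phi>)) has_sum (x \<bullet> neg_pow m y)) E"
    using has_sum_inner[of x "neg_pow m y"]
    by (rule has_sum_cong[THEN iffD1, rotated]) (simp add: neg_pow_coord)
qed

lemma norm_neg_pow_Suc_le: "norm (neg_pow (Suc m) x) \<le> norm (neg_pow m x) / l0"
  using norm_neg_pow_le[of 1 "neg_pow m x"] by (simp add: neg_pow_add)

lemma Hsp_mono:
  assumes "x \<in> Hsp D A k" "j \<le> k"
  shows "x \<in> Hsp D A j"
  unfolding Hsp_iff
proof (rule summable_on_comparison_test)
  show "(\<lambda>\<phi>. (1 / l0 ^ (k - j))^2 * (lam \<phi> ^ k * (x \<bullet> \<phi>))^2) summable_on E"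
    using assms(1) unfolding Hsp_iff by (rule summable_on_cmult_right)
  fix \<phi> assume \<phi>: "\<phi> \<in> E"
  have "l0 ^ (k - j) \<le> lam \<phi> ^ (k - j)" using lam_ge[OF \<phi>] l0 by (intro power_mono) auto
  then have "1 \<le> 1 / l0 ^ (k - j) * lam \<phi> ^ (k - j)" using l0 by (simp add: field_simps)
  then have "1 * (lam \<phi> ^ j * (x \<bullet> \<phi>))^2 \<le> (1 / l0 ^ (k - j) * lam \<phi> ^ (k - j))^2 * (lam \<phi> ^ j * (x \<bullet> \<phi>))^2"
    by (intro mult_right_mono) auto
  moreover have "lam \<phi> ^ k = lam \<phi> ^ (k - j) * lam \<phi> ^ j" using assms(2) by (simp flip: power_add)
  ultimately show "(lam \<phi> ^ j * (x \<bullet> \<phi>))^2 \<le> (1 / l0 ^ (k - j))^2 * (lam \<phi> ^ k * (x \<bullet> \<phi>))^2"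
    by (simp add: power_mult_distrib power_divide ac_simps)
qed simp

lemma basis_Hsp: "\<phi> \<in> E \<Longrightarrow> \<phi> \<in> Hsp D A k"
proof -
  assume \<phi>: "\<phi> \<in> E"
  have "(\<Sum>\<psi>\<in>F. (lam \<psi> ^ k * (\<phi> \<bullet> \<psi>))^2) \<le> (lam \<phi> ^ k)^2" if F: "finite F" "F \<subseteq> E" for F
  proof -
    have "(\<Sum>\<psi>\<in>F. (lam \<psi> ^ k * (\<phi> \<bullet> \<psi>))^2) = (\<Sum>\<psi>\<in>F. if \<psi> = \<phi> then (lam \<phi> ^ k)^2 else 0)"
      using F \<phi> by (intro sum.cong) (auto simp: inner_basis subset_iff)
    also have "\<dots> \<le> (lam \<phi> ^ k)^2" using F by simp
    finally show ?thesis .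
  qed
  then show ?thesis unfolding Hsp_iff by (rule summable_on_sq_bound)
qed

lemma half_pow_1_basis: "\<phi> \<in> E \<Longrightarrow> half_pow D A 1 \<phi> = lam \<phi> *\<^sub>R \<phi>"
  by (rule coords_eqI) (simp add: half_pow_coord_1[OF basis_Hsp] inner_basis)

lemma half_pow_2_inner:
  assumes "x \<in> Hsp D A 2" "y \<in> Hsp D A 1"
  shows "half_pow D A 2 x \<bullet> y = half_pow D A 1 x \<bullet> half_pow D A 1 y"
proof (rule has_sum_unique[OF has_sum_inner])
  have x1: "x \<in> Hsp D A 1" using assms(1) by (rule Hsp_mono) simp
  have eq: "(half_pow D A 2 x \<bullet> \<phi>) * (y \<bullet> \<phi>) = (half_pow D A 1 x \<bullet> \<phi>) * (half_pow D A 1 y \<bullet> \<phi>)" if "\<phi> \<in> E" for \<phi>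
    by (simp only: half_pow_coord_1[OF x1 that] half_pow_coord_1[OF assms(2) that]
        half_pow_coord_2[OF assms(1) that]) (simp add: power2_eq_square)
  show "((\<lambda>\<phi>. (half_pow D A 2 x \<bullet> \<phi>) * (y \<bullet> \<phi>)) has_sum (half_pow D A 1 x \<bullet> half_pow D A 1 y)) E"
    using has_sum_inner[of "half_pow D A 1 x" "half_pow D A 1 y"]
    by (rule has_sum_cong[THEN iffD1, rotated]) (simp add: eq)
qed

lemma half_pow_1_eq: "x \<in> Hsp D A 2 \<Longrightarrow> half_pow D A 1 x = neg_pow 1 (half_pow D A 2 x)"
proof (rule coords_eqI)
  fix \<phi> assume x: "x \<in> Hsp D A 2" and \<phi>: "\<phi> \<in> E"
  have x1: "x \<in> Hsp D A 1" using x by (rule Hsp_mono) simp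
  show "half_pow D A 1 x \<bullet> \<phi> = neg_pow 1 (half_pow D A 2 x) \<bullet> \<phi>"
    using lam_pos[OF \<phi>] unfolding neg_pow_coord[OF \<phi>] half_pow_coord_1[OF x1 \<phi>] half_pow_coord_2[OF x \<phi>]
    by (simp add: power2_eq_square)
qed

lemma L2_on_continuous:
  assumes "continuous_on {0..T} (f :: real \<Rightarrow> 'h)"
  shows "L2_on T f"
  unfolding L2_on_def
proof
  have "(\<lambda>x. indicator {0..T} x *\<^sub>R f x) \<in> borel_measurable borel"
    by (rule borel_measurable_continuous_on_indicator[OF _ assms]) simp
  then show "set_borel_measurable lebesgue {0..T} f"
    unfolding set_borel_measurable_def by (intro measurable_completion) simp
  show "set_integrable lebesgue {0..T} (\<lambda>t. (norm (f t))^2)"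
    by (rule LINT_continuous(1)) (intro continuous_intros assms)
qed

text \<open>For a source continuous in time, a pointwise second derivative suffices: pairing it with
  a test vector, moving half of \<open>A\<close> onto that vector by \<open>half_pow_2_inner\<close>
  and integrating gives the weak equation.\<close>

lemma regular_solutionI:
  assumes f: "continuous_on {0..T} f"
    and u: "\<And>t. t \<in> {0..T} \<Longrightarrow> (u has_vector_derivative u' t) (at t within {0..T})"
    and u': "\<And>t. t \<in> {0..T} \<Longrightarrow> (u' has_vector_derivative f t - half_pow D A 2 (u t)) (at t within {0..T})"
    and H2: "\<And>t. t \<in> {0..T} \<Longrightarrow> u t \<in> Hsp D A 2" "continuous_on {0..T} (\<lambda>t. half_pow D A 2 (u t))"
    and H1: "\<And>t. t \<in> {0..T} \<Longrightarrow> u' t \<in> Hsp D A 1" "continuous_on {0..T} (\<lambda>t. half_pow D A 1 (u' t))"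
  shows "regular_solution D A T f u u'"
proof -
  have u1: "u t \<in> Hsp D A 1" if "t \<in> {0..T}" for t using H2(1)[OF that] by (rule Hsp_mono) simp
  have "continuous_on {0..T} (\<lambda>t. neg_pow 1 (half_pow D A 2 (u t)))"
    by (intro bounded_linear.continuous_on[OF bounded_linear_neg_pow] H2)
  then have c1: "continuous_on {0..T} (\<lambda>t. half_pow D A 1 (u t))"
    by (rule continuous_on_cong[THEN iffD1, rotated 2]) (simp_all add: half_pow_1_eq[OF H2(1)])
  have c': "continuous_on {0..T} u'"
    unfolding continuous_on_eq_continuous_within using u' by (blast intro: has_vector_derivative_continuous)
  have "u' t \<bullet> \<psi> = u' 0 \<bullet> \<psi> + (LINT s:{0..t}|lebesgue. f s \<bullet> \<psi> - half_pow D A 1 (u s) \<bullet> half_pow D A 1 \<psi>)"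
    if \<psi>: "\<psi> \<in> Hsp D A 1" and t: "t \<in> {0..T}" for \<psi> t
  proof -
    have sub: "{0..t} \<subseteq> {0..T}" using t by auto
    have "((\<lambda>s. (f s - half_pow D A 2 (u s)) \<bullet> \<psi>) has_integral u' t \<bullet> \<psi> - u' 0 \<bullet> \<psi>) {0..t}"
    proof (rule fundamental_theorem_of_calculus)
      show "0 \<le> t" using t by simp
      show "((\<lambda>s. u' s \<bullet> \<psi>) has_vector_derivative (f s - half_pow D A 2 (u s)) \<bullet> \<psi>) (at s within {0..t})"
        if s: "s \<in> {0..t}" for s
        by (rule bounded_linear.has_vector_derivative[OF bounded_linear_inner_left])
          (use s sub in \<open>blast intro: has_vector_derivative_within_subset[OF u']\<close>)
    qed
    then have "integral {0..t} (\<lambda>s. (f s - half_pow D A 2 (u s)) \<bullet> \<psi>) = u' t \<bullet> \<psi> - u' 0 \<bullet> \<psi>"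
      by (rule integral_unique)
    moreover have "(f s - half_pow D A 2 (u s)) \<bullet> \<psi> = f s \<bullet> \<psi> - half_pow D A 1 (u s) \<bullet> half_pow D A 1 \<psi>"
      if "s \<in> {0..t}" for s
      using half_pow_2_inner[OF H2(1) \<psi>, of s] sub that by (auto simp: inner_diff_left)
    ultimately have "integral {0..t} (\<lambda>s. f s \<bullet> \<psi> - half_pow D A 1 (u s) \<bullet> half_pow D A 1 \<psi>) = u' t \<bullet> \<psi> - u' 0 \<bullet> \<psi>"
      by (metis (no_types, lifting) integral_cong)
    moreover have "continuous_on {0..t} (\<lambda>s. f s \<bullet> \<psi> - half_pow D A 1 (u s) \<bullet> half_pow D A 1 \<psi>)"
      by (rule continuous_on_subset[OF _ sub]) (intro continuous_intros f c1)
    ultimately show ?thesis by (simp add: LINT_continuous(2))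
  qed
  then have "wave_solution D A T f u u'"
    unfolding wave_solution_def using L2_on_continuous[OF f] u1 c1 u c' by blast
  then show ?thesis unfolding regular_solution_def using H2 H1 by blast
qed

lemma energy_nonneg: "0 \<le> energy D A k w w'"
  by (simp add: energy_def)

lemma energy_coords_le:
  assumes w: "w \<in> Hsp D A 1"
    and le: "\<And>F. finite F \<Longrightarrow> F \<subseteq> E \<Longrightarrow>
      (\<Sum>\<phi>\<in>F. ((lam \<phi> * (w \<bullet> \<phi>))^2 + (w' \<bullet> \<phi>)^2) / (lam \<phi> ^ m)^2) \<le> 2 * K"
  shows "energy D A (1 - int m) w w' \<le> K"
proof -
  have w': "w \<in> Hsp D A (nat (1 - int m))" using w by (rule Hsp_mono) auto
  have 1: "half_pow D A (1 - int m) w \<bullet> \<phi> = lam \<phi> * (w \<bullet> \<phi>) / lam \<phi> ^ m" if "\<phi> \<in> E" for \<phi>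
    using half_pow_coord[OF w' that] lam_pos[OF that] by (simp add: power_int_diff)
  have "(norm (half_pow D A (1 - int m) w))^2 + (norm (neg_pow m w'))^2 \<le> 2 * K"
  proof (rule has_sum_le_finite_sums)
    show "((\<lambda>\<phi>. (half_pow D A (1 - int m) w \<bullet> \<phi>)^2 + (neg_pow m w' \<bullet> \<phi>)^2) has_sum
      (norm (half_pow D A (1 - int m) w))^2 + (norm (neg_pow m w'))^2) E"
      by (intro has_sum_add parseval)
    fix F assume F: "finite F" "F \<subseteq> E"
    have "(\<Sum>\<phi>\<in>F. (half_pow D A (1 - int m) w \<bullet> \<phi>)^2 + (neg_pow m w' \<bullet> \<phi>)^2) =
      (\<Sum>\<phi>\<in>F. ((lam \<phi> * (w \<bullet> \<phi>))^2 + (w' \<bullet> \<phi>)^2) / (lam \<phi> ^ m)^2)"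
      using F by (intro sum.cong) (auto simp: 1 neg_pow_coord power_divide add_divide_distrib)
    then show "(\<Sum>\<phi>\<in>F. (half_pow D A (1 - int m) w \<bullet> \<phi>)^2 + (neg_pow m w' \<bullet> \<phi>)^2) \<le> 2 * K"
      using le[OF F] by simp
  qed
  moreover have "1 - int m - 1 = - int m" by simp
  ultimately show ?thesis by (simp add: energy_def neg_pow_def)
qed

lemma continuous_on_neg_pow: "continuous_on S f \<Longrightarrow> continuous_on S (\<lambda>t. neg_pow m (f t))"
  by (rule bounded_linear.continuous_on[OF bounded_linear_neg_pow])

text \<open>Solved mode by mode. Regularity comes from the differentiated equation, in which
  \<open>y'\<close> is an oscillator with source \<open>f'\<close>. Dividing each mode by
  \<open>lam \<phi> ^ m\<close> yields the energy bound for all \<open>m\<close> at once: a source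
  in index \<open>-m\<close> controls the energy of index \<open>1 - m\<close>, the gain of one
  index that drives the cascade.\<close>

lemma duhamel:
  assumes T: "0 \<le> T" and f: "\<And>t. t \<in> {0..T} \<Longrightarrow> (f has_vector_derivative f' t) (at t within {0..T})"
    and f': "continuous_on {0..T} f'"
  obtains u u' where "u 0 = 0" "u' 0 = 0" "regular_solution D A T f u u'"
    "\<And>m t. t \<in> {0..T} \<Longrightarrow> energy D A (1 - int m) (u t) (u' t)
        \<le> T * integral {0..T} (\<lambda>s. (norm (neg_pow m (f s)))^2)"
proof -
  have fc: "continuous_on {0..T} f"
    unfolding continuous_on_eq_continuous_within using f by (blast intro: has_vector_derivative_continuous)
  have T0: "0 \<in> {0..T}" using T by simp
  have "\<forall>\<phi>\<in>E. \<exists>y y'. y 0 = 0 \<and> y' 0 = 0 \<and> (\<forall>t\<in>{0..T}. (y has_real_derivative y' t) (at t within {0..T}) \<and>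
      (y' has_real_derivative f t \<bullet> \<phi> - (lam \<phi>)^2 * y t) (at t within {0..T}))"
  proof
    fix \<phi> assume \<phi>: "\<phi> \<in> E"
    show "\<exists>y y'. y 0 = 0 \<and> y' 0 = 0 \<and> (\<forall>t\<in>{0..T}. (y has_real_derivative y' t) (at t within {0..T}) \<and>
      (y' has_real_derivative f t \<bullet> \<phi> - (lam \<phi>)^2 * y t) (at t within {0..T}))"
      by (rule oscillator_exists) (use lam_pos[OF \<phi>] in \<open>auto intro!: continuous_intros fc\<close>)
  qed
  then obtain y y' where y0: "\<And>\<phi>. \<phi> \<in> E \<Longrightarrow> y \<phi> 0 = 0" "\<And>\<phi>. \<phi> \<in> E \<Longrightarrow> y' \<phi> 0 = 0"
    and y: "\<And>\<phi> t. \<phi> \<in> E \<Longrightarrow> t \<in> {0..T} \<Longrightarrow> (y \<phi> has_real_derivative y' \<phi> t) (at t within {0..T})"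
    and y': "\<And>\<phi> t. \<phi> \<in> E \<Longrightarrow> t \<in> {0..T} \<Longrightarrow>
      (y' \<phi> has_real_derivative f t \<bullet> \<phi> - (lam \<phi>)^2 * y \<phi> t) (at t within {0..T})"
    by metis
  have f\<phi>: "((\<lambda>t. f t \<bullet> \<phi>) has_real_derivative f' t \<bullet> \<phi>) (at t within {0..T})" if "t \<in> {0..T}" for t \<phi>
    unfolding has_real_derivative_iff_has_vector_derivative
    by (rule bounded_linear.has_vector_derivative[OF bounded_linear_inner_left f[OF that]])
  \<comment> \<open>Energy bound for the differentiated mode, whose initial values are 0 and
    \<open>f 0 \<bullet> \<phi>\<close>. The same quantity dominates
    \<open>(f t \<bullet> \<phi>)^2\<close>; since \<open>(lam \<phi>)^2 * y \<phi> t\<close> is the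
    difference of \<open>f t \<bullet> \<phi>\<close> and the second derivative, the majorant
    \<open>b\<close> carries the factor 2.\<close>
  define c where "c \<phi> = 2 * (f 0 \<bullet> \<phi>)^2 + 2 * T * integral {0..T} (\<lambda>s. (f' s \<bullet> \<phi>)^2)" for \<phi>
  define b where "b \<phi> = 2 * sqrt (c \<phi>)" for \<phi>
  have c0: "0 \<le> c \<phi>" for \<phi>
    unfolding c_def using T
    by (auto intro!: add_nonneg_nonneg mult_nonneg_nonneg integral_nonneg integrable_continuous_real continuous_intros f')
  have b: "(\<lambda>\<phi>. (b \<phi>)^2) summable_on E"
  proof (rule summable_on_sq_bound)
    fix F assume F: "finite F" "F \<subseteq> E"
    have "(\<Sum>\<phi>\<in>F. (b \<phi>)^2) = 8 * (\<Sum>\<phi>\<in>F. (f 0 \<bullet> \<phi>)^2) + 8 * T * (\<Sum>\<phi>\<in>F. integral {0..T} (\<lambda>s. (f' s \<bullet> \<phi>)^2))"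
    proof -
      have "(b \<phi>)^2 = 8 * (f 0 \<bullet> \<phi>)^2 + 8 * T * integral {0..T} (\<lambda>s. (f' s \<bullet> \<phi>)^2)" for \<phi>
        unfolding b_def power_mult_distrib real_sqrt_pow2[OF c0] by (simp add: c_def)
      then show ?thesis by (simp add: sum.distrib sum_distrib_left)
    qed
    also have "\<dots> \<le> 8 * (norm (f 0))^2 + 8 * T * integral {0..T} (\<lambda>s. (norm (f' s))^2)"
      using T by (intro add_mono mult_left_mono bessel[OF on F] sum_integral_coords_le f' F) auto
    finally show "(\<Sum>\<phi>\<in>F. (b \<phi>)^2) \<le> \<dots>" .
  qed
  have bound: "\<bar>lam \<phi> * y' \<phi> t\<bar> \<le> b \<phi>" "\<bar>f t \<bullet> \<phi> - (lam \<phi>)^2 * y \<phi> t\<bar> \<le> b \<phi>" "\<bar>(lam \<phi>)^2 * y \<phi> t\<bar> \<le> b \<phi>"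
    if \<phi>: "\<phi> \<in> E" and t: "t \<in> {0..T}" for \<phi> t
  proof -
    \<comment> \<open>\<open>oscillator_energy\<close> is applied one derivative up:
      \<open>y' \<phi>\<close> is the position, the second derivative is the velocity, and
      \<open>f'\<close> is the source.\<close>
    have "(lam \<phi> * y' \<phi> t)^2 + (f t \<bullet> \<phi> - (lam \<phi>)^2 * y \<phi> t)^2
        \<le> 2 * ((lam \<phi> * y' \<phi> 0)^2 + (f 0 \<bullet> \<phi> - (lam \<phi>)^2 * y \<phi> 0)^2) + 2 * T * integral {0..T} (\<lambda>s. (f' s \<bullet> \<phi>)^2)"
      by (rule oscillator_energy[OF t]) (auto intro!: continuous_intros f' y'[OF \<phi>] derivative_eq_intros f\<phi> y[OF \<phi>])
    also have "\<dots> = c \<phi>" using \<phi> by (simp add: y0 c_def)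
    finally have 1: "(lam \<phi> * y' \<phi> t)^2 + (f t \<bullet> \<phi> - (lam \<phi>)^2 * y \<phi> t)^2 \<le> c \<phi>" .
    then have "(lam \<phi> * y' \<phi> t)^2 \<le> c \<phi>" "(f t \<bullet> \<phi> - (lam \<phi>)^2 * y \<phi> t)^2 \<le> c \<phi>"
      using zero_le_power2[of "lam \<phi> * y' \<phi> t"] zero_le_power2[of "f t \<bullet> \<phi> - (lam \<phi>)^2 * y \<phi> t"]
      by linarith+
    then have 2: "\<bar>lam \<phi> * y' \<phi> t\<bar> \<le> sqrt (c \<phi>)" "\<bar>f t \<bullet> \<phi> - (lam \<phi>)^2 * y \<phi> t\<bar> \<le> sqrt (c \<phi>)"
      by (auto intro: real_le_rsqrt)
    have "f t \<bullet> \<phi> = f 0 \<bullet> \<phi> + integral {0..t} (\<lambda>s. f' s \<bullet> \<phi>)"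
    proof -
      have "((\<lambda>s. f' s \<bullet> \<phi>) has_integral f t \<bullet> \<phi> - f 0 \<bullet> \<phi>) {0..t}"
      proof (rule fundamental_theorem_of_calculus)
        show "0 \<le> t" using t by simp
        show "((\<lambda>s. f s \<bullet> \<phi>) has_vector_derivative f' s \<bullet> \<phi>) (at s within {0..t})" if "s \<in> {0..t}" for s
          by (rule has_vector_derivative_within_subset[of _ _ _ "{0..T}"])
            (use f\<phi>[of s \<phi>] that t in \<open>auto simp: has_real_derivative_iff_has_vector_derivative\<close>)
      qed
      then show ?thesis by (auto dest: integral_unique)
    qed
    moreover have "(integral {0..t} (\<lambda>s. f' s \<bullet> \<phi>))^2 \<le> T * integral {0..T} (\<lambda>s. (f' s \<bullet> \<phi>)^2)"
    proof -
      have sub: "{0..t} \<subseteq> {0..T}" using t by auto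
      have "(integral {0..t} (\<lambda>s. f' s \<bullet> \<phi>))^2 \<le> t * integral {0..t} (\<lambda>s. (f' s \<bullet> \<phi>)^2)"
        using t by (intro integral_square_le continuous_on_subset[OF _ sub] continuous_intros f') auto
      also have "\<dots> \<le> T * integral {0..T} (\<lambda>s. (f' s \<bullet> \<phi>)^2)"
        using t sub by (intro mult_mono integral_mono_interval integral_nonneg integrable_continuous_real
            continuous_intros f' continuous_on_subset[OF f']) auto
      finally show ?thesis .
    qed
    ultimately have "(f t \<bullet> \<phi>)^2 \<le> c \<phi>"
      using sum_squares_bound[of "f 0 \<bullet> \<phi>" "integral {0..t} (\<lambda>s. f' s \<bullet> \<phi>)"]
      by (simp add: c_def power2_sum)
    then have 3: "\<bar>f t \<bullet> \<phi>\<bar> \<le> sqrt (c \<phi>)" by (auto intro: real_le_rsqrt)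
    show "\<bar>lam \<phi> * y' \<phi> t\<bar> \<le> b \<phi>" "\<bar>f t \<bullet> \<phi> - (lam \<phi>)^2 * y \<phi> t\<bar> \<le> b \<phi>" "\<bar>(lam \<phi>)^2 * y \<phi> t\<bar> \<le> b \<phi>"
      using 2 3 unfolding b_def by linarith+
  qed
  have low: "\<bar>x\<bar> \<le> b \<phi> / l0 ^ k" if "\<bar>lam \<phi> ^ k * x\<bar> \<le> b \<phi>" "\<phi> \<in> E" for x \<phi> k
  proof -
    have "l0 ^ k * \<bar>x\<bar> \<le> lam \<phi> ^ k * \<bar>x\<bar>"
      using lam_ge[OF that(2)] l0 by (intro mult_right_mono power_mono) auto
    also have "\<dots> \<le> b \<phi>" using that lam_pos[of \<phi>] by (simp add: abs_mult)
    finally show ?thesis using l0 by (simp add: field_simps)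
  qed
  have bk: "(\<lambda>\<phi>. (b \<phi> / l0 ^ k)^2) summable_on E" for k
    using summable_on_cmult_right[OF b, of "(1 / l0 ^ k)^2"] by (simp add: power_divide)
  have bs: "\<bar>y \<phi> t\<bar> \<le> b \<phi> / l0 ^ 2" "\<bar>y' \<phi> t\<bar> \<le> b \<phi> / l0 ^ 1" if "\<phi> \<in> E" "t \<in> {0..T}" for \<phi> t
    using low[of \<phi> 2 "y \<phi> t"] low[of \<phi> 1 "y' \<phi> t"] bound[OF that] that by auto
  have ex: "\<exists>x. t \<in> {0..T} \<longrightarrow> (\<forall>\<phi>\<in>E. x \<bullet> \<phi> = g \<phi> t)"
    if "\<And>\<phi> t. \<phi> \<in> E \<Longrightarrow> t \<in> {0..T} \<Longrightarrow> \<bar>g \<phi> t\<bar> \<le> b \<phi> / l0 ^ k" for g t k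
  proof (cases "t \<in> {0..T}")
    case True
    have "(\<lambda>\<phi>. (g \<phi> t)^2) summable_on E"
    proof (rule summable_on_comparison_test[OF bk])
      show "(g \<phi> t)^2 \<le> (b \<phi> / l0 ^ k)^2" if "\<phi> \<in> E" for \<phi>
        using power_mono[OF \<open>\<And>\<phi> t. _ \<Longrightarrow> _ \<Longrightarrow> \<bar>g \<phi> t\<bar> \<le> _\<close>[OF that True], of 2] by simp
    qed simp
    then show ?thesis using vector_from_coords[of "\<lambda>\<phi>. g \<phi> t"] by blast
  qed blast
  obtain u where u: "\<And>t \<phi>. t \<in> {0..T} \<Longrightarrow> \<phi> \<in> E \<Longrightarrow> u t \<bullet> \<phi> = y \<phi> t"
    using ex[of y 2, OF bs(1)] by metis
  obtain u' where u': "\<And>t \<phi>. t \<in> {0..T} \<Longrightarrow> \<phi> \<in> E \<Longrightarrow> u' t \<bullet> \<phi> = y' \<phi> t"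
    using ex[of y' 1, OF bs(2)] by metis
  have H2: "u t \<in> Hsp D A 2" if t: "t \<in> {0..T}" for t
    unfolding Hsp_iff
  proof (rule summable_on_comparison_test[OF b])
    show "((lam \<phi>)^2 * (u t \<bullet> \<phi>))^2 \<le> (b \<phi>)^2" if "\<phi> \<in> E" for \<phi>
      using power_mono[OF bound(3)[OF that t], of 2] by (simp add: u[OF t that])
  qed simp
  have H1: "u' t \<in> Hsp D A 1" if t: "t \<in> {0..T}" for t
    unfolding Hsp_iff
  proof (rule summable_on_comparison_test[OF b])
    show "(lam \<phi> ^ 1 * (u' t \<bullet> \<phi>))^2 \<le> (b \<phi>)^2" if "\<phi> \<in> E" for \<phi>
      using power_mono[OF bound(1)[OF that t], of 2] by (simp add: u'[OF t that])
  qed simp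
  have cy: "continuous_on {0..T} (y \<phi>)" "continuous_on {0..T} (y' \<phi>)" if "\<phi> \<in> E" for \<phi>
    by (rule DERIV_continuous_on[OF y[OF that]], assumption, rule DERIV_continuous_on[OF y'[OF that]])
  have reg: "regular_solution D A T f u u'"
  proof (rule regular_solutionI[OF fc])
    fix t assume t: "t \<in> {0..T}"
    show "u t \<in> Hsp D A 2" "u' t \<in> Hsp D A 1" using H2 H1 t by auto
    show "(u has_vector_derivative u' t) (at t within {0..T})"
    proof (rule has_vector_derivative_coords[OF _ t _ _ bk[of 1]])
      show "((\<lambda>t. u t \<bullet> \<phi>) has_real_derivative u' s \<bullet> \<phi>) (at s within {0..T})"
        if "\<phi> \<in> E" "s \<in> {0..T}" for \<phi> s
        unfolding u'[OF that(2,1)]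
        by (rule has_field_derivative_transform_within[OF y[OF that], where d = 1])
          (use that in \<open>simp_all add: u del: atLeastAtMost_iff\<close>)
      show "\<bar>u' s \<bullet> \<phi>\<bar> \<le> b \<phi> / l0 ^ 1" if "\<phi> \<in> E" "s \<in> {0..T}" for \<phi> s
        using bs(2)[OF that] by (simp add: u'[OF that(2,1)])
    qed simp
    show "(u' has_vector_derivative f t - half_pow D A 2 (u t)) (at t within {0..T})"
    proof (rule has_vector_derivative_coords[OF _ t _ _ b])
      have co: "(f s - half_pow D A 2 (u s)) \<bullet> \<phi> = f s \<bullet> \<phi> - (lam \<phi>)^2 * y \<phi> s" if "\<phi> \<in> E" "s \<in> {0..T}" for \<phi> s
        using half_pow_coord_2[OF H2[OF that(2)] that(1)] by (simp add: inner_diff_left u[OF that(2,1)])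
      show "((\<lambda>t. u' t \<bullet> \<phi>) has_real_derivative (f s - half_pow D A 2 (u s)) \<bullet> \<phi>) (at s within {0..T})"
        if "\<phi> \<in> E" "s \<in> {0..T}" for \<phi> s
        unfolding co[OF that]
        by (rule has_field_derivative_transform_within[OF y'[OF that], where d = 1]) (use that in \<open>simp_all add: u' del: atLeastAtMost_iff\<close>)
      show "\<bar>(f s - half_pow D A 2 (u s)) \<bullet> \<phi>\<bar> \<le> b \<phi>" if "\<phi> \<in> E" "s \<in> {0..T}" for \<phi> s
        unfolding co[OF that] using bound(2)[OF that] .
    qed simp
  next
    show "continuous_on {0..T} (\<lambda>t. half_pow D A 2 (u t))"
    proof (rule continuous_on_coords[OF _ _ b])
      fix \<phi> assume \<phi>: "\<phi> \<in> E"
      have co: "half_pow D A 2 (u s) \<bullet> \<phi> = (lam \<phi>)^2 * y \<phi> s" if "s \<in> {0..T}" for s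
        using half_pow_coord_2[OF H2[OF that] \<phi>] by (simp add: u[OF that \<phi>])
      show "continuous_on {0..T} (\<lambda>t. half_pow D A 2 (u t) \<bullet> \<phi>)"
        by (rule continuous_on_eq[of _ "\<lambda>s. (lam \<phi>)^2 * y \<phi> s"])
          (auto intro!: continuous_intros cy \<phi> simp: co simp del: atLeastAtMost_iff)
      show "\<bar>half_pow D A 2 (u t) \<bullet> \<phi>\<bar> \<le> b \<phi>" if "t \<in> {0..T}" for t
        using bound(3)[OF \<phi> that] by (simp add: co[OF that])
    qed
    show "continuous_on {0..T} (\<lambda>t. half_pow D A 1 (u' t))"
    proof (rule continuous_on_coords[OF _ _ b])
      fix \<phi> assume \<phi>: "\<phi> \<in> E"
      have co: "half_pow D A 1 (u' s) \<bullet> \<phi> = lam \<phi> * y' \<phi> s" if "s \<in> {0..T}" for s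
        using half_pow_coord_1[OF H1[OF that] \<phi>] by (simp add: u'[OF that \<phi>])
      show "continuous_on {0..T} (\<lambda>t. half_pow D A 1 (u' t) \<bullet> \<phi>)"
        by (rule continuous_on_eq[of _ "\<lambda>s. lam \<phi> * y' \<phi> s"])
          (auto intro!: continuous_intros cy \<phi> simp: co simp del: atLeastAtMost_iff)
      show "\<bar>half_pow D A 1 (u' t) \<bullet> \<phi>\<bar> \<le> b \<phi>" if "t \<in> {0..T}" for t
        using bound(1)[OF \<phi> that] by (simp add: co[OF that])
    qed
  qed
  have en: "energy D A (1 - int m) (u t) (u' t) \<le> T * integral {0..T} (\<lambda>s. (norm (neg_pow m (f s)))^2)"
    if t: "t \<in> {0..T}" for m t
  proof (rule energy_coords_le)
    show "u t \<in> Hsp D A 1" using H2[OF t] by (rule Hsp_mono) simp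
    fix F assume F: "finite F" "F \<subseteq> E"
    have gc: "continuous_on {0..T} (\<lambda>s. neg_pow m (f s))" by (rule continuous_on_neg_pow[OF fc])
    have "((lam \<phi> * (u t \<bullet> \<phi>))^2 + (u' t \<bullet> \<phi>)^2) / (lam \<phi> ^ m)^2 \<le>
        2 * T * integral {0..T} (\<lambda>s. (neg_pow m (f s) \<bullet> \<phi>)^2)" if "\<phi> \<in> F" for \<phi>
    proof -
      have \<phi>: "\<phi> \<in> E" using F that by auto
      have "(lam \<phi> * y \<phi> t)^2 + (y' \<phi> t)^2 \<le> 2 * ((lam \<phi> * y \<phi> 0)^2 + (y' \<phi> 0)^2) + 2 * T * integral {0..T} (\<lambda>s. (f s \<bullet> \<phi>)^2)"
        by (rule oscillator_energy[OF t _ y[OF \<phi>] y'[OF \<phi>]]) (intro continuous_intros fc)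
      then have "((lam \<phi> * (u t \<bullet> \<phi>))^2 + (u' t \<bullet> \<phi>)^2) / (lam \<phi> ^ m)^2
          \<le> 2 * T * integral {0..T} (\<lambda>s. (f s \<bullet> \<phi>)^2) / (lam \<phi> ^ m)^2"
        by (intro divide_right_mono) (simp_all add: y0 u[OF t \<phi>] u'[OF t \<phi>] \<phi>)
      also have "\<dots> = 2 * T * integral {0..T} (\<lambda>s. (neg_pow m (f s) \<bullet> \<phi>)^2)"
        by (simp add: neg_pow_coord[OF \<phi>] power_divide)
      finally show ?thesis .
    qed
    then have "(\<Sum>\<phi>\<in>F. ((lam \<phi> * (u t \<bullet> \<phi>))^2 + (u' t \<bullet> \<phi>)^2) / (lam \<phi> ^ m)^2)
        \<le> 2 * T * (\<Sum>\<phi>\<in>F. integral {0..T} (\<lambda>s. (neg_pow m (f s) \<bullet> \<phi>)^2))"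
      unfolding sum_distrib_left by (rule sum_mono)
    also have "\<dots> \<le> 2 * T * integral {0..T} (\<lambda>s. (norm (neg_pow m (f s)))^2)"
      using T by (intro mult_left_mono sum_integral_coords_le[OF gc F]) auto
    finally show "(\<Sum>\<phi>\<in>F. ((lam \<phi> * (u t \<bullet> \<phi>))^2 + (u' t \<bullet> \<phi>)^2) / (lam \<phi> ^ m)^2)
        \<le> 2 * (T * integral {0..T} (\<lambda>s. (norm (neg_pow m (f s)))^2))" by simp
  qed
  have "u 0 = 0" "u' 0 = 0"
    by (rule coords_eqI, simp add: u u' T0 y0 del: atLeastAtMost_iff)+
  then show thesis using reg en by (rule that)
qed

end

section \<open>The observation of a regular solution\<close>

text \<open>The positive and negative parts of \<open>g\<close> define finite measures that agree on
  all open half-lines, hence are equal, and equal measures have almost everywhere equal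
  densities.\<close>

lemma AE_zero_of_integral_greaterThan:
  fixes g :: "real \<Rightarrow> real"
  assumes g: "integrable lborel g" and zero: "\<And>x. (LINT s:{x<..}|lborel. g s) = 0"
  shows "AE s in lborel. g s = 0"
proof -
  have [measurable]: "g \<in> borel_measurable lborel" using g by auto
  \<comment> \<open>\<open>ennreal\<close> truncates negative values to 0, so these densities are
    the positive and the negative part of \<open>g\<close>; their agreement forces both to
    vanish.\<close>
  let ?M = "density lborel (\<lambda>s. ennreal (g s))" and ?N = "density lborel (\<lambda>s. ennreal (- g s))"
  have fin: "(\<integral>\<^sup>+s. ennreal (f s) * indicator A s \<partial>lborel) < \<infinity>" if "integrable lborel f" "A \<in> sets borel"
    for f :: "real \<Rightarrow> real" and A
  proof -
    have "(\<integral>\<^sup>+s. ennreal (f s) * indicator A s \<partial>lborel) \<le> (\<integral>\<^sup>+s. ennreal (norm (f s)) \<partial>lborel)"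
      by (rule nn_integral_mono) (auto simp: indicator_def intro!: ennreal_leI)
    also have "\<dots> < \<infinity>" using that(1) by (simp add: integrable_iff_bounded)
    finally show ?thesis .
  qed
  have "?M = ?N"
  proof (rule measure_eqI_lessThan)
    fix x :: real
    have em: "emeasure ?M {x<..} = (\<integral>\<^sup>+s. ennreal (g s) * indicator {x<..} s \<partial>lborel)"
      "emeasure ?N {x<..} = (\<integral>\<^sup>+s. ennreal (- g s) * indicator {x<..} s \<partial>lborel)"
      by (simp_all add: emeasure_density)
    show "emeasure ?M {x<..} < \<infinity>" unfolding em by (rule fin[OF g]) simp
    have int: "integrable lborel (\<lambda>s. indicator {x<..} s *\<^sub>R g s)"
      by (rule integrable_mult_indicator[OF _ g]) simp
    have "enn2real (\<integral>\<^sup>+s. ennreal (indicator {x<..} s *\<^sub>R g s) \<partial>lborel)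
        = enn2real (\<integral>\<^sup>+s. ennreal (- (indicator {x<..} s *\<^sub>R g s)) \<partial>lborel)"
      using real_lebesgue_integral_def[OF int] zero[of x] by (simp add: set_lebesgue_integral_def)
    moreover have "(\<integral>\<^sup>+s. ennreal (indicator {x<..} s *\<^sub>R g s) \<partial>lborel) = emeasure ?M {x<..}"
      unfolding em by (rule nn_integral_cong) (auto simp: indicator_def)
    moreover have "(\<integral>\<^sup>+s. ennreal (- (indicator {x<..} s *\<^sub>R g s)) \<partial>lborel) = emeasure ?N {x<..}"
      unfolding em by (rule nn_integral_cong) (auto simp: indicator_def)
    moreover have "emeasure ?M {x<..} < \<infinity>" "emeasure ?N {x<..} < \<infinity>"
      unfolding em using fin[OF g] fin[of "\<lambda>s. - g s"] g by auto
    ultimately show "emeasure ?M {x<..} = emeasure ?N {x<..}"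
      by (metis ennreal_enn2real infinity_ennreal_def)
  qed auto
  then have "AE s in lborel. ennreal (g s) = ennreal (- g s)"
    by (intro sigma_finite_measure.density_unique[OF lborel.sigma_finite_measure_axioms]) auto
  then show ?thesis
  proof eventually_elim
    case (elim s)
    then show ?case by (cases "0 \<le> g s") (auto simp: ennreal_neg ennreal_eq_0_iff)
  qed
qed

text \<open>A function with vanishing primitive is null. It is extended by 0 to the line as
  \<open>H\<close> and replaced by a Borel representative \<open>g\<close>, since the comparison of
  measures takes place on Borel sets.\<close>

lemma AE_zero_of_integral_atLeastAtMost:
  fixes h :: "real \<Rightarrow> real"
  assumes h: "set_integrable lebesgue {0..T} h"
    and zero: "\<And>t. t \<in> {0..T} \<Longrightarrow> (LINT s:{0..t}|lebesgue. h s) = 0"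
  shows "AE s in lebesgue. s \<in> {0..T} \<longrightarrow> h s = 0"
proof -
  define H where "H s = indicator {0..T} s *\<^sub>R h s" for s
  have H: "integrable lebesgue H" using h by (simp add: H_def[abs_def] set_integrable_def)
  have "H \<in> borel_measurable lebesgue" using H by (rule borel_measurable_integrable)
  then obtain g where g: "g \<in> borel_measurable lborel" "AE s in lborel. H s = g s"
    using completion_ex_borel_measurable_real[of H lborel] by blast
  have g_leb: "g \<in> borel_measurable lebesgue" using g(1) by (rule measurable_completion)
  have AE: "AE s in lebesgue. H s = g s" using g(2) by (rule AE_completion)
  have "integrable lebesgue g" using integrable_cong_AE_imp[OF H g_leb AE] .
  then have gi: "integrable lborel g" using integrable_completion[OF g(1)] by simp
  have part: "(LINT s:{x<..}|lebesgue. H s) = 0" for x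
  proof -
    have Hs: "set_integrable lebesgue S H" if "S \<in> sets lebesgue" for S
      unfolding set_integrable_def by (rule integrable_mult_indicator[OF that H])
    have H0: "(LINT s:{..x}|lebesgue. H s) = 0" for x
    proof (cases "0 \<le> x \<and> 0 \<le> T")
      case True
      have "(LINT s:{..x}|lebesgue. H s) = (LINT s:{0..min x T}|lebesgue. h s)"
        unfolding set_lebesgue_integral_def
        by (rule Bochner_Integration.integral_cong) (auto simp: H_def indicator_def)
      then show ?thesis using zero[of "min x T"] True by simp
    next
      case False
      then have "(LINT s:{..x}|lebesgue. H s) = (LINT s:{..x}|lebesgue. 0)"
        unfolding set_lebesgue_integral_def
        by (intro Bochner_Integration.integral_cong) (auto simp: H_def indicator_def)
      then show ?thesis by simp
    qed
    \<comment> \<open>The bound \<open>max x T\<close> makes the left-hand side the integral over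
      the whole line, because \<open>H\<close> vanishes beyond \<open>T\<close>.\<close>
    have "(LINT s:{..max x T}|lebesgue. H s) = (LINT s:{..x} \<union> {x<..}|lebesgue. H s)"
      unfolding set_lebesgue_integral_def
      by (rule Bochner_Integration.integral_cong) (auto simp: H_def indicator_def)
    also have "\<dots> = (LINT s:{..x}|lebesgue. H s) + (LINT s:{x<..}|lebesgue. H s)"
      by (rule set_integral_Un) (auto intro!: Hs)
    finally show ?thesis by (simp add: H0)
  qed
  have "(LINT s:{x<..}|lborel. g s) = 0" for x
  proof -
    have "(LINT s:{x<..}|lborel. g s) = (LINT s:{x<..}|lebesgue. g s)"
      unfolding set_lebesgue_integral_def
      by (rule integral_completion[symmetric]) (use g(1) in measurable)
    also have "\<dots> = (LINT s:{x<..}|lebesgue. H s)"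
      using AE H g_leb unfolding set_lebesgue_integral_def
      by (intro integral_cong_AE) (auto intro!: borel_measurable_times borel_measurable_indicator)
    finally show ?thesis using part by simp
  qed
  then have "AE s in lborel. g s = 0" by (rule AE_zero_of_integral_greaterThan[OF gi])
  then have "AE s in lebesgue. g s = 0" by (rule AE_completion)
  with AE show ?thesis by eventually_elim (auto simp: H_def)
qed

lemma LINT_mono':
  fixes f g :: "'a \<Rightarrow> real"
  assumes "set_integrable M S f" "\<And>x. x \<in> S \<Longrightarrow> g x \<le> f x" "\<And>x. x \<in> S \<Longrightarrow> 0 \<le> f x"
  shows "(LINT x:S|M. g x) \<le> (LINT x:S|M. f x)"
  unfolding set_lebesgue_integral_def
  by (rule integral_mono') (use assms in \<open>auto simp: set_integrable_def indicator_def\<close>)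

lemma LINT_nonneg:
  fixes f :: "'a \<Rightarrow> real"
  assumes "\<And>x. x \<in> S \<Longrightarrow> 0 \<le> f x"
  shows "0 \<le> (LINT x:S|M. f x)"
  unfolding set_lebesgue_integral_def
  by (rule Bochner_Integration.integral_nonneg) (use assms in \<open>auto simp: indicator_def\<close>)

text \<open>The restriction to \<open>\<epsilon> \<le> 1\<close> allows quadratic errors to be
  counted linearly, through \<open>\<epsilon>^2 \<le> \<epsilon>\<close>.\<close>

lemma le_of_perturbation:
  fixes x y c :: real
  assumes "\<And>\<epsilon>. 0 < \<epsilon> \<Longrightarrow> \<epsilon> \<le> 1 \<Longrightarrow> x \<le> y + \<epsilon> * c"
  shows "x \<le> y"
proof (rule field_le_epsilon)
  fix e :: real assume e: "0 < e"
  define \<epsilon> where "\<epsilon> = min 1 (e / (\<bar>c\<bar> + 1))"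
  have \<epsilon>: "0 < \<epsilon>" "\<epsilon> \<le> 1" using e by (auto simp: \<epsilon>_def)
  have "\<epsilon> * c \<le> \<epsilon> * (\<bar>c\<bar> + 1)" using \<epsilon> by (intro mult_left_mono) auto
  also have "\<dots> \<le> e / (\<bar>c\<bar> + 1) * (\<bar>c\<bar> + 1)" by (intro mult_right_mono) (auto simp: \<epsilon>_def)
  also have "\<dots> = e" by simp
  finally show "x \<le> y + e" using assms[OF \<epsilon>] by simp
qed

lemma norm_sq_le_double:
  fixes x y :: "'a::real_normed_vector"
  shows "(norm x)^2 \<le> 2 * (norm y)^2 + 2 * (norm (x - y))^2"
proof -
  have "norm x \<le> norm y + norm (x - y)" using norm_triangle_ineq[of y "x - y"] by simp
  then have "(norm x)^2 \<le> (norm y + norm (x - y))^2" by (rule power_mono) simp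
  then show ?thesis using sum_squares_bound[of "norm y" "norm (x - y)"] by (simp add: power2_sum)
qed

section \<open>Measurability through coordinates\<close>

context orthonormal_basis
begin

text \<open>Measurability passes to limits of sequences, not of nets; this replaces the limit along
  finite subsets by a sequential one.\<close>

lemma countable_basis_exhaustion:
  assumes "countable E"
  obtains X :: "nat \<Rightarrow> 'h set" where "filterlim X (finite_subsets_at_top E) sequentially"
proof -
  define X where "X N = {\<phi>\<in>E. to_nat_on E \<phi> < N}" for N
  have fin: "finite (X N)" for N
  proof (rule finite_imageD)
    show "finite (to_nat_on E ` X N)" by (rule finite_subset[of _ "{..<N}"]) (auto simp: X_def)
    show "inj_on (to_nat_on E) (X N)"
      using inj_on_to_nat_on[OF assms] by (rule inj_on_subset) (auto simp: X_def)
  qed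
  have "filterlim X (finite_subsets_at_top E) sequentially"
    unfolding filterlim_finite_subsets_at_top
  proof (intro allI impI)
    fix F assume F: "finite F \<and> F \<subseteq> E"
    have "F \<subseteq> X N" if "Suc (Max (insert 0 (to_nat_on E ` F))) \<le> N" for N
    proof
      fix \<phi> assume "\<phi> \<in> F"
      then have "to_nat_on E \<phi> \<le> Max (insert 0 (to_nat_on E ` F))" using F by (intro Max_ge) auto
      then have "to_nat_on E \<phi> < N" using that by linarith
      then show "\<phi> \<in> X N" using \<open>\<phi> \<in> F\<close> F by (auto simp: X_def)
    qed
    then show "\<forall>\<^sub>F N in sequentially. finite (X N) \<and> F \<subseteq> X N \<and> X N \<subseteq> E"
      using fin by (intro eventually_sequentiallyI) (auto simp: X_def)
  qed
  then show thesis by (rule that)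
qed

text \<open>Parseval writes the squared norm as a countable sum of scalar measurable functions. In
  this way the norm of a difference of two sources is measurable although the type of H carries no
  separability assumption.\<close>

lemma borel_measurable_norm_sq:
  assumes "countable E" and "\<And>\<phi>. \<phi> \<in> E \<Longrightarrow> (\<lambda>s. x s \<bullet> \<phi>) \<in> borel_measurable M"
  shows "(\<lambda>s. (norm (x s))^2) \<in> borel_measurable M"
proof -
  obtain X :: "nat \<Rightarrow> 'h set" where X: "filterlim X (finite_subsets_at_top E) sequentially"
    using countable_basis_exhaustion[OF assms(1)] .
  show ?thesis
  proof (rule borel_measurable_LIMSEQ_real)
    show "(\<lambda>N. \<Sum>\<phi>\<in>X N \<inter> E. (x s \<bullet> \<phi>)^2) \<longlonglongrightarrow> (norm (x s))^2" for s
    proof -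
      have "((\<lambda>F. \<Sum>\<phi>\<in>F. (x s \<bullet> \<phi>)^2) \<longlongrightarrow> (norm (x s))^2) (finite_subsets_at_top E)"
        using parseval by (simp add: has_sum_def)
      then have "(\<lambda>N. \<Sum>\<phi>\<in>X N. (x s \<bullet> \<phi>)^2) \<longlonglongrightarrow> (norm (x s))^2"
        using X by (rule filterlim_compose)
      moreover have "\<forall>\<^sub>F N in sequentially. X N \<subseteq> E"
        using X unfolding filterlim_finite_subsets_at_top by (force elim: eventually_mono)
      ultimately show ?thesis
        by (rule Lim_transform_eventually[OF _ eventually_mono]) (simp add: Int_absorb2)
    qed
    show "(\<lambda>s. \<Sum>\<phi>\<in>X N \<inter> E. (x s \<bullet> \<phi>)^2) \<in> borel_measurable M" for N
      using assms(2) by (intro borel_measurable_sum borel_measurable_power) auto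
  qed
qed

end

context wave_setting
begin

lemma L2_on_inner_measurable:
  assumes "L2_on T (f :: real \<Rightarrow> 'h)"
  shows "(\<lambda>s. (indicator {0..T} s *\<^sub>R f s) \<bullet> \<phi>) \<in> borel_measurable lebesgue"
  using assms unfolding L2_on_def set_borel_measurable_def
  by (intro measurable_compose[OF _ borel_measurable_continuous_onI[of "\<lambda>x. x \<bullet> \<phi>"]])
    (auto intro!: continuous_intros)

lemma L2_on_inner_integrable:
  assumes f: "L2_on T (f :: real \<Rightarrow> 'h)"
  shows "set_integrable lebesgue {0..T} (\<lambda>s. f s \<bullet> \<phi>)"
proof (rule set_integrable_bound)
  have "set_integrable lebesgue {0..T} (\<lambda>s. 1 :: real)"
    by (rule LINT_continuous(1)) simp
  then show "set_integrable lebesgue {0..T} (\<lambda>s. norm \<phi> * (1 + (norm (f s))^2))"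
    using f unfolding L2_on_def by (intro set_integrable_mult_right) auto
  show "set_borel_measurable lebesgue {0..T} (\<lambda>s. f s \<bullet> \<phi>)"
    using L2_on_inner_measurable[OF f, of \<phi>] by (simp add: set_borel_measurable_def)
  have "norm (f s \<bullet> \<phi>) \<le> norm (norm \<phi> * (1 + (norm (f s))^2))" for s
  proof -
    have "norm (f s) \<le> 1 + (norm (f s))^2"
      using sum_squares_bound[of "norm (f s)" 1] zero_le_power2[of "norm (f s)"] by (simp; linarith)
    then have "norm (f s) * norm \<phi> \<le> (1 + (norm (f s))^2) * norm \<phi>"
      by (rule mult_right_mono) simp
    then show ?thesis
      using Cauchy_Schwarz_ineq2[of "f s" \<phi>] by (simp add: mult.commute)
  qed
  then show "AE s in lebesgue. s \<in> {0..T} \<longrightarrow> norm (f s \<bullet> \<phi>) \<le> norm (norm \<phi> * (1 + (norm (f s))^2))"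
    by simp
qed

lemma L2_on_diff_integrable:
  assumes f: "L2_on T (f :: real \<Rightarrow> 'h)" and g: "L2_on T g"
  shows "set_integrable lebesgue {0..T} (\<lambda>s. (norm (f s - g s))^2)"
proof (rule set_integrable_bound)
  show "set_integrable lebesgue {0..T} (\<lambda>s. 2 * (norm (f s))^2 + 2 * (norm (g s))^2)"
    using f g by (auto simp: L2_on_def)
  have "(\<lambda>s. (norm (indicator {0..T} s *\<^sub>R f s - indicator {0..T} s *\<^sub>R g s))^2) \<in> borel_measurable lebesgue"
    by (rule borel_measurable_norm_sq[OF countable_basis])
      (auto simp: inner_diff_left simp del: inner_scaleR_left
        intro!: borel_measurable_diff L2_on_inner_measurable f g)
  also have "(\<lambda>s. (norm (indicator {0..T} s *\<^sub>R f s - indicator {0..T} s *\<^sub>R g s))^2) =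
      (\<lambda>s. indicator {0..T} s *\<^sub>R (norm (f s - g s))^2)"
    by (auto simp: indicator_def)
  finally show "set_borel_measurable lebesgue {0..T} (\<lambda>s. (norm (f s - g s))^2)"
    by (simp add: set_borel_measurable_def)
  have "(norm (f s - g s))^2 \<le> 2 * (norm (f s))^2 + 2 * (norm (g s))^2" for s
    using norm_sq_le_double[of "f s - g s" "f s"] by simp
  then show "AE s in lebesgue. s \<in> {0..T} \<longrightarrow>
      norm ((norm (f s - g s))^2) \<le> norm (2 * (norm (f s))^2 + 2 * (norm (g s))^2)"
    by simp
qed

lemma wave_solution_weak:
  assumes "wave_solution D A T f w w'" "\<phi> \<in> Hsp D A 1" "t \<in> {0..T}"
  shows "w' t \<bullet> \<phi> = w' 0 \<bullet> \<phi>
    + (LINT s:{0..t}|lebesgue. f s \<bullet> \<phi> - half_pow D A 1 (w s) \<bullet> half_pow D A 1 \<phi>)"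
  using assms unfolding wave_solution_def by blast

lemma wave_solution_L2: "wave_solution D A T f w w' \<Longrightarrow> L2_on T f"
  unfolding wave_solution_def by blast

text \<open>\<open>is_observation\<close> quantifies existentially over the source, so an estimate
  in terms of a given source has to identify the two. Testing with a basis vector gives equal
  primitives, hence equal coordinates almost everywhere; countability of \<open>E\<close> allows one
  common null set.\<close>

lemma wave_solution_source_unique:
  assumes f: "wave_solution D A T f w w'" and g: "wave_solution D A T g w w'"
  shows "(LINT s:{0..T}|lebesgue. (norm (f s))^2) = (LINT s:{0..T}|lebesgue. (norm (g s))^2)"
proof -
  have L2: "L2_on T f" "L2_on T g" using f g by (blast intro: wave_solution_L2)+
  have "AE s in lebesgue. s \<in> {0..T} \<longrightarrow> f s \<bullet> \<phi> - g s \<bullet> \<phi> = 0" if \<phi>: "\<phi> \<in> E" for \<phi>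
  proof (rule AE_zero_of_integral_atLeastAtMost)
    note f\<phi> = L2_on_inner_integrable[OF L2(1), of \<phi>] and g\<phi> = L2_on_inner_integrable[OF L2(2), of \<phi>]
    show "set_integrable lebesgue {0..T} (\<lambda>s. f s \<bullet> \<phi> - g s \<bullet> \<phi>)"
      using f\<phi> g\<phi> by (rule set_integral_diff)
    fix t assume t: "t \<in> {0..T}"
    have sub: "{0..t} \<subseteq> {0..T}" using t by auto
    let ?h = "\<lambda>s. half_pow D A 1 (w s) \<bullet> half_pow D A 1 \<phi>"
    have i: "set_integrable lebesgue {0..t} (\<lambda>s. f s \<bullet> \<phi>)" "set_integrable lebesgue {0..t} (\<lambda>s. g s \<bullet> \<phi>)"
      by (rule set_integrable_subset[OF f\<phi> _ sub], simp, rule set_integrable_subset[OF g\<phi> _ sub], simp)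
    have "continuous_on {0..t} ?h"
      by (rule continuous_on_subset[OF _ sub]) (use f in \<open>auto simp: wave_solution_def intro!: continuous_intros\<close>)
    then have h: "set_integrable lebesgue {0..t} ?h" by (rule LINT_continuous)
    have "(LINT s:{0..t}|lebesgue. f s \<bullet> \<phi> - ?h s) = (LINT s:{0..t}|lebesgue. g s \<bullet> \<phi> - ?h s)"
      using wave_solution_weak[OF f basis_Hsp[OF \<phi>] t] wave_solution_weak[OF g basis_Hsp[OF \<phi>] t] by simp
    then show "(LINT s:{0..t}|lebesgue. f s \<bullet> \<phi> - g s \<bullet> \<phi>) = 0"
      using set_integral_diff(2)[OF i(1) h] set_integral_diff(2)[OF i(2) h] set_integral_diff(2)[OF i] by simp
  qed
  then have "AE s in lebesgue. \<forall>\<phi>\<in>E. s \<in> {0..T} \<longrightarrow> f s \<bullet> \<phi> - g s \<bullet> \<phi> = 0"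
    using countable_basis by (rule AE_ball_countable')
  then have "AE s in lebesgue. indicator {0..T} s *\<^sub>R (norm (f s))^2 = indicator {0..T} s *\<^sub>R (norm (g s))^2"
  proof eventually_elim
    case (elim s)
    show ?case
    proof (cases "s \<in> {0..T}")
      case True
      then have "f s = g s" using elim by (intro coords_eqI) auto
      then show ?thesis by simp
    qed simp
  qed
  then show ?thesis
    using L2 unfolding set_lebesgue_integral_def L2_on_def set_integrable_def
    by (intro integral_cong_AE) auto
qed

text \<open>Linearity and boundedness on the space of index 2 times H give a Lipschitz bound for
  differences. Continuity makes the squared observation integrable, which the integral comparisons
  in \<open>observation_le\<close> require.\<close>

lemma continuous_on_observation:
  fixes B :: "'h \<times> 'h \<Rightarrow> 'g::{real_inner,complete_space}"
  assumes B: "admissibility_hyp D A B" and reg: "regular_solution D A T f w w'"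
  shows "continuous_on {0..T} (\<lambda>t. B (w t, w' t))"
proof -
  have w2: "w t \<in> Hsp D A 2" if "t \<in> {0..T}" for t
    using reg that unfolding regular_solution_def by blast
  have cont: "continuous_on {0..T} (\<lambda>t. half_pow D A 2 (w t))" "continuous_on {0..T} w'"
    using reg unfolding regular_solution_def wave_solution_def by blast+
  obtain K where lin: "linear_on (Hsp D A 2 \<times> UNIV) B"
    and K: "\<And>x y. x \<in> Hsp D A 2 \<Longrightarrow> norm (B (x, y)) \<le> K * sqrt ((norm (half_pow D A 2 x))^2 + (norm y)^2)"
    using B unfolding admissibility_hyp_def by blast
  have sub: "subspace (Hsp D A 2 \<times> (UNIV :: 'h set))" using lin by (simp add: linear_on_def)
  have diff2: "x - y \<in> Hsp D A 2" if "x \<in> Hsp D A 2" "y \<in> Hsp D A 2" for x y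
    using subspace_diff[OF sub, of "(x, 0)" "(y, 0)"] that by (simp del: Hsp.simps)
  have Bdiff: "B (x, x') - B (y, y') = B (x - y, x' - y')" if "x \<in> Hsp D A 2" "y \<in> Hsp D A 2" for x y x' y'
  proof -
    have "(x - y, x' - y') \<in> Hsp D A 2 \<times> UNIV" "(y, y') \<in> Hsp D A 2 \<times> UNIV" using diff2 that by blast+
    then have "B ((x - y, x' - y') + (y, y')) = B (x - y, x' - y') + B (y, y')"
      using lin unfolding linear_on_def by blast
    then show ?thesis by simp
  qed
  have half: "half_pow D A 2 (x - y) = half_pow D A 2 x - half_pow D A 2 y"
    if "x \<in> Hsp D A 2" "y \<in> Hsp D A 2" for x y
    by (rule coords_eqI) (simp only: half_pow_coord_2 that diff2 inner_diff_left right_diff_distrib)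
  show ?thesis
    unfolding continuous_on_def
  proof
    fix t assume t: "t \<in> {0..T}"
    have "((\<lambda>s. K * sqrt ((norm (half_pow D A 2 (w s) - half_pow D A 2 (w t)))^2 + (norm (w' s - w' t))^2)) \<longlongrightarrow>
        K * sqrt ((norm (half_pow D A 2 (w t) - half_pow D A 2 (w t)))^2 + (norm (w' t - w' t))^2)) (at t within {0..T})"
      using cont t by (intro tendsto_intros) (auto simp: continuous_on_def)
    then have "((\<lambda>s. K * sqrt ((norm (half_pow D A 2 (w s) - half_pow D A 2 (w t)))^2 + (norm (w' s - w' t))^2)) \<longlongrightarrow> 0) (at t within {0..T})"
      by simp
    then have "((\<lambda>s. B (w s, w' s) - B (w t, w' t)) \<longlongrightarrow> 0) (at t within {0..T})"
    proof (rule Lim_null_comparison[rotated])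
      have "norm (B (w s, w' s) - B (w t, w' t)) \<le>
          K * sqrt ((norm (half_pow D A 2 (w s) - half_pow D A 2 (w t)))^2 + (norm (w' s - w' t))^2)"
        if s: "s \<in> {0..T}" for s
        using K[OF diff2[OF w2[OF s] w2[OF t]], of "w' s - w' t"] by (simp only: Bdiff half w2[OF s] w2[OF t])
      then show "\<forall>\<^sub>F s in at t within {0..T}. norm (B (w s, w' s) - B (w t, w' t)) \<le>
          K * sqrt ((norm (half_pow D A 2 (w s) - half_pow D A 2 (w t)))^2 + (norm (w' s - w' t))^2)"
        unfolding eventually_at_filter by simp
    qed
    then show "((\<lambda>s. B (w s, w' s)) \<longlongrightarrow> B (w t, w' t)) (at t within {0..T})"
      by (simp add: LIM_zero_iff)
  qed
qed

lemma energy_1: "energy D A 1 w w' = ((norm (half_pow D A 1 w))^2 + (norm w')^2) / 2"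
  by (simp add: energy_def half_pow_0)

lemma continuous_on_energy:
  assumes "wave_solution D A T f w w'"
  shows "continuous_on {0..T} (\<lambda>t. energy D A 1 (w t) (w' t))"
  unfolding energy_1 using assms unfolding wave_solution_def by (intro continuous_intros) auto

text \<open>\<open>observation\<close> is a chosen limit, so the bound is proved for an arbitrary
  one. A late regular approximant obeys the admissibility inequality; the doubling inequality is
  used once to pass from \<open>g\<close> to the approximant and once to pass from its energies and
  source to those of \<open>u\<close>, whence the factor \<open>4 * d\<close>.\<close>

lemma observation_le:
  fixes B :: "'h \<times> 'h \<Rightarrow> 'g::{real_inner,complete_space}"
  assumes B: "admissibility_hyp D A B" and T: "0 < T" and d: "0 < d"
    and adm: "\<And>f w w'. regular_solution D A T f w w' \<Longrightarrow>
      (LINT t:{0..T}|lebesgue. (norm (B (w t, w' t)))^2)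
        \<le> d * (energy D A 1 (w 0) (w' 0) + energy D A 1 (w T) (w' T)
             + (LINT t:{0..T}|lebesgue. energy D A 1 (w t) (w' t))
             + (LINT t:{0..T}|lebesgue. (norm (f t))^2))"
    and reg: "regular_solution D A T f0 u u'"
  shows "(LINT t:{0..T}|lebesgue. (norm (observation D A B T u u' t))^2)
    \<le> 4 * d * (energy D A 1 (u 0) (u' 0) + energy D A 1 (u T) (u' T)
             + (LINT t:{0..T}|lebesgue. energy D A 1 (u t) (u' t))
             + (LINT t:{0..T}|lebesgue. (norm (f0 t))^2))"
proof -
  define g where "g = observation D A B T u u'"
  have wave0: "wave_solution D A T f0 u u'" using reg by (simp add: regular_solution_def)
  have zero: "set_integrable lebesgue {0..T} (\<lambda>t. 0 :: real)"
    by (rule LINT_continuous(1)) simp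
  \<comment> \<open>A regular solution, taken as a constant sequence of approximants, is observed
    pointwise; hence the choice is made from a nonempty set.\<close>
  have "is_observation D A B T u u' (\<lambda>t. B (u t, u' t))"
    unfolding is_observation_def
    by (rule exI[of _ f0], rule exI[of _ "\<lambda>m. f0"], rule exI[of _ "\<lambda>m. u"], rule exI[of _ "\<lambda>m. u'"])
      (use wave0 reg zero in \<open>auto simp: set_lebesgue_integral_def intro!: uniform_limit_const\<close>)
  then have "is_observation D A B T u u' g"
    unfolding g_def observation_def by (rule someI[where P = "is_observation D A B T u u'"])
  then obtain f fs ws ws' where wave: "wave_solution D A T f u u'"
    and regm: "\<And>m::nat. regular_solution D A T (fs m) (ws m) (ws' m)"
    and lim1: "uniform_limit {0..T} (\<lambda>m t. half_pow D A 1 (ws m t)) (\<lambda>t. half_pow D A 1 (u t)) sequentially"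
    and lim2: "uniform_limit {0..T} ws' u' sequentially"
    and limf: "(\<lambda>m. LINT t:{0..T}|lebesgue. (norm (fs m t - f t))^2) \<longlonglongrightarrow> 0"
    and intg: "\<And>m. set_integrable lebesgue {0..T} (\<lambda>t. (norm (B (ws m t, ws' m t) - g t))^2)"
    and limg: "(\<lambda>m. LINT t:{0..T}|lebesgue. (norm (B (ws m t, ws' m t) - g t))^2) \<longlonglongrightarrow> 0"
    unfolding is_observation_def by blast
  define e where "e t = energy D A 1 (u t) (u' t)" for t
  define F where "F = (LINT t:{0..T}|lebesgue. (norm (f0 t))^2)"
  have f_eq: "(LINT t:{0..T}|lebesgue. (norm (f t))^2) = F"
    unfolding F_def by (rule wave_solution_source_unique[OF wave wave0])
  have L2f: "L2_on T f" using wave by (rule wave_solution_L2)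
  have ce: "continuous_on {0..T} e" unfolding e_def by (rule continuous_on_energy[OF wave0])
  \<comment> \<open>In the coefficient of \<open>\<epsilon>\<close>, the two endpoint energies and
    the source contribute 2 each, the integrated energy \<open>2 * T\<close>, all multiplied by
    \<open>2 * d\<close>; the last 2 is the distance from the approximant's observation to
    \<open>g\<close>.\<close>
  have "(LINT t:{0..T}|lebesgue. (norm (g t))^2)
      \<le> 4 * d * (e 0 + e T + (LINT t:{0..T}|lebesgue. e t) + F) + \<epsilon> * (2 * d * (6 + 2 * T) + 2)"
    if \<epsilon>: "0 < \<epsilon>" "\<epsilon> \<le> 1" for \<epsilon>
  proof -
    have "\<forall>\<^sub>F m in sequentially. (\<forall>t\<in>{0..T}. dist (half_pow D A 1 (ws m t)) (half_pow D A 1 (u t)) < \<epsilon>) \<and>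
        (\<forall>t\<in>{0..T}. dist (ws' m t) (u' t) < \<epsilon>) \<and>
        (LINT t:{0..T}|lebesgue. (norm (fs m t - f t))^2) < \<epsilon> \<and>
        (LINT t:{0..T}|lebesgue. (norm (B (ws m t, ws' m t) - g t))^2) < \<epsilon>"
      using uniform_limitD[OF lim1 \<epsilon>(1)] uniform_limitD[OF lim2 \<epsilon>(1)]
        order_tendstoD(2)[OF limf \<epsilon>(1)] order_tendstoD(2)[OF limg \<epsilon>(1)]
      by (auto intro!: eventually_conj)
    then obtain m where m: "\<forall>t\<in>{0..T}. dist (half_pow D A 1 (ws m t)) (half_pow D A 1 (u t)) < \<epsilon>"
      "\<forall>t\<in>{0..T}. dist (ws' m t) (u' t) < \<epsilon>"
      and mf: "(LINT t:{0..T}|lebesgue. (norm (fs m t - f t))^2) < \<epsilon>"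
      and mg: "(LINT t:{0..T}|lebesgue. (norm (B (ws m t, ws' m t) - g t))^2) < \<epsilon>"
      using eventually_happens'[OF sequentially_bot] by blast
    have m1: "norm (half_pow D A 1 (ws m t) - half_pow D A 1 (u t)) < \<epsilon>"
      and m2: "norm (ws' m t - u' t) < \<epsilon>" if "t \<in> {0..T}" for t
      using m that by (simp_all add: dist_norm del: atLeastAtMost_iff)
    have wavem: "wave_solution D A T (fs m) (ws m) (ws' m)"
      using regm by (simp add: regular_solution_def)
    then have L2m: "L2_on T (fs m)" by (rule wave_solution_L2)
    have em: "energy D A 1 (ws m t) (ws' m t) \<le> 2 * e t + 2 * \<epsilon>" if t: "t \<in> {0..T}" for t
    proof -
      have "\<epsilon>^2 \<le> \<epsilon>" using \<epsilon> by (simp add: power2_eq_square mult_left_le)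
      moreover have "(norm (half_pow D A 1 (ws m t) - half_pow D A 1 (u t)))^2 \<le> \<epsilon>^2"
        "(norm (ws' m t - u' t))^2 \<le> \<epsilon>^2"
        using m1[OF t] m2[OF t] by (simp_all add: power_mono less_imp_le)
      ultimately show ?thesis
        using norm_sq_le_double[of "half_pow D A 1 (ws m t)" "half_pow D A 1 (u t)"]
          norm_sq_le_double[of "ws' m t" "u' t"]
        unfolding energy_1 e_def by (simp add: field_simps)
    qed
    have "(LINT t:{0..T}|lebesgue. energy D A 1 (ws m t) (ws' m t)) \<le> (LINT t:{0..T}|lebesgue. 2 * e t + 2 * \<epsilon>)"
      by (rule LINT_mono'[OF LINT_continuous(1)])
        (auto intro!: continuous_intros ce em order_trans[OF energy_nonneg em])
    also have "\<dots> = 2 * (LINT t:{0..T}|lebesgue. e t) + 2 * \<epsilon> * T"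
    proof -
      have "(LINT t:{0..T}|lebesgue. 2 * e t + 2 * \<epsilon>) = integral {0..T} (\<lambda>t. 2 * e t + 2 * \<epsilon>)"
        by (rule LINT_continuous(2)) (intro continuous_intros ce)
      also have "\<dots> = integral {0..T} (\<lambda>t. 2 * e t) + integral {0..T} (\<lambda>t. 2 * \<epsilon>)"
        by (rule integral_add) (auto intro!: integrable_continuous_real continuous_intros ce)
      finally show ?thesis using T by (simp add: LINT_continuous(2)[OF ce])
    qed
    finally have e_int: "(LINT t:{0..T}|lebesgue. energy D A 1 (ws m t) (ws' m t))
        \<le> 2 * (LINT t:{0..T}|lebesgue. e t) + 2 * \<epsilon> * T" .
    have i1: "set_integrable lebesgue {0..T} (\<lambda>t. (norm (f t))^2)" using L2f by (simp add: L2_on_def)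
    have i2: "set_integrable lebesgue {0..T} (\<lambda>t. (norm (fs m t - f t))^2)"
      by (rule L2_on_diff_integrable[OF L2m L2f])
    have "(LINT t:{0..T}|lebesgue. (norm (fs m t))^2) \<le>
        (LINT t:{0..T}|lebesgue. 2 * (norm (f t))^2 + 2 * (norm (fs m t - f t))^2)"
      using i1 i2 by (intro LINT_mono' set_integral_add(1) set_integrable_mult_right norm_sq_le_double) auto
    also have "\<dots> = 2 * F + 2 * (LINT t:{0..T}|lebesgue. (norm (fs m t - f t))^2)"
      using i1 i2 by (simp add: set_integral_add(2) f_eq)
    finally have f_int: "(LINT t:{0..T}|lebesgue. (norm (fs m t))^2) \<le> 2 * F + 2 * \<epsilon>" using mf by simp
    have i3: "set_integrable lebesgue {0..T} (\<lambda>t. (norm (B (ws m t, ws' m t)))^2)"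
      by (rule LINT_continuous(1)) (intro continuous_intros continuous_on_observation[OF B regm])
    have "(LINT t:{0..T}|lebesgue. (norm (g t))^2) \<le>
        (LINT t:{0..T}|lebesgue. 2 * (norm (B (ws m t, ws' m t)))^2 + 2 * (norm (B (ws m t, ws' m t) - g t))^2)"
      using i3 intg[of m] norm_sq_le_double[of "g _" "B (ws m _, ws' m _)"]
      by (intro LINT_mono' set_integral_add(1) set_integrable_mult_right) (auto simp: norm_minus_commute)
    also have "\<dots> \<le> 2 * (LINT t:{0..T}|lebesgue. (norm (B (ws m t, ws' m t)))^2) + 2 * \<epsilon>"
      using i3 intg[of m] mg by (simp add: set_integral_add(2))
    also have "\<dots> \<le> 2 * (d * (energy D A 1 (ws m 0) (ws' m 0) + energy D A 1 (ws m T) (ws' m T)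
             + (LINT t:{0..T}|lebesgue. energy D A 1 (ws m t) (ws' m t))
             + (LINT t:{0..T}|lebesgue. (norm (fs m t))^2))) + 2 * \<epsilon>"
      using adm[OF regm[of m]] by simp
    also have "\<dots> \<le> 2 * (d * ((2 * e 0 + 2 * \<epsilon>) + (2 * e T + 2 * \<epsilon>)
             + (2 * (LINT t:{0..T}|lebesgue. e t) + 2 * \<epsilon> * T) + (2 * F + 2 * \<epsilon>))) + 2 * \<epsilon>"
      using d T by (intro add_right_mono mult_left_mono add_mono em e_int f_int) auto
    also have "\<dots> = 4 * d * (e 0 + e T + (LINT t:{0..T}|lebesgue. e t) + F) + \<epsilon> * (2 * d * (6 + 2 * T) + 2)"
      by (simp add: algebra_simps)
    finally show ?thesis .
  qed
  then have "(LINT t:{0..T}|lebesgue. (norm (g t))^2)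
      \<le> 4 * d * (e 0 + e T + (LINT t:{0..T}|lebesgue. e t) + F)"
    by (rule le_of_perturbation)
  then show ?thesis by (simp add: g_def e_def F_def)
qed

end

section \<open>The cascade excited in one component\<close>

context wave_setting
begin

lemma neg_pow_in_Hsp: "neg_pow m x \<in> Hsp D A m"
  unfolding Hsp_iff
  by (rule summable_on_cong[THEN iffD2, OF _ summable_coords[of x]])
    (use lam_pos in \<open>force simp: neg_pow_coord\<close>)

lemma half_pow_neg_pow: "half_pow D A (int m) (neg_pow m x) = x"
  by (rule coords_eqI) (use lam_pos in \<open>force simp: half_pow_coord_nat[OF neg_pow_in_Hsp] neg_pow_coord\<close>)

lemma neg_pow_half_pow: "x \<in> Hsp D A m \<Longrightarrow> neg_pow m (half_pow D A (int m) x) = x"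
  by (rule coords_eqI) (use lam_pos in \<open>force simp: half_pow_coord_nat neg_pow_coord\<close>)

text \<open>Boundedness of the adjoint on \<open>H\<^sub>m\<close> is boundedness of the operator on \<open>H\<^bsub>-m\<^esub>\<close>.\<close>

lemma norm_neg_pow_operator_le:
  assumes C: "bounded_linear C" and H: "\<And>x. x \<in> Hsp D A m \<Longrightarrow> adjoint C x \<in> Hsp D A m"
    and K: "\<And>x. x \<in> Hsp D A m \<Longrightarrow>
      norm (half_pow D A (int m) (adjoint C x)) \<le> K * norm (half_pow D A (int m) x)"
  shows "norm (neg_pow m (C x)) \<le> K * norm (neg_pow m x)"
proof -
  \<comment> \<open>Duality: the square of \<open>norm ?y\<close> is \<open>C x\<close> paired with
    \<open>neg_pow m ?y\<close>, an element of \<open>Hsp D A m\<close>. The adjoint keeps it there,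
    so it can be written as \<open>neg_pow m ?v\<close>, and the negative power is moved onto
    \<open>x\<close>.\<close>
  let ?y = "neg_pow m (C x)"
  let ?z = "adjoint C (neg_pow m ?y)"
  let ?v = "half_pow D A (int m) ?z"
  have v: "norm ?v \<le> K * norm ?y"
    using K[OF neg_pow_in_Hsp, of ?y] by (simp add: half_pow_neg_pow)
  have "(norm ?y)^2 = C x \<bullet> neg_pow m ?y"
    by (simp add: power2_norm_eq_inner neg_pow_sym)
  also have "\<dots> = x \<bullet> neg_pow m ?v"
    using adjoint_works_complete[OF C] H[OF neg_pow_in_Hsp] by (simp add: neg_pow_half_pow)
  also have "\<dots> = neg_pow m x \<bullet> ?v" by (simp add: neg_pow_sym)
  also have "\<dots> \<le> norm (neg_pow m x) * (K * norm ?y)"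
    using norm_cauchy_schwarz[of "neg_pow m x" ?v] mult_left_mono[OF v, of "norm (neg_pow m x)"] by simp
  finally have le: "norm ?y * norm ?y \<le> (K * norm (neg_pow m x)) * norm ?y"
    by (simp add: power2_eq_square ac_simps)
  show ?thesis
  proof (cases "norm ?y = 0")
    case True
    show ?thesis
    proof (cases "neg_pow m x = 0")
      case False
      \<comment> \<open>The sign of \<open>K\<close> is not given; the right-hand side is
        nonnegative because the hypothesis at \<open>neg_pow m (neg_pow m x)\<close> bounds a norm
        by it.\<close>
      have "0 \<le> K * norm (neg_pow m x)"
        using order_trans[OF norm_ge_zero K[OF neg_pow_in_Hsp, of "neg_pow m x"]]
        by (simp only: half_pow_neg_pow)
      then show ?thesis using True by simp
    qed (use True in simp)
  next
    case False
    then show ?thesis using le by (simp add: mult_le_cancel_right)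
  qed
qed

lemma coupling_bounded:
  assumes "coupling_hyp D A n C P"
  obtains K where "0 \<le> K"
    "\<And>j m x. j \<in> {2..n} \<Longrightarrow> m \<le> n - j + 1 \<Longrightarrow> norm (neg_pow m (C j x)) \<le> K * norm (neg_pow m x)"
proof -
  have "\<exists>K. \<forall>x. norm (neg_pow m (C j x)) \<le> K * norm (neg_pow m x)"
    if j: "j \<in> {2..n}" and m: "m \<le> n - j + 1" for j m
  proof -
    have m': "m \<in> {0..n - j + 1}" using m by simp
    have "bounded_linear (C j)" "\<forall>x\<in>Hsp D A m. adjoint (C j) x \<in> Hsp D A m"
      and "\<exists>K. \<forall>x\<in>Hsp D A m. norm (half_pow D A (int m) (adjoint (C j) x)) \<le> K * norm (half_pow D A (int m) x)"
      using assms j m' unfolding coupling_hyp_def by blast+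
    then show ?thesis using norm_neg_pow_operator_le by blast
  qed
  then obtain Kf where Kf: "\<And>j m x. j \<in> {2..n} \<Longrightarrow> m \<le> n - j + 1 \<Longrightarrow>
      norm (neg_pow m (C j x)) \<le> Kf j m * norm (neg_pow m x)"
    by metis
  define K where "K = (\<Sum>j\<in>{2..n}. \<Sum>m\<in>{..n}. \<bar>Kf j m\<bar>)"
  show thesis
  proof (rule that)
    show "0 \<le> K" unfolding K_def by (intro sum_nonneg) simp
    fix j m x assume j: "j \<in> {2..n}" and m: "m \<le> n - j + 1"
    have "\<bar>Kf j m\<bar> \<le> (\<Sum>m\<in>{..n}. \<bar>Kf j m\<bar>)"
      using j m by (intro member_le_sum) auto
    also have "\<dots> \<le> K"
      unfolding K_def using j by (intro member_le_sum[where f = "\<lambda>j. \<Sum>m\<in>{..n}. \<bar>Kf j m\<bar>"]) (auto intro: sum_nonneg)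
    finally have "Kf j m \<le> K" by simp
    then show "norm (neg_pow m (C j x)) \<le> K * norm (neg_pow m x)"
      using Kf[OF j m, of x] mult_right_mono[of "Kf j m" K "norm (neg_pow m x)"] by simp
  qed
qed

lemma zero_in_Hsp: "0 \<in> Hsp D A k"
  unfolding Hsp_iff by simp

lemma half_pow_1_zero: "half_pow D A 1 0 = 0"
  by (rule coords_eqI) (simp only: half_pow_coord_1 zero_in_Hsp inner_zero_left mult_zero_right)

lemma zero_regular: "regular_solution D A T (\<lambda>t. 0) (\<lambda>t. 0) (\<lambda>t. 0)"
proof -
  note H = zero_in_Hsp
  have "half_pow D A 2 0 = 0" by (rule coords_eqI) (simp only: half_pow_coord_2 H inner_zero_left mult_zero_right)
  then show ?thesis
    by (intro regular_solutionI) (auto simp: H simp del: Hsp.simps intro!: derivative_eq_intros)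
qed

lemma regular_solution_wave: "regular_solution D A T f u u' \<Longrightarrow> wave_solution D A T f u u'"
  by (simp add: regular_solution_def)

lemma wave_solution_derivative:
  assumes "wave_solution D A T f w w'"
  shows "\<And>t. t \<in> {0..T} \<Longrightarrow> (w has_vector_derivative w' t) (at t within {0..T})"
    and "continuous_on {0..T} w'" and "continuous_on {0..T} w"
proof -
  show d: "(w has_vector_derivative w' t) (at t within {0..T})" if "t \<in> {0..T}" for t
    using assms that unfolding wave_solution_def by blast
  show "continuous_on {0..T} w'" using assms unfolding wave_solution_def by blast
  show "continuous_on {0..T} w"
    unfolding continuous_on_eq_continuous_within using d by (blast intro: has_vector_derivative_continuous)
qed

text \<open>Components below \<open>p\<close> are zero, component \<open>p\<close> is the given free
  solution, and those above are built successively by \<open>duhamel\<close>. A component that is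
  continuously differentiable into H produces a differentiable source for the next one, so the free
  solution itself needs only energy regularity. The initial data are read off from the constructed
  solution.\<close>

lemma cascade_exists:
  assumes T: "0 \<le> T" and C: "\<And>j. j \<in> {2..n} \<Longrightarrow> bounded_linear (C j)" and p: "1 \<le> p"
    and v: "wave_solution D A T (\<lambda>t. 0) v v'"
  obtains u u' where "cascade_solution D A n C T (\<lambda>i. u i 0) (\<lambda>i. u' i 0) u u'"
    "u p = v" "u' p = v'"
    "\<And>j. p < j \<Longrightarrow> j \<le> n \<Longrightarrow> regular_solution D A T (\<lambda>t. - C j (u (j - 1) t)) (u j) (u' j)"
    "\<And>j. p < j \<Longrightarrow> j \<le> n \<Longrightarrow> u j 0 = 0" "\<And>j. p < j \<Longrightarrow> j \<le> n \<Longrightarrow> u' j 0 = 0"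
    "\<And>j m t. p < j \<Longrightarrow> j \<le> n \<Longrightarrow> t \<in> {0..T} \<Longrightarrow> energy D A (1 - int m) (u j t) (u' j t)
        \<le> T * integral {0..T} (\<lambda>s. (norm (neg_pow m (C j (u (j - 1) s))))^2)"
proof -
  \<comment> \<open>Step \<open>N\<close> stands for component \<open>p + N\<close>.
    \<open>P\<close> keeps just what the next source needs, and \<open>Q\<close> is guarded by
    \<open>p + Suc N \<le> n\<close> because the operators are controlled only up to
    \<open>n\<close>; beyond that the recursion continues with zero.\<close>
  define P where "P N x \<longleftrightarrow> (\<forall>t\<in>{0..T}. (fst x has_vector_derivative snd x t) (at t within {0..T}))
      \<and> continuous_on {0..T} (snd x) \<and> (N = 0 \<longrightarrow> x = (v, v'))" for N :: nat and x
  define Q where "Q N x z \<longleftrightarrow> (p + Suc N \<le> n \<longrightarrow>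
      regular_solution D A T (\<lambda>t. - C (p + Suc N) (fst x t)) (fst z) (snd z)
      \<and> fst z 0 = 0 \<and> snd z 0 = 0
      \<and> (\<forall>m. \<forall>t\<in>{0..T}. energy D A (1 - int m) (fst z t) (snd z t)
        \<le> T * integral {0..T} (\<lambda>s. (norm (neg_pow m (C (p + Suc N) (fst x s))))^2)))"
    for N and x z :: "(real \<Rightarrow> 'h) \<times> (real \<Rightarrow> 'h)"
  have "\<exists>s. \<forall>N. P N (s N) \<and> Q N (s N) (s (Suc N))"
  proof (rule dependent_nat_choice)
    show "\<exists>x. P 0 x"
      by (rule exI[of _ "(v, v')"]) (use wave_solution_derivative[OF v] in \<open>simp add: P_def\<close>)
    fix x N assume x: "P N x"
    show "\<exists>z. P (Suc N) z \<and> Q N x z"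
    proof (cases "p + Suc N \<le> n")
      case True
      then have bl: "bounded_linear (C (p + Suc N))" using p by (intro C) auto
      interpret C: bounded_linear "C (p + Suc N)" by (rule bl)
      obtain z z' where z: "z 0 = 0" "z' 0 = 0"
        "regular_solution D A T (\<lambda>t. - C (p + Suc N) (fst x t)) z z'"
        "\<And>m t. t \<in> {0..T} \<Longrightarrow> energy D A (1 - int m) (z t) (z' t)
          \<le> T * integral {0..T} (\<lambda>s. (norm (neg_pow m (- C (p + Suc N) (fst x s))))^2)"
      proof (rule duhamel[OF T])
        show "((\<lambda>t. - C (p + Suc N) (fst x t)) has_vector_derivative - C (p + Suc N) (snd x t)) (at t within {0..T})"
          if "t \<in> {0..T}" for t
          using x that unfolding P_def
          by (intro has_vector_derivative_minus C.has_vector_derivative) blast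
        show "continuous_on {0..T} (\<lambda>t. - C (p + Suc N) (snd x t))"
          using x unfolding P_def by (intro continuous_on_minus C.continuous_on) blast
      qed (rule that, assumption+)
      have "neg_pow m (- y) = - neg_pow m y" for m y
        by (rule linear_neg[OF bounded_linear.linear[OF bounded_linear_neg_pow]])
      then show ?thesis
        using z wave_solution_derivative[OF regular_solution_wave[OF z(3)]]
        by (intro exI[of _ "(z, z')"]) (simp add: P_def Q_def)
    next
      case False
      then show ?thesis
        by (intro exI[of _ "(\<lambda>t. 0, \<lambda>t. 0)"]) (auto simp: P_def Q_def intro!: derivative_eq_intros)
    qed
  qed
  then obtain s where s: "\<And>N. P N (s N)" "\<And>N. Q N (s N) (s (Suc N))" by blast
  define u where "u j = (if j < p then (\<lambda>t. 0) else fst (s (j - p)))" for j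
  define u' where "u' j = (if j < p then (\<lambda>t. 0) else snd (s (j - p)))" for j
  have up: "u p = v" "u' p = v'" using s(1)[of 0] by (simp_all add: u_def u'_def P_def)
  have Qj: "regular_solution D A T (\<lambda>t. - C j (u (j - 1) t)) (u j) (u' j) \<and> u j 0 = 0 \<and> u' j 0 = 0
      \<and> (\<forall>m. \<forall>t\<in>{0..T}. energy D A (1 - int m) (u j t) (u' j t)
        \<le> T * integral {0..T} (\<lambda>s. (norm (neg_pow m (C j (u (j - 1) s))))^2))" if "p < j" "j \<le> n" for j
  proof -
    obtain N where N: "j = p + Suc N" using \<open>p < j\<close> less_iff_Suc_add by auto
    show ?thesis using s(2)[of N] that by (simp add: Q_def N u_def u'_def)
  qed
  have low: "wave_solution D A T (\<lambda>t. - C i (u (i - 1) t)) (u i) (u' i)" if "i \<in> {2..n}" for i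
  proof (cases "p < i")
    case True
    then show ?thesis using Qj[of i] that regular_solution_wave by auto
  next
    case False
    have "- C i (u (i - 1) t) = 0" for t
      using False that linear_0[OF bounded_linear.linear[OF C[OF that]]] by (auto simp: u_def)
    moreover have "wave_solution D A T (\<lambda>t. 0) (u i) (u' i)"
    proof (cases "i = p")
      case True
      then show ?thesis using v up by simp
    next
      case False
      then have "u i = (\<lambda>t. 0)" "u' i = (\<lambda>t. 0)" using \<open>\<not> p < i\<close> by (auto simp: u_def u'_def)
      then show ?thesis using regular_solution_wave[OF zero_regular] by simp
    qed
    ultimately show ?thesis by simp
  qed
  have first: "wave_solution D A T (\<lambda>t. 0) (u 1) (u' 1)"
  proof (cases "p = 1")
    case True
    then show ?thesis using v up by simp
  next
    case False
    then have "u 1 = (\<lambda>t. 0)" "u' 1 = (\<lambda>t. 0)" using p by (auto simp: u_def u'_def)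
    then show ?thesis using regular_solution_wave[OF zero_regular] by simp
  qed
  show thesis
  proof (rule that[of u u'])
    show "u p = v" "u' p = v'" by (rule up)+
    show "cascade_solution D A n C T (\<lambda>i. u i 0) (\<lambda>i. u' i 0) u u'"
      unfolding cascade_solution_def using low first by blast
  qed (use Qj in blast)+
qed

end

section \<open>Trigonometric solutions and the weak observability estimate\<close>

context wave_setting
begin

text \<open>\<open>osc F a b j\<close> is the \<open>j\<close>-th time derivative of a free solution with finitely many modes.\<close>

abbreviation osc_coeff :: "('h \<Rightarrow> real) \<Rightarrow> ('h \<Rightarrow> real) \<Rightarrow> nat \<Rightarrow> real \<Rightarrow> 'h \<Rightarrow> real" where
  "osc_coeff a b j t \<phi> \<equiv>
     a \<phi> * cos (lam \<phi> * t + real j * (pi / 2)) + b \<phi> * sin (lam \<phi> * t + real j * (pi / 2))"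

definition osc :: "'h set \<Rightarrow> ('h \<Rightarrow> real) \<Rightarrow> ('h \<Rightarrow> real) \<Rightarrow> nat \<Rightarrow> real \<Rightarrow> 'h" where
  "osc F a b j t = (\<Sum>\<phi>\<in>F. (lam \<phi> ^ j *
     osc_coeff a b j t \<phi>) *\<^sub>R \<phi>)"

lemma osc_coord:
  assumes "finite F" "F \<subseteq> E" "\<phi> \<in> E"
  shows "osc F a b j t \<bullet> \<phi> = (if \<phi> \<in> F then lam \<phi> ^ j *
     osc_coeff a b j t \<phi> else 0)"
  unfolding osc_def by (rule inner_sum_orthonormal[OF on assms])

text \<open>Differentiation multiplies a mode by \<open>lam \<phi>\<close> and advances its phase by
  a quarter turn, which is what the term \<open>real j * (pi / 2)\<close> records.\<close>

lemma osc_derivative: "(osc F a b j has_vector_derivative osc F a b (Suc j) t) (at t within S)"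
proof -
  have "((\<lambda>t. (lam \<phi> ^ j * osc_coeff a b j t \<phi>) *\<^sub>R \<phi>)
    has_vector_derivative (lam \<phi> ^ Suc j * (a \<phi> * cos (lam \<phi> * t + real (Suc j) * (pi / 2)) +
      b \<phi> * sin (lam \<phi> * t + real (Suc j) * (pi / 2)))) *\<^sub>R \<phi>) (at t within S)" for \<phi>
  proof -
    define \<theta> where "\<theta> = lam \<phi> * t + real j * (pi / 2)"
    have eq: "lam \<phi> * t + real (Suc j) * (pi / 2) = \<theta> + pi / 2"
      by (simp add: \<theta>_def algebra_simps add_divide_distrib)
    have shift: "cos (\<theta> + pi / 2) = - sin \<theta>" "sin (\<theta> + pi / 2) = cos \<theta>"
      by (simp_all add: cos_add sin_add)
    have "((\<lambda>t. lam \<phi> ^ j * osc_coeff a b j t \<phi>)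
      has_real_derivative lam \<phi> ^ Suc j * (a \<phi> * - sin \<theta> + b \<phi> * cos \<theta>)) (at t within S)"
      unfolding \<theta>_def by (auto intro!: derivative_eq_intros simp: algebra_simps)
    then show ?thesis
      unfolding eq shift has_real_derivative_iff_has_vector_derivative
      by (rule bounded_linear.has_vector_derivative[OF bounded_linear_scaleR_left])
  qed
  then show ?thesis
    unfolding osc_def[abs_def] by (intro has_vector_derivative_sum)
qed

lemma continuous_on_osc: "continuous_on S (osc F a b j)"
  unfolding continuous_on_eq_continuous_within
  using osc_derivative by (blast intro: has_vector_derivative_continuous)

lemma osc_in_Hsp:
  assumes "finite F" "F \<subseteq> E"
  shows "osc F a b j t \<in> Hsp D A k"
  unfolding Hsp_iff
proof (rule summable_on_cong_neutral[THEN iffD1])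
  show "(\<lambda>\<phi>. (lam \<phi> ^ k * (osc F a b j t \<bullet> \<phi>))^2) summable_on F" using assms(1) by simp
qed (use assms in \<open>auto simp: osc_coord\<close>)

lemma half_pow_2_osc:
  assumes "finite F" "F \<subseteq> E"
  shows "half_pow D A 2 (osc F a b j t) = - osc F a b (j + 2) t"
proof (rule coords_eqI)
  fix \<phi> assume \<phi>: "\<phi> \<in> E"
  have eq: "lam \<phi> * t + real (j + 2) * (pi / 2) = (lam \<phi> * t + real j * (pi / 2)) + pi"
    by (simp add: algebra_simps add_divide_distrib)
  show "half_pow D A 2 (osc F a b j t) \<bullet> \<phi> = - osc F a b (j + 2) t \<bullet> \<phi>"
    unfolding half_pow_coord_2[OF osc_in_Hsp[OF assms] \<phi>] inner_minus_left osc_coord[OF assms \<phi>] eq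
    by (simp add: power2_eq_square algebra_simps)
qed

lemma osc_regular:
  assumes "finite F" "F \<subseteq> E"
  shows "regular_solution D A T (\<lambda>t. 0) (osc F a b j) (osc F a b (Suc j))"
proof (rule regular_solutionI)
  show "(osc F a b j has_vector_derivative osc F a b (Suc j) t) (at t within {0..T})" for t
    by (rule osc_derivative)
  show "(osc F a b (Suc j) has_vector_derivative 0 - half_pow D A 2 (osc F a b j t)) (at t within {0..T})" for t
    using osc_derivative[of F a b "Suc j"] by (simp add: half_pow_2_osc[OF assms])
  show "osc F a b j t \<in> Hsp D A 2" "osc F a b (Suc j) t \<in> Hsp D A 1" for t
    by (rule osc_in_Hsp[OF assms])+
  show "continuous_on {0..T} (\<lambda>t. half_pow D A 2 (osc F a b j t))"
    unfolding half_pow_2_osc[OF assms] by (intro continuous_intros continuous_on_osc)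
  show "continuous_on {0..T} (\<lambda>t. half_pow D A 1 (osc F a b (Suc j) t))"
    unfolding half_pow_1_eq[OF osc_in_Hsp[OF assms]] half_pow_2_osc[OF assms]
    by (intro continuous_on_neg_pow continuous_intros continuous_on_osc)
qed simp

text \<open>The factor \<open>lam \<phi> ^ j\<close> cancels against the negative power: the
  derivative of order \<open>j\<close> measured in index \<open>-j\<close> depends on the
  frequencies only through the phases.\<close>

lemma norm_neg_pow_osc:
  assumes "finite F" "F \<subseteq> E"
  shows "(norm (neg_pow j (osc F a b j t)))^2 = (\<Sum>\<phi>\<in>F. (osc_coeff a b j t \<phi>)^2)"
proof -
  have "neg_pow j (osc F a b j t) = (\<Sum>\<phi>\<in>F. osc_coeff a b j t \<phi> *\<^sub>R \<phi>)"
  proof (rule coords_eqI)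
    fix \<phi> assume \<phi>: "\<phi> \<in> E"
    show "neg_pow j (osc F a b j t) \<bullet> \<phi> = (\<Sum>\<phi>\<in>F. osc_coeff a b j t \<phi> *\<^sub>R \<phi>) \<bullet> \<phi>"
      unfolding neg_pow_coord[OF \<phi>] osc_coord[OF assms \<phi>] inner_sum_orthonormal[OF on assms \<phi>]
      using lam_pos[OF \<phi>] by simp
  qed
  then show ?thesis by (simp only: norm_sum_orthonormal[OF on assms])
qed

lemma norm_neg_pow_osc_le:
  assumes "finite F" "F \<subseteq> E"
  shows "(norm (neg_pow j (osc F a b j t)))^2 \<le> (\<Sum>\<phi>\<in>F. (a \<phi>)^2 + (b \<phi>)^2)"
  unfolding norm_neg_pow_osc[OF assms]
proof (rule sum_mono)
  fix \<phi> :: 'h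
  define \<theta> where "\<theta> = lam \<phi> * t + real j * (pi / 2)"
  have "(a \<phi>)^2 + (b \<phi>)^2 - (a \<phi> * cos \<theta> + b \<phi> * sin \<theta>)^2 = (a \<phi> * sin \<theta> - b \<phi> * cos \<theta>)^2"
    using sin_cos_squared_add[of \<theta>] by algebra
  then show "(osc_coeff a b j t \<phi>)^2 \<le> (a \<phi>)^2 + (b \<phi>)^2"
    using zero_le_power2[of "a \<phi> * sin \<theta> - b \<phi> * cos \<theta>"] unfolding \<theta>_def by linarith
qed

text \<open>Consecutive derivatives are a quarter turn apart, so in each mode the two squares add up
  to the squared amplitude; the value depends neither on \<open>t\<close> nor on
  \<open>k\<close>.\<close>

lemma energy_osc:
  assumes "finite F" "F \<subseteq> E"
  shows "energy D A (- int k) (osc F a b k t) (osc F a b (Suc k) t) = (\<Sum>\<phi>\<in>F. (a \<phi>)^2 + (b \<phi>)^2) / 2"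
proof -
  have "(norm (neg_pow k (osc F a b k t)))^2 + (norm (neg_pow (Suc k) (osc F a b (Suc k) t)))^2 = (\<Sum>\<phi>\<in>F. (a \<phi>)^2 + (b \<phi>)^2)"
    unfolding norm_neg_pow_osc[OF assms] sum.distrib[symmetric]
  proof (rule sum.cong[OF refl])
    fix \<phi> :: 'h
    define \<theta> where "\<theta> = lam \<phi> * t + real k * (pi / 2)"
    have eq: "lam \<phi> * t + real (Suc k) * (pi / 2) = \<theta> + pi / 2"
      by (simp add: \<theta>_def algebra_simps add_divide_distrib)
    have shift: "cos (\<theta> + pi / 2) = - sin \<theta>" "sin (\<theta> + pi / 2) = cos \<theta>"
      by (simp_all add: cos_add sin_add)
    show "(osc_coeff a b k t \<phi>)^2 +
        (osc_coeff a b (Suc k) t \<phi>)^2 =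
        (a \<phi>)^2 + (b \<phi>)^2"
      unfolding eq shift \<theta>_def[symmetric] using sin_cos_squared_add[of \<theta>] by algebra
  qed
  moreover have "- int k - 1 = - int (Suc k)" by simp
  ultimately show ?thesis by (simp only: energy_def neg_pow_def)
qed

text \<open>The indices fit together: a source of \<open>u j\<close> in index
  \<open>-(n - j)\<close> places \<open>u j\<close> in index \<open>1 - (n - j)\<close>, which is
  the index in which the source of \<open>u (Suc j)\<close> is measured. At \<open>j = n\<close>
  this is the energy of index 1, as admissibility requires.\<close>

lemma weak_observability:
  fixes B :: "'h \<times> 'h \<Rightarrow> 'g::{real_inner,complete_space}"
  assumes coup: "coupling_hyp D A n C P" and B: "admissibility_hyp D A B"
    and T: "0 < T" and c: "0 < c"
    and obs: "\<And>u0 u1 u u'. (\<forall>i\<in>{1..n}. u0 i \<in> Hsp D A 1) \<Longrightarrow> cascade_solution D A n C T u0 u1 u u' \<Longrightarrow>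
      c * (\<Sum>i=1..n. energy D A (1 + int i - int n) (u i 0) (u' i 0))
        \<le> (LINT t:{0..T}|lebesgue. (norm (observation D A B T (u n) (u' n) t))^2)"
    and i: "i \<in> {2..n}"
  obtains M where "0 \<le> M" "\<And>F a b. finite F \<Longrightarrow> F \<subseteq> E \<Longrightarrow> (\<Sum>\<phi>\<in>F. (a \<phi>)^2 + (b \<phi>)^2)
      \<le> M * integral {0..T} (\<lambda>t. (norm (neg_pow (n - i) (C i (osc F a b (n - i) t))))^2)"
proof -
  define p where "p = i - 1"
  define k where "k = n - i"
  have p: "1 \<le> p" "p < n" "i = Suc p" using i by (auto simp: p_def)
  have bl: "bounded_linear (C j)" if "j \<in> {2..n}" for j
    using coup that unfolding coupling_hyp_def by blast
  obtain K where K: "0 \<le> K" "\<And>j m x. j \<in> {2..n} \<Longrightarrow> m \<le> n - j + 1 \<Longrightarrow> norm (neg_pow m (C j x)) \<le> K * norm (neg_pow m x)"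
    using coupling_bounded[OF coup] by blast
  obtain d where d: "0 < d" "\<And>f w w'. regular_solution D A T f w w' \<Longrightarrow>
      (LINT t:{0..T}|lebesgue. (norm (B (w t, w' t)))^2)
        \<le> d * (energy D A 1 (w 0) (w' 0) + energy D A 1 (w T) (w' T)
             + (LINT t:{0..T}|lebesgue. energy D A 1 (w t) (w' t))
             + (LINT t:{0..T}|lebesgue. (norm (f t))^2))"
    using B T unfolding admissibility_hyp_def by meson
  \<comment> \<open>Cost of one equation: \<open>2 * T\<close> from the energy bound,
    \<open>K^2\<close> from the coupling operator, and another \<open>T\<close> from integrating in
    time.\<close>
  define q where "q = 2 * K^2 * T^2"
  \<comment> \<open>\<open>4 * d\<close> comes from \<open>observation_le\<close>; \<open>T\<close>,
    \<open>T * T\<close> and 1 come from the energy at time \<open>T\<close>, the integrated energy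
    and the source, each in terms of \<open>J n\<close>; \<open>q ^ k\<close> comes from the
    equations after the first; \<open>2 / c\<close> inverts the cascade inequality.\<close>
  define M where "M = (4 * d * (T + T * T + 1) * q ^ k) * (2 / c)"
  show thesis
  proof (rule that)
    have q0: "0 \<le> q" by (simp add: q_def)
    show "0 \<le> M" using d(1) T c q0 by (simp add: M_def)
    fix F a b assume F: "finite F" "F \<subseteq> E"
    let ?I = "integral {0..T} (\<lambda>t. (norm (neg_pow k (C i (osc F a b k t))))^2)"
    let ?Y = "\<Sum>\<phi>\<in>F. (a \<phi>)^2 + (b \<phi>)^2"
    obtain u u' where casc: "cascade_solution D A n C T (\<lambda>i. u i 0) (\<lambda>i. u' i 0) u u'"
      and up: "u p = osc F a b k" "u' p = osc F a b (Suc k)"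
      and reg: "\<And>j. p < j \<Longrightarrow> j \<le> n \<Longrightarrow> regular_solution D A T (\<lambda>t. - C j (u (j - 1) t)) (u j) (u' j)"
      and u0: "\<And>j. p < j \<Longrightarrow> j \<le> n \<Longrightarrow> u j 0 = 0" "\<And>j. p < j \<Longrightarrow> j \<le> n \<Longrightarrow> u' j 0 = 0"
      and en: "\<And>j m t. p < j \<Longrightarrow> j \<le> n \<Longrightarrow> t \<in> {0..T} \<Longrightarrow> energy D A (1 - int m) (u j t) (u' j t)
        \<le> T * integral {0..T} (\<lambda>s. (norm (neg_pow m (C j (u (j - 1) s))))^2)"
      using cascade_exists[where n = n and C = C, OF less_imp_le[OF T] bl p(1)
          regular_solution_wave[OF osc_regular[OF F, of T a b k]]]
      by blast
    define J where "J j = integral {0..T} (\<lambda>s. (norm (neg_pow (n - j) (C j (u (j - 1) s))))^2)" for j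
    have cont_u: "continuous_on {0..T} (u j)" if "p \<le> j" "j \<le> n" for j
    proof (cases "j = p")
      case True
      then show ?thesis by (simp add: up continuous_on_osc)
    next
      case False
      then show ?thesis using that
        by (intro wave_solution_derivative(3)[OF regular_solution_wave[OF reg]]) auto
    qed
    have cont: "continuous_on {0..T} (\<lambda>s. (norm (neg_pow m (C j (u (j - 1) s))))^2)" if "p < j" "j \<le> n" for j m
      using that p by (intro continuous_intros continuous_on_neg_pow bounded_linear.continuous_on[OF bl] cont_u) auto
    \<comment> \<open>The energy bound holds pointwise in time, with \<open>m = n - Suc j\<close>:
      it controls \<open>u j\<close> in index \<open>-m\<close>, where \<open>C (Suc j)\<close> is
      bounded by the coupling hypothesis, and this bounds the next source.\<close>
    have J: "J j \<le> q ^ (j - Suc p) * ?I" if "Suc p \<le> j" "j \<le> n" for j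
      using that
    proof (induction j rule: dec_induct)
      case base
      then show ?case using p by (simp add: J_def k_def up)
    next
      case (step j)
      have j: "p < j" "j \<le> n" using step by auto
      define m where "m = n - Suc j"
      have nj: "n - j = Suc m" using step by (auto simp: m_def)
      have "J (Suc j) \<le> integral {0..T} (\<lambda>s. K^2 * (2 * (T * J j)))"
        unfolding J_def[of "Suc j"] m_def[symmetric]
      proof (rule integral_mono_continuous)
        show "continuous_on {0..T} (\<lambda>s. (norm (neg_pow m (C (Suc j) (u (Suc j - 1) s))))^2)"
          by (rule cont) (use step in auto)
        fix s assume s: "s \<in> {0..T}"
        have eq: "1 - int (Suc m) = - int m" by simp
        have "energy D A (- int m) (u j s) (u' j s) \<le> T * J j"
          using en[OF j s, of "Suc m"] unfolding eq J_def nj .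
        then have "(norm (neg_pow m (u j s)))^2 + (norm (half_pow D A (- int m - 1) (u' j s)))^2 \<le> 2 * (T * J j)"
          by (simp add: energy_def neg_pow_def)
        then have "(norm (neg_pow m (u j s)))^2 \<le> 2 * (T * J j)"
          by (rule order_trans[rotated]) simp
        then have "K^2 * (norm (neg_pow m (u j s)))^2 \<le> K^2 * (2 * (T * J j))"
          by (intro mult_left_mono) auto
        moreover have "(norm (neg_pow m (C (Suc j) (u j s))))^2 \<le> (K * norm (neg_pow m (u j s)))^2"
          using step p by (intro power_mono K(2)) (auto simp: m_def)
        ultimately show "(norm (neg_pow m (C (Suc j) (u (Suc j - 1) s))))^2 \<le> K^2 * (2 * (T * J j))"
          by (simp add: power_mult_distrib)
      qed simp
      also have "\<dots> = q * J j" using T by (simp add: q_def power2_eq_square)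
      also have "\<dots> \<le> q * (q ^ (j - Suc p) * ?I)"
        using step.IH j q0 by (intro mult_left_mono) auto
      also have "\<dots> = q ^ (Suc j - Suc p) * ?I"
      proof -
        have "Suc j - Suc p = Suc (j - Suc p)" using step by auto
        then show ?thesis by (simp only: power_Suc mult.assoc)
      qed
      finally show ?case .
    qed
    have k: "n - Suc p = k" using p by (simp add: k_def)
    have pn: "p < n" "n \<le> n" using p by auto
    have en1: "energy D A 1 (u n t) (u' n t) \<le> T * J n" if "t \<in> {0..T}" for t
      using en[OF pn that, of 0] by (simp add: J_def)
    have H1: "u j 0 \<in> Hsp D A 1" if "j \<in> {1..n}" for j
    proof (cases "j = 1")
      case True
      then show ?thesis using casc T unfolding cascade_solution_def wave_solution_def by auto
    next
      case False
      then have "j \<in> {2..n}" using that by auto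
      then have "wave_solution D A T (\<lambda>t. - C j (u (j - 1) t)) (u j) (u' j)"
        using casc unfolding cascade_solution_def by blast
      moreover have "0 \<in> {0..T}" using T by simp
      ultimately show ?thesis unfolding wave_solution_def by blast
    qed
    \<comment> \<open>This selects the summand of the cascade inequality that equals half the sum of
      squared amplitudes by \<open>energy_osc\<close>; the other summands are nonnegative and are
      dropped.\<close>
    have pk: "1 + int p - int n = - int k" using p by (simp add: k_def)
    have "c * (?Y / 2) = c * energy D A (1 + int p - int n) (u p 0) (u' p 0)"
      unfolding pk up energy_osc[OF F] ..
    also have "\<dots> \<le> c * (\<Sum>i=1..n. energy D A (1 + int i - int n) (u i 0) (u' i 0))"
      using c p by (intro mult_left_mono member_le_sum[where f = "\<lambda>i. energy D A (1 + int i - int n) (u i 0) (u' i 0)"])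
        (auto simp: energy_nonneg)
    also have "\<dots> \<le> (LINT t:{0..T}|lebesgue. (norm (observation D A B T (u n) (u' n) t))^2)"
      by (rule obs[OF _ casc]) (use H1 in blast)
    also have "\<dots> \<le> 4 * d * (energy D A 1 (u n 0) (u' n 0) + energy D A 1 (u n T) (u' n T)
             + (LINT t:{0..T}|lebesgue. energy D A 1 (u n t) (u' n t))
             + (LINT t:{0..T}|lebesgue. (norm (- C n (u (n - 1) t)))^2))"
      by (rule observation_le[OF B T d(1) d(2) reg[OF pn]])
    also have "\<dots> \<le> 4 * d * (0 + T * J n + T * (T * J n) + J n)"
    proof (intro mult_left_mono add_mono)
      show "energy D A 1 (u n 0) (u' n 0) \<le> 0" by (simp add: energy_1 u0[OF pn] half_pow_1_zero)
      show "energy D A 1 (u n T) (u' n T) \<le> T * J n" using T by (intro en1) simp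
      have ce: "continuous_on {0..T} (\<lambda>t. energy D A 1 (u n t) (u' n t))"
        by (rule continuous_on_energy[OF regular_solution_wave[OF reg[OF pn]]])
      show "(LINT t:{0..T}|lebesgue. energy D A 1 (u n t) (u' n t)) \<le> T * (T * J n)"
        unfolding LINT_continuous(2)[OF ce] using T en1 by (intro integral_le_const ce) auto
      have "(LINT t:{0..T}|lebesgue. (norm (C n (u (n - 1) t)))^2) = J n"
        using LINT_continuous(2)[OF cont[OF pn, of 0]] by (simp add: J_def neg_pow_0)
      then show "(LINT t:{0..T}|lebesgue. (norm (- C n (u (n - 1) t)))^2) \<le> J n" by simp
    qed (use d in simp)
    also have "\<dots> = 4 * d * (T + T * T + 1) * J n" by (simp add: algebra_simps)
    also have "\<dots> \<le> 4 * d * (T + T * T + 1) * (q ^ k * ?I)"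
      using J[of n] p d T by (intro mult_left_mono) (auto simp: k)
    finally show "?Y \<le> M * integral {0..T} (\<lambda>t. (norm (neg_pow (n - i) (C i (osc F a b (n - i) t))))^2)"
      using c unfolding k_def[symmetric] by (simp add: M_def field_simps)
  qed
qed

end

section \<open>Interpolation between the time derivatives\<close>

context wave_setting
begin

text \<open>An intermediate-derivative estimate in the scale \<open>H\<^bsub>-m\<^esub>\<close>: integration by parts in time, with a
  cut-off that kills the boundary terms and with the weight \<open>m\<close> shifted from one factor to the other.\<close>

lemma interp_step:
  fixes g0 g1 g2 :: "real \<Rightarrow> 'h" and m :: nat
  assumes g0: "\<And>t. (g0 has_vector_derivative g1 t) (at t within {0..L})"
    and g1: "\<And>t. (g1 has_vector_derivative g2 t) (at t within {0..L})"
    and g2: "continuous_on {0..L} g2"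
    and L: "0 < L" and \<delta>: "0 < \<delta>"
  shows "integral {0..L} (\<lambda>t. ((t * (L - t)) ^ Suc m * norm (neg_pow (Suc m) (g1 t)))^2)
    \<le> 2 * \<delta> * integral {0..L} (\<lambda>t. ((t * (L - t)) ^ Suc (Suc m) * norm (neg_pow (Suc (Suc m)) (g2 t)))^2)
      + (4 * (real (Suc m) * L / l0)^2 + 1 / (2 * \<delta>)) * integral {0..L} (\<lambda>t. ((t * (L - t)) ^ m * norm (neg_pow m (g0 t)))^2)"
proof -
  let ?G = "neg_pow (Suc m)"
  \<comment> \<open>The power of the cut-off grows with the order. Differentiating the weight
    \<open>(\<theta> t ^ Suc m)^2\<close> loses one factor, leaving exponents \<open>m\<close> for
    \<open>x\<close> and \<open>m + 1\<close> for \<open>y\<close>; the undifferentiated weight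
    splits as \<open>m\<close> for \<open>x\<close> and \<open>m + 2\<close> for
    \<open>z\<close>.\<close>
  define \<theta> where "\<theta> t = t * (L - t)" for t
  define x where "x t = \<theta> t ^ m * norm (neg_pow m (g0 t))" for t
  define y where "y t = \<theta> t ^ Suc m * norm (?G (g1 t))" for t
  define z where "z t = \<theta> t ^ Suc (Suc m) * norm (neg_pow (Suc (Suc m)) (g2 t))" for t
  have c0: "continuous_on {0..L} g0" and c1: "continuous_on {0..L} g1"
    unfolding continuous_on_eq_continuous_within using g0 g1 by (blast intro: has_vector_derivative_continuous)+
  have c\<theta>: "continuous_on {0..L} \<theta>" unfolding \<theta>_def by (intro continuous_intros)
  have cx: "continuous_on {0..L} x" and cy: "continuous_on {0..L} y" and cz: "continuous_on {0..L} z"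
    unfolding x_def y_def z_def by (intro continuous_intros c\<theta> continuous_on_neg_pow c0 c1 g2)+
  define h where "h t = (\<theta> t ^ Suc m)^2 * (?G (g0 t) \<bullet> ?G (g1 t))" for t
  define r where "r t = 2 * \<theta> t ^ Suc m * (real (Suc m) * \<theta> t ^ m * (L - 2 * t)) * (?G (g0 t) \<bullet> ?G (g1 t))" for t
  define h' where "h' t = r t + (\<theta> t ^ Suc m)^2 * (?G (g0 t) \<bullet> ?G (g2 t) + ?G (g1 t) \<bullet> ?G (g1 t))" for t
  have h: "(h has_vector_derivative h' t) (at t within {0..L})" for t
  proof -
    have 1: "((\<lambda>t. ?G (g0 t) \<bullet> ?G (g1 t)) has_real_derivative ?G (g0 t) \<bullet> ?G (g2 t) + ?G (g1 t) \<bullet> ?G (g1 t)) (at t within {0..L})"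
      unfolding has_real_derivative_iff_has_vector_derivative
      by (rule bounded_bilinear.has_vector_derivative[OF bounded_bilinear_inner])
        (rule bounded_linear.has_vector_derivative[OF bounded_linear_neg_pow] g0 g1)+
    have 2: "(\<theta> has_real_derivative L - 2 * t) (at t within {0..L})"
      unfolding \<theta>_def by (auto intro!: derivative_eq_intros)
    have 3: "((\<lambda>t. (\<theta> t ^ Suc m)^2) has_real_derivative 2 * \<theta> t ^ Suc m * (real (Suc m) * \<theta> t ^ m * (L - 2 * t))) (at t within {0..L})"
      using DERIV_power[OF DERIV_power[OF 2, of "Suc m"], of 2] by (simp add: ac_simps)
    show ?thesis
      unfolding has_real_derivative_iff_has_vector_derivative[symmetric] h_def[abs_def]
      by (rule DERIV_cong[OF DERIV_mult[OF 3 1]]) (simp add: h'_def r_def ac_simps)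
  qed
  have h'0: "(h' has_integral 0) {0..L}"
  proof -
    have "(h' has_integral h L - h 0) {0..L}"
      by (rule fundamental_theorem_of_calculus) (use L h in auto)
    then show ?thesis by (simp add: h_def \<theta>_def)
  qed
  \<comment> \<open>Coefficient of \<open>(x t)^2\<close> from the two Young inequalities below,
    first for \<open>r t\<close> and then for \<open>x t * z t\<close>. The former also leaves half
    of \<open>(y t)^2\<close>, and absorbing it doubles all constants.\<close>
  define c where "c = 2 * (real (Suc m) * L / l0)^2 + 1 / (4 * \<delta>)"
  have pt: "(y t)^2 \<le> h' t + (1/2) * (y t)^2 + c * (x t)^2 + \<delta> * (z t)^2" if t: "t \<in> {0..L}" for t
  proof -
    have \<theta>0: "0 \<le> \<theta> t" using t by (simp add: \<theta>_def)
    have "\<bar>(\<theta> t ^ Suc m)^2 * (?G (g0 t) \<bullet> ?G (g2 t))\<bar> \<le> x t * z t"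
    proof -
      \<comment> \<open>Symmetry moves one half power from \<open>g0\<close> to \<open>g2\<close>:
        indices \<open>-(m + 1)\<close> on both sides become \<open>-m\<close> and
        \<open>-(m + 2)\<close>, matching the orders of differentiation.\<close>
      have "?G (g0 t) \<bullet> ?G (g2 t) = neg_pow m (g0 t) \<bullet> neg_pow (Suc (Suc m)) (g2 t)"
        using neg_pow_sym[of 1 "neg_pow m (g0 t)" "?G (g2 t)"] by (simp add: neg_pow_add)
      then have "\<bar>?G (g0 t) \<bullet> ?G (g2 t)\<bar> \<le> norm (neg_pow m (g0 t)) * norm (neg_pow (Suc (Suc m)) (g2 t))"
        by (simp add: Cauchy_Schwarz_ineq2)
      then have "(\<theta> t ^ Suc m)^2 * \<bar>?G (g0 t) \<bullet> ?G (g2 t)\<bar> \<le> (\<theta> t ^ Suc m)^2 * (norm (neg_pow m (g0 t)) * norm (neg_pow (Suc (Suc m)) (g2 t)))"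
        by (rule mult_left_mono) simp
      also have "\<dots> = x t * z t" by (simp add: x_def z_def power2_eq_square)
      finally show ?thesis by (simp add: abs_mult)
    qed
    also have "x t * z t \<le> 1 / (4 * \<delta>) * (x t)^2 + \<delta> * (z t)^2"
    proof -
      have "0 \<le> (x t - 2 * \<delta> * z t)^2 / (4 * \<delta>)" using \<delta> by simp
      also have "\<dots> = 1 / (4 * \<delta>) * (x t)^2 + \<delta> * (z t)^2 - x t * z t"
        using \<delta> by (simp add: power2_eq_square field_simps)
      finally show ?thesis by simp
    qed
    finally have A: "\<bar>(\<theta> t ^ Suc m)^2 * (?G (g0 t) \<bullet> ?G (g2 t))\<bar> \<le> 1 / (4 * \<delta>) * (x t)^2 + \<delta> * (z t)^2" .
    \<comment> \<open>The term from differentiating the cut-off is of lower order: it contains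
      \<open>g0\<close> in index \<open>-(m + 1)\<close>, which index \<open>-m\<close> dominates at
      the price of \<open>1 / l0\<close>.\<close>
    have "\<bar>r t\<bar> \<le> 2 * (real (Suc m) * L / l0 * x t) * y t"
    proof -
      have "\<bar>?G (g0 t) \<bullet> ?G (g1 t)\<bar> \<le> norm (neg_pow m (g0 t)) / l0 * norm (?G (g1 t))"
        by (rule order_trans[OF Cauchy_Schwarz_ineq2 mult_right_mono[OF norm_neg_pow_Suc_le norm_ge_zero]])
      moreover have "\<bar>L - 2 * t\<bar> \<le> L" using t by auto
      ultimately have "(2 * \<theta> t ^ Suc m * (real (Suc m) * \<theta> t ^ m)) * (\<bar>L - 2 * t\<bar> * \<bar>?G (g0 t) \<bullet> ?G (g1 t)\<bar>)
          \<le> (2 * \<theta> t ^ Suc m * (real (Suc m) * \<theta> t ^ m)) * (L * (norm (neg_pow m (g0 t)) / l0 * norm (?G (g1 t))))"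
        using \<theta>0 L by (intro mult_left_mono[OF mult_mono]) auto
      then show ?thesis using \<theta>0
        by (simp add: r_def x_def y_def abs_mult ac_simps)
    qed
    also have "\<dots> \<le> 2 * (real (Suc m) * L / l0 * x t)^2 + (1/2) * (y t)^2"
    proof -
      have "2 * A * B \<le> 2 * A^2 + (1/2) * B^2" for A B :: real
        using zero_le_power2[of "2 * A - B"] by (simp add: power2_eq_square algebra_simps)
      then show ?thesis .
    qed
    finally have B: "\<bar>r t\<bar> \<le> 2 * (real (Suc m) * L / l0)^2 * (x t)^2 + (1/2) * (y t)^2"
      by (simp add: power_mult_distrib power_divide)
    have "(y t)^2 = (\<theta> t ^ Suc m)^2 * (?G (g1 t) \<bullet> ?G (g1 t))"
      by (simp only: y_def power_mult_distrib power2_norm_eq_inner)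
    then have "(y t)^2 = h' t - r t - (\<theta> t ^ Suc m)^2 * (?G (g0 t) \<bullet> ?G (g2 t))"
      unfolding h'_def distrib_left by linarith
    then show ?thesis using A B unfolding c_def distrib_right by linarith
  qed
  have I: "((\<lambda>t. (x t)^2) has_integral integral {0..L} (\<lambda>t. (x t)^2)) {0..L}"
    "((\<lambda>t. (y t)^2) has_integral integral {0..L} (\<lambda>t. (y t)^2)) {0..L}"
    "((\<lambda>t. (z t)^2) has_integral integral {0..L} (\<lambda>t. (z t)^2)) {0..L}"
    by (rule integrable_integral, rule integrable_continuous_real, intro continuous_intros cx cy cz)+
  have "((\<lambda>t. h' t + (1/2) * (y t)^2 + c * (x t)^2 + \<delta> * (z t)^2) has_integral
      0 + (1/2) * integral {0..L} (\<lambda>t. (y t)^2) + c * integral {0..L} (\<lambda>t. (x t)^2)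
      + \<delta> * integral {0..L} (\<lambda>t. (z t)^2)) {0..L}"
    by (intro has_integral_add has_integral_mult_right I h'0)
  then have "integral {0..L} (\<lambda>t. (y t)^2) \<le> 0 + (1/2) * integral {0..L} (\<lambda>t. (y t)^2)
      + c * integral {0..L} (\<lambda>t. (x t)^2) + \<delta> * integral {0..L} (\<lambda>t. (z t)^2)"
    by (rule has_integral_le[OF I(2) _ pt])
  then have "integral {0..L} (\<lambda>t. (y t)^2) \<le> 2 * \<delta> * integral {0..L} (\<lambda>t. (z t)^2) + 2 * c * integral {0..L} (\<lambda>t. (x t)^2)"
    by linarith
  moreover have "2 * c = 4 * (real (Suc m) * L / l0)^2 + 1 / (2 * \<delta>)" by (simp add: c_def)
  ultimately show ?thesis unfolding x_def y_def z_def \<theta>_def by simp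
qed

text \<open>The cut-off makes the boundary terms vanish. Order 0 has no cut-off and is the quantity
  to be observed, \<open>osc F a b 0\<close> playing the part of the velocity w'.\<close>

definition osc_moment :: "('h \<Rightarrow> 'h) \<Rightarrow> real \<Rightarrow> 'h set \<Rightarrow> ('h \<Rightarrow> real) \<Rightarrow> ('h \<Rightarrow> real) \<Rightarrow> nat \<Rightarrow> real" where
  "osc_moment P L F a b j =
     integral {0..L} (\<lambda>t. ((t * (L - t)) ^ j * norm (neg_pow j (P (osc F a b j t))))^2)"

lemma continuous_on_operator_osc:
  assumes "bounded_linear P"
  shows "continuous_on S (\<lambda>t. P (osc F a b j t))"
  using assms continuous_on_osc by (rule bounded_linear.continuous_on)

text \<open>Order \<open>j + 1\<close> is interpolated between \<open>j\<close> and
  \<open>j + 2\<close>. The latter is bounded by the amplitudes, as \<open>P\<close> is bounded in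
  index \<open>-(j + 2)\<close> with \<open>j + 2 \<le> k + 1\<close>, and receives a small
  coefficient; the former is handled by the induction hypothesis with a smaller
  \<open>\<delta>\<close>.\<close>

lemma osc_moment_interpolation:
  assumes P: "bounded_linear P" and L: "0 < L" and K: "\<And>m x. m \<le> Suc k \<Longrightarrow> norm (neg_pow m (P x)) \<le> K * norm (neg_pow m x)"
  shows "j \<le> k \<Longrightarrow> 0 < \<delta> \<Longrightarrow> \<exists>M\<ge>0. \<forall>F a b. finite F \<longrightarrow> F \<subseteq> E \<longrightarrow>
    osc_moment P L F a b j \<le> \<delta> * (\<Sum>\<phi>\<in>F. (a \<phi>)^2 + (b \<phi>)^2) + M * osc_moment P L F a b 0"
proof (induction j arbitrary: \<delta>)
  case 0
  have "osc_moment P L F a b 0 \<le> \<delta> * (\<Sum>\<phi>\<in>F. (a \<phi>)^2 + (b \<phi>)^2) + 1 * osc_moment P L F a b 0" for F a b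
    using \<open>0 < \<delta>\<close> by (simp add: sum_nonneg)
  then show ?case by (intro exI[of _ 1]) auto
next
  case (Suc j)
  define Q where "Q = L * ((L * L) ^ (j + 2))^2 * K^2"
  have Q0: "0 \<le> Q" using L by (simp add: Q_def)
  have upper: "osc_moment P L F a b (Suc (Suc j)) \<le> Q * (\<Sum>\<phi>\<in>F. (a \<phi>)^2 + (b \<phi>)^2)"
    if F: "finite F" "F \<subseteq> E" for F a b
  proof -
    have "osc_moment P L F a b (Suc (Suc j)) \<le> L * ((((L * L) ^ (j + 2))^2) * (K^2 * (\<Sum>\<phi>\<in>F. (a \<phi>)^2 + (b \<phi>)^2)))"
      unfolding osc_moment_def
    proof (rule integral_le_const[OF less_imp_le[OF L]])
      show "continuous_on {0..L} (\<lambda>t. ((t * (L - t)) ^ Suc (Suc j) * norm (neg_pow (Suc (Suc j)) (P (osc F a b (Suc (Suc j)) t))))^2)"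
        by (intro continuous_intros continuous_on_neg_pow continuous_on_operator_osc[OF P])
      fix t assume t: "t \<in> {0..L}"
      have "((t * (L - t)) ^ (j + 2))^2 \<le> ((L * L) ^ (j + 2))^2"
        using t by (intro power_mono mult_mono) auto
      moreover have "(norm (neg_pow (j + 2) (P (osc F a b (j + 2) t))))^2 \<le> K^2 * (\<Sum>\<phi>\<in>F. (a \<phi>)^2 + (b \<phi>)^2)"
      proof -
        have "(norm (neg_pow (j + 2) (P (osc F a b (j + 2) t))))^2 \<le> (K * norm (neg_pow (j + 2) (osc F a b (j + 2) t)))^2"
          using Suc.prems(1) by (intro power_mono K) auto
        also have "\<dots> \<le> K^2 * (\<Sum>\<phi>\<in>F. (a \<phi>)^2 + (b \<phi>)^2)"
          unfolding power_mult_distrib by (intro mult_left_mono norm_neg_pow_osc_le[OF F]) simp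
        finally show ?thesis .
      qed
      ultimately show "((t * (L - t)) ^ Suc (Suc j) * norm (neg_pow (Suc (Suc j)) (P (osc F a b (Suc (Suc j)) t))))^2
          \<le> ((L * L) ^ (j + 2))^2 * (K^2 * (\<Sum>\<phi>\<in>F. (a \<phi>)^2 + (b \<phi>)^2))"
        unfolding power_mult_distrib[of _ "norm _"] by (intro mult_mono) auto
    qed
    then show ?thesis by (simp add: Q_def ac_simps)
  qed
  \<comment> \<open>Chosen so that \<open>2 * \<epsilon> * Q \<le> \<delta> / 2\<close>. The
    constant \<open>c\<close> depends on \<open>\<epsilon>\<close>, so the parameter
    \<open>\<delta> / (2 * c)\<close> of the induction hypothesis is fixed only afterwards and uses
    the other half of \<open>\<delta>\<close>.\<close>
  define \<epsilon> where "\<epsilon> = \<delta> / (4 * (Q + 1))"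
  have \<epsilon>: "0 < \<epsilon>" using Suc.prems(2) Q0 by (simp add: \<epsilon>_def)
  define c where "c = 4 * (real (Suc j) * L / l0)^2 + 1 / (2 * \<epsilon>)"
  have c0: "0 < c" using \<epsilon> by (auto simp: c_def intro!: add_nonneg_pos)
  obtain M where M: "0 \<le> M" "\<And>F a b. finite F \<Longrightarrow> F \<subseteq> E \<Longrightarrow>
      osc_moment P L F a b j \<le> (\<delta> / (2 * c)) * (\<Sum>\<phi>\<in>F. (a \<phi>)^2 + (b \<phi>)^2) + M * osc_moment P L F a b 0"
    using Suc.IH[of "\<delta> / (2 * c)"] Suc.prems c0 by auto
  have "osc_moment P L F a b (Suc j) \<le> \<delta> * (\<Sum>\<phi>\<in>F. (a \<phi>)^2 + (b \<phi>)^2) + (c * M) * osc_moment P L F a b 0"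
    if F: "finite F" "F \<subseteq> E" for F a b
  proof -
    let ?Y = "\<Sum>\<phi>\<in>F. (a \<phi>)^2 + (b \<phi>)^2"
    have Y0: "0 \<le> ?Y" by (intro sum_nonneg) simp
    have "osc_moment P L F a b (Suc j) \<le> 2 * \<epsilon> * osc_moment P L F a b (Suc (Suc j)) + c * osc_moment P L F a b j"
      unfolding osc_moment_def c_def
      by (rule interp_step[OF _ _ _ L \<epsilon>])
        (rule bounded_linear.has_vector_derivative[OF P osc_derivative] continuous_on_operator_osc[OF P])+
    also have "\<dots> \<le> 2 * \<epsilon> * (Q * ?Y) + c * ((\<delta> / (2 * c)) * ?Y + M * osc_moment P L F a b 0)"
      using \<epsilon> c0 by (intro add_mono mult_left_mono upper[OF F] M(2)[OF F]) auto
    also have "\<dots> = (2 * \<epsilon> * Q + \<delta> / 2) * ?Y + (c * M) * osc_moment P L F a b 0"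
      using c0 by (simp add: algebra_simps)
    also have "\<dots> \<le> \<delta> * ?Y + (c * M) * osc_moment P L F a b 0"
    proof -
      have "2 * \<epsilon> * Q \<le> 2 * \<epsilon> * (Q + 1)" using \<epsilon> by simp
      also have "\<dots> = \<delta> / 2" using Q0 by (simp add: \<epsilon>_def field_simps)
      finally show ?thesis using Y0 by (intro add_right_mono mult_right_mono) auto
    qed
    finally show ?thesis .
  qed
  then show ?case using M(1) c0 by (intro exI[of _ "c * M"]) auto
qed

text \<open>Translation in time rotates the amplitudes \<open>(a \<phi>, b \<phi>)\<close> by the
  angle \<open>lam \<phi>\<close> and so preserves their sum of squares; it moves the observation
  window away from the ends of the interval.\<close>

lemma osc_shift:
  "osc F a b j (t + 1) = osc F (\<lambda>\<phi>. a \<phi> * cos (lam \<phi>) + b \<phi> * sin (lam \<phi>)) (\<lambda>\<phi>. b \<phi> * cos (lam \<phi>) - a \<phi> * sin (lam \<phi>)) j t"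
proof -
  have "a \<phi> * cos (lam \<phi> * (t + 1) + real j * (pi / 2)) + b \<phi> * sin (lam \<phi> * (t + 1) + real j * (pi / 2)) =
    (a \<phi> * cos (lam \<phi>) + b \<phi> * sin (lam \<phi>)) * cos (lam \<phi> * t + real j * (pi / 2)) +
    (b \<phi> * cos (lam \<phi>) - a \<phi> * sin (lam \<phi>)) * sin (lam \<phi> * t + real j * (pi / 2))" for \<phi>
  proof -
    have "lam \<phi> * (t + 1) + real j * (pi / 2) = (lam \<phi> * t + real j * (pi / 2)) + lam \<phi>"
      by (simp add: algebra_simps)
    then show ?thesis by (simp only: cos_add sin_add) (simp add: algebra_simps)
  qed
  then show ?thesis by (simp add: osc_def)
qed

text \<open>The weak estimate is translated to \<open>{1..T + 1}\<close>, where the cut-off on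
  \<open>{0..T + 2}\<close> is at least 1, so that the moment of order \<open>k\<close> dominates
  it. Interpolation trades that moment for the one of order 0 plus a part absorbed on the
  left.\<close>

lemma strong_observability_osc:
  assumes P: "bounded_linear P" and T: "0 < T"
    and K: "\<And>m x. m \<le> Suc k \<Longrightarrow> norm (neg_pow m (P x)) \<le> K * norm (neg_pow m x)"
    and M: "0 \<le> M" "\<And>F a b. finite F \<Longrightarrow> F \<subseteq> E \<Longrightarrow> (\<Sum>\<phi>\<in>F. (a \<phi>)^2 + (b \<phi>)^2)
      \<le> M * integral {0..T} (\<lambda>t. (norm (neg_pow k (P (osc F a b k t))))^2)"
  obtains M' where "0 \<le> M'" "\<And>F a b. finite F \<Longrightarrow> F \<subseteq> E \<Longrightarrow> (\<Sum>\<phi>\<in>F. (a \<phi>)^2 + (b \<phi>)^2)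
      \<le> M' * integral {0..T + 2} (\<lambda>t. (norm (P (osc F a b 0 t)))^2)"
proof -
  define L where "L = T + 2"
  have L: "0 < L" using T by (simp add: L_def)
  \<comment> \<open>With this \<open>\<delta>\<close> the amplitudes return with the coefficient
    \<open>M * \<delta> \<le> 1 / 2\<close>, which the left-hand side absorbs.\<close>
  have "0 < 1 / (2 * (M + 1))" using M by simp
  from osc_moment_interpolation[OF P L K order_refl this]
  obtain N where N: "0 \<le> N" "\<And>F a b. finite F \<Longrightarrow> F \<subseteq> E \<Longrightarrow>
      osc_moment P L F a b k \<le> 1 / (2 * (M + 1)) * (\<Sum>\<phi>\<in>F. (a \<phi>)^2 + (b \<phi>)^2) + N * osc_moment P L F a b 0"
    by blast
  show thesis
  proof (rule that[of "2 * (M * N)"])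
    show "0 \<le> 2 * (M * N)" using M N by simp
    fix F and a b :: "'h \<Rightarrow> real" assume F: "finite F" "F \<subseteq> E"
    let ?Y = "\<Sum>\<phi>\<in>F. (a \<phi>)^2 + (b \<phi>)^2"
    let ?a = "\<lambda>\<phi>. a \<phi> * cos (lam \<phi>) + b \<phi> * sin (lam \<phi>)" and ?b = "\<lambda>\<phi>. b \<phi> * cos (lam \<phi>) - a \<phi> * sin (lam \<phi>)"
    let ?h = "\<lambda>t. (norm (neg_pow k (P (osc F a b k t))))^2"
    have ch: "continuous_on S ?h" for S
      by (intro continuous_intros continuous_on_neg_pow continuous_on_operator_osc[OF P])
    have cm: "continuous_on S (\<lambda>t. ((t * (L - t)) ^ k * norm (neg_pow k (P (osc F a b k t))))^2)" for S
      by (intro continuous_intros continuous_on_neg_pow continuous_on_operator_osc[OF P])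
    have "(?a \<phi>)^2 + (?b \<phi>)^2 = (a \<phi>)^2 + (b \<phi>)^2" for \<phi>
      using sin_cos_squared_add[of "lam \<phi>"] by algebra
    then have "?Y = (\<Sum>\<phi>\<in>F. (?a \<phi>)^2 + (?b \<phi>)^2)" by simp
    also have "\<dots> \<le> M * integral {0..T} (\<lambda>t. (norm (neg_pow k (P (osc F ?a ?b k t))))^2)"
      by (rule M(2)[OF F])
    also have "(\<lambda>t. (norm (neg_pow k (P (osc F ?a ?b k t))))^2) = ?h \<circ> (+) 1"
      by (simp add: fun_eq_iff osc_shift[symmetric] add.commute)
    also have "integral {0..T} (?h \<circ> (+) 1) = integral {1..T + 1} ?h"
      by (simp add: integral_shift_Icc_real)
    also have "M * \<dots> \<le> M * osc_moment P L F a b k"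
    proof (rule mult_left_mono[OF _ M(1)])
      have "integral {1..T + 1} ?h \<le> integral {1..T + 1} (\<lambda>t. ((t * (L - t)) ^ k * norm (neg_pow k (P (osc F a b k t))))^2)"
      proof (rule integral_mono_continuous[OF ch cm])
        fix t assume t: "t \<in> {1..T + 1}"
        \<comment> \<open>The product equals \<open>t * (L - t) - (T + 1)\<close>, so the cut-off is
          even at least \<open>T + 1\<close> on this window.\<close>
        have "0 \<le> (t - 1) * (T + 1 - t)" using t by simp
        then have "1 \<le> t * (L - t)" using T by (simp add: L_def algebra_simps)
        then have "1 \<le> (t * (L - t)) ^ k" by (rule one_le_power)
        then have "1 * norm (neg_pow k (P (osc F a b k t))) \<le> (t * (L - t)) ^ k * norm (neg_pow k (P (osc F a b k t)))"
          by (rule mult_right_mono) simp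
        then show "?h t \<le> ((t * (L - t)) ^ k * norm (neg_pow k (P (osc F a b k t))))^2"
          by (intro power_mono) auto
      qed
      also have "\<dots> \<le> osc_moment P L F a b k"
        unfolding osc_moment_def by (rule integral_mono_interval[OF cm]) (use T in \<open>auto simp: L_def\<close>)
      finally show "integral {1..T + 1} ?h \<le> osc_moment P L F a b k" .
    qed
    also have "\<dots> \<le> M * (1 / (2 * (M + 1)) * ?Y + N * osc_moment P L F a b 0)"
      by (rule mult_left_mono[OF N(2)[OF F] M(1)])
    also have "\<dots> \<le> ?Y / 2 + (M * N) * osc_moment P L F a b 0"
    proof -
      have "M * (1 / (2 * (M + 1))) \<le> 1 / 2" using M by (simp add: field_simps)
      moreover have "0 \<le> ?Y" by (intro sum_nonneg) simp
      ultimately have "M * (1 / (2 * (M + 1))) * ?Y \<le> 1 / 2 * ?Y" by (rule mult_right_mono)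
      then show ?thesis by (simp add: distrib_left)
    qed
    finally have "?Y \<le> 2 * (M * N) * osc_moment P L F a b 0" by simp
    then show "?Y \<le> 2 * (M * N) * integral {0..T + 2} (\<lambda>t. (norm (P (osc F a b 0 t)))^2)"
      by (simp add: osc_moment_def L_def neg_pow_0)
  qed
qed

end

section \<open>Extension to all free solutions, and the theorem\<close>

context wave_setting
begin

text \<open>Uniqueness for a single mode: the difference from the explicit trigonometric solution is
  an oscillator with zero source and zero initial data, and \<open>oscillator_energy\<close> makes
  it vanish.\<close>

lemma free_solution_coord:
  assumes w: "wave_solution D A T (\<lambda>t. 0) w w'" and \<phi>: "\<phi> \<in> E" and t: "t \<in> {0..T}"
  shows "w' t \<bullet> \<phi> = (w' 0 \<bullet> \<phi>) * cos (lam \<phi> * t) - lam \<phi> * (w 0 \<bullet> \<phi>) * sin (lam \<phi> * t)"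
proof -
  have lp: "lam \<phi> \<noteq> 0" using lam_pos[OF \<phi>] by simp
  have H1: "w s \<in> Hsp D A 1" if "s \<in> {0..T}" for s
    using w that unfolding wave_solution_def by blast
  define y where "y s = w s \<bullet> \<phi>" for s
  define y' where "y' s = w' s \<bullet> \<phi>" for s
  have y: "(y has_real_derivative y' s) (at s within {0..T})" if "s \<in> {0..T}" for s
    unfolding has_real_derivative_iff_has_vector_derivative y_def y'_def
    by (rule bounded_linear.has_vector_derivative[OF bounded_linear_inner_left wave_solution_derivative(1)[OF w that]])
  have cy: "continuous_on {0..T} y"
    unfolding y_def by (intro continuous_intros wave_solution_derivative(3)[OF w])
  \<comment> \<open>The weak equation tested with an eigenvector exhibits \<open>y'\<close> as a
    primitive of a continuous function, so the mode satisfies the scalar equation in the classical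
    sense.\<close>
  have "y' s = y' 0 - (lam \<phi>)^2 * integral {0..s} y" if s: "s \<in> {0..T}" for s
  proof -
    have sub: "{0..s} \<subseteq> {0..T}" using s by auto
    have "half_pow D A 1 (w r) \<bullet> half_pow D A 1 \<phi> = (lam \<phi>)^2 * y r" if "r \<in> {0..T}" for r
      using half_pow_coord_1[OF H1[OF that] \<phi>] by (simp add: half_pow_1_basis[OF \<phi>] y_def power2_eq_square)
    then have "(LINT r:{0..s}|lebesgue. 0 \<bullet> \<phi> - half_pow D A 1 (w r) \<bullet> half_pow D A 1 \<phi>)
        = (LINT r:{0..s}|lebesgue. - ((lam \<phi>)^2 * y r))"
      using sub by (intro set_lebesgue_integral_cong) auto
    also have "\<dots> = integral {0..s} (\<lambda>r. - ((lam \<phi>)^2 * y r))"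
      by (rule LINT_continuous(2)) (intro continuous_intros continuous_on_subset[OF cy sub])
    also have "\<dots> = - ((lam \<phi>)^2 * integral {0..s} y)" by simp
    finally show ?thesis
      using wave_solution_weak[OF w basis_Hsp[OF \<phi>] s] by (simp add: y'_def)
  qed
  note y'_eq = this
  have y': "(y' has_real_derivative 0 - (lam \<phi>)^2 * y s) (at s within {0..T})" if s: "s \<in> {0..T}" for s
  proof (rule has_field_derivative_transform_within[where d = 1])
    have "((\<lambda>s. integral {0..s} y) has_real_derivative y s) (at s within {0..T})"
      unfolding has_real_derivative_iff_has_vector_derivative
      by (rule integral_has_vector_derivative[OF cy s])
    then show "((\<lambda>s. y' 0 - (lam \<phi>)^2 * integral {0..s} y) has_real_derivative 0 - (lam \<phi>)^2 * y s) (at s within {0..T})"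
      by (auto intro!: derivative_eq_intros)
  qed (use s y'_eq in \<open>simp_all del: atLeastAtMost_iff\<close>)
  define d where "d s = y s - (y 0 * cos (lam \<phi> * s) + y' 0 / lam \<phi> * sin (lam \<phi> * s))" for s
  define d' where "d' s = y' s - (y' 0 * cos (lam \<phi> * s) - lam \<phi> * y 0 * sin (lam \<phi> * s))" for s
  have "(lam \<phi> * d t)^2 + (d' t)^2 \<le> 2 * ((lam \<phi> * d 0)^2 + (d' 0)^2) + 2 * T * integral {0..T} (\<lambda>s. 0^2)"
  proof (rule oscillator_energy[OF t])
    show "(d has_real_derivative d' s) (at s within {0..T})" if "s \<in> {0..T}" for s
      unfolding d_def d'_def using lp by (auto intro!: derivative_eq_intros y that simp: field_simps)
    show "(d' has_real_derivative 0 - (lam \<phi>)^2 * d s) (at s within {0..T})" if "s \<in> {0..T}" for s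
      unfolding d_def d'_def using lp
      by (auto intro!: derivative_eq_intros y' that simp: field_simps power2_eq_square)
  qed simp
  then have "(lam \<phi> * d t)^2 + (d' t)^2 \<le> 0" by (simp add: d_def d'_def)
  then have "d' t = 0" by (simp add: sum_power2_le_zero_iff)
  then show ?thesis by (simp add: d'_def y'_def y_def)
qed

text \<open>A finite set \<open>F\<close> is taken that captures the initial energy up to
  \<open>\<epsilon>\<close> and projects the orbit of \<open>w'\<close> with error below
  \<open>\<epsilon>\<close> at all times. The projected velocity is a trigonometric solution, to
  which the estimate applies.\<close>

lemma coupling_observability_of_osc:
  assumes P: "bounded_linear P" and M: "0 \<le> M" and L: "0 \<le> L" "L \<le> T"
    and osc: "\<And>F a b. finite F \<Longrightarrow> F \<subseteq> E \<Longrightarrow> (\<Sum>\<phi>\<in>F. (a \<phi>)^2 + (b \<phi>)^2)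
      \<le> M * integral {0..L} (\<lambda>t. (norm (P (osc F a b 0 t)))^2)"
    and w: "wave_solution D A T (\<lambda>t. 0) w w'"
  shows "energy D A 1 (w 0) (w' 0) \<le> M * (LINT t:{0..T}|lebesgue. (norm (P (w' t)))^2)"
proof -
  interpret P: bounded_linear P by (rule P)
  obtain K where K: "0 < K" "\<And>x. norm (P x) \<le> norm x * K" using P.pos_bounded by blast
  have T: "0 \<le> T" using L by simp
  have w0: "w 0 \<in> Hsp D A 1" using w T unfolding wave_solution_def by auto
  have cw': "continuous_on {0..T} w'" by (rule wave_solution_derivative(2)[OF w])
  let ?I = "integral {0..T} (\<lambda>t. (norm (P (w' t)))^2)"
  \<comment> \<open>Amplitudes of the velocity from \<open>free_solution_coord\<close>. Their
    squares sum over \<open>F\<close> to the part of twice the initial energy carried by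
    \<open>F\<close>.\<close>
  define a where "a \<phi> = w' 0 \<bullet> \<phi>" for \<phi>
  define b where "b \<phi> = - (lam \<phi> * (w 0 \<bullet> \<phi>))" for \<phi>
  have "2 * energy D A 1 (w 0) (w' 0) \<le> 2 * M * ?I + \<epsilon> * (1 + 2 * M * (T * K^2))"
    if \<epsilon>: "0 < \<epsilon>" "\<epsilon> \<le> 1" for \<epsilon>
  proof -
    have "((\<lambda>\<phi>. (w' 0 \<bullet> \<phi>)^2 + (half_pow D A 1 (w 0) \<bullet> \<phi>)^2) has_sum
        (norm (w' 0))^2 + (norm (half_pow D A 1 (w 0)))^2) E"
      by (intro has_sum_add parseval)
    also have "(norm (w' 0))^2 + (norm (half_pow D A 1 (w 0)))^2 = 2 * energy D A 1 (w 0) (w' 0)"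
      by (simp add: energy_1)
    finally have "\<forall>\<^sub>F F in finite_subsets_at_top E. 2 * energy D A 1 (w 0) (w' 0) - \<epsilon>
        < (\<Sum>\<phi>\<in>F. (w' 0 \<bullet> \<phi>)^2 + (half_pow D A 1 (w 0) \<bullet> \<phi>)^2)"
      unfolding has_sum_def by (rule order_tendstoD) (use \<epsilon> in simp)
    moreover have "\<forall>\<^sub>F F in finite_subsets_at_top E. \<forall>x\<in>w' ` {0..T}. norm (proj F x - x) < \<epsilon>"
      by (rule proj_tendsto_uniform[OF compact_continuous_image[OF cw' compact_Icc] \<epsilon>(1)])
    moreover have "\<forall>\<^sub>F F in finite_subsets_at_top E. finite F \<and> F \<subseteq> E"
      by (rule eventually_finite_subsets_at_top_weakI) simp
    ultimately have "\<forall>\<^sub>F F in finite_subsets_at_top E. 2 * energy D A 1 (w 0) (w' 0) - \<epsilon>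
        < (\<Sum>\<phi>\<in>F. (w' 0 \<bullet> \<phi>)^2 + (half_pow D A 1 (w 0) \<bullet> \<phi>)^2) \<and>
        (\<forall>x\<in>w' ` {0..T}. norm (proj F x - x) < \<epsilon>) \<and> finite F \<and> F \<subseteq> E"
      by eventually_elim simp
    from eventually_happens'[OF finite_subsets_at_top_neq_bot this]
    obtain F where F: "finite F" "F \<subseteq> E"
      and F1: "2 * energy D A 1 (w 0) (w' 0) - \<epsilon> < (\<Sum>\<phi>\<in>F. (w' 0 \<bullet> \<phi>)^2 + (half_pow D A 1 (w 0) \<bullet> \<phi>)^2)"
      and F2: "\<forall>x\<in>w' ` {0..T}. norm (proj F x - x) < \<epsilon>"
      by (elim exE conjE)
    have Y: "(\<Sum>\<phi>\<in>F. (w' 0 \<bullet> \<phi>)^2 + (half_pow D A 1 (w 0) \<bullet> \<phi>)^2) = (\<Sum>\<phi>\<in>F. (a \<phi>)^2 + (b \<phi>)^2)"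
      using F by (intro sum.cong) (auto simp: a_def b_def half_pow_coord_1[OF w0])
    have osc_eq: "osc F a b 0 t = proj F (w' t)" if "t \<in> {0..T}" for t
    proof (rule coords_eqI)
      fix \<phi> assume \<phi>: "\<phi> \<in> E"
      show "osc F a b 0 t \<bullet> \<phi> = proj F (w' t) \<bullet> \<phi>"
        unfolding osc_coord[OF F \<phi>] inner_proj[OF on F \<phi>] free_solution_coord[OF w \<phi> that]
        by (simp add: a_def b_def)
    qed
    have c1: "continuous_on {0..T} (\<lambda>t. (norm (P (osc F a b 0 t)))^2)"
      by (intro continuous_intros continuous_on_operator_osc[OF P])
    have c2: "continuous_on {0..T} (\<lambda>t. (norm (P (w' t)))^2)"
      by (intro continuous_intros P.continuous_on cw')
    have "integral {0..L} (\<lambda>t. (norm (P (osc F a b 0 t)))^2) \<le> integral {0..T} (\<lambda>t. (norm (P (osc F a b 0 t)))^2)"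
      using L by (intro integral_mono_interval[OF c1]) auto
    also have "\<dots> \<le> integral {0..T} (\<lambda>t. 2 * (norm (P (w' t)))^2 + 2 * (\<epsilon> * K^2))"
    proof (rule integral_mono_continuous[OF c1])
      show "continuous_on {0..T} (\<lambda>t. 2 * (norm (P (w' t)))^2 + 2 * (\<epsilon> * K^2))"
        by (intro continuous_intros c2)
      fix t assume t: "t \<in> {0..T}"
      have "norm (proj F (w' t) - w' t) < \<epsilon>" using F2 t by blast
      then have "norm (P (proj F (w' t) - w' t)) \<le> \<epsilon> * K"
        using K(2)[of "proj F (w' t) - w' t"] mult_right_mono[of "norm (proj F (w' t) - w' t)" \<epsilon> K] K(1) by linarith
      then have "(norm (P (proj F (w' t)) - P (w' t)))^2 \<le> (\<epsilon> * K)^2"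
        by (intro power_mono) (auto simp: P.diff)
      also have "\<dots> \<le> \<epsilon> * K^2"
      proof -
        have "\<epsilon>^2 \<le> \<epsilon>" using \<epsilon> by (simp add: power2_eq_square mult_left_le)
        then show ?thesis unfolding power_mult_distrib by (rule mult_right_mono) simp
      qed
      finally show "(norm (P (osc F a b 0 t)))^2 \<le> 2 * (norm (P (w' t)))^2 + 2 * (\<epsilon> * K^2)"
        using norm_sq_le_double[of "P (proj F (w' t))" "P (w' t)"] by (simp add: osc_eq[OF t])
    qed
    also have "\<dots> = 2 * ?I + 2 * (\<epsilon> * K^2) * T"
    proof -
      have "((\<lambda>t. 2 * (norm (P (w' t)))^2 + 2 * (\<epsilon> * K^2)) has_integral 2 * ?I + 2 * (\<epsilon> * K^2) * T) {0..T}"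
        using has_integral_const_real[of "2 * (\<epsilon> * K^2)" 0 T] T
        by (intro has_integral_add has_integral_mult_right integrable_integral integrable_continuous_real c2)
          (simp add: mult.commute)
      then show ?thesis by (rule integral_unique)
    qed
    finally have "M * integral {0..L} (\<lambda>t. (norm (P (osc F a b 0 t)))^2) \<le> M * (2 * ?I + 2 * (\<epsilon> * K^2) * T)"
      by (rule mult_left_mono[OF _ M])
    then have "2 * energy D A 1 (w 0) (w' 0) - \<epsilon> \<le> M * (2 * ?I + 2 * (\<epsilon> * K^2) * T)"
      using F1 osc[OF F, of a b] unfolding Y by linarith
    then show ?thesis by (simp add: algebra_simps)
  qed
  then have "2 * energy D A 1 (w 0) (w' 0) \<le> 2 * M * ?I" by (rule le_of_perturbation)
  moreover have "(LINT t:{0..T}|lebesgue. (norm (P (w' t)))^2) = ?I"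
    by (rule LINT_continuous(2)) (intro continuous_intros P.continuous_on cw')
  ultimately show ?thesis by simp
qed

text \<open>For \<open>i = n\<close> the index in the cascade sum is 1, so this summand is the
  energy of the free solution placed in the last component; the others are nonnegative.\<close>

lemma cascade_observability_imp_observability:
  fixes B :: "'h \<times> 'h \<Rightarrow> 'g::{real_inner,complete_space}"
  assumes n: "1 \<le> n" and C: "\<And>j. j \<in> {2..n} \<Longrightarrow> bounded_linear (C j)"
    and obs: "\<And>u0 u1 u u'. (\<forall>i\<in>{1..n}. u0 i \<in> Hsp D A 1) \<Longrightarrow> cascade_solution D A n C T u0 u1 u u' \<Longrightarrow>
      c * (\<Sum>i=1..n. energy D A (1 + int i - int n) (u i 0) (u' i 0))
        \<le> (LINT t:{0..T}|lebesgue. (norm (observation D A B T (u n) (u' n) t))^2)"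
    and c: "0 < c" and T: "0 < T" and w: "wave_solution D A T (\<lambda>t. 0) w w'"
  shows "c * energy D A 1 (w 0) (w' 0) \<le> (LINT t:{0..T}|lebesgue. (norm (observation D A B T w w' t))^2)"
proof -
  obtain u u' where casc: "cascade_solution D A n C T (\<lambda>i. u i 0) (\<lambda>i. u' i 0) u u'"
    and un: "u n = w" "u' n = w'"
    using cascade_exists[where n = n and C = C, OF less_imp_le[OF T] C n w] by blast
  have H1: "\<forall>j\<in>{1..n}. u j 0 \<in> Hsp D A 1"
  proof
    fix j assume j: "j \<in> {1..n}"
    have "\<exists>f. wave_solution D A T f (u j) (u' j)"
    proof (cases "j = 1")
      case False
      then have "j \<in> {2..n}" using j by auto
      then show ?thesis using casc unfolding cascade_solution_def by blast
    qed (use casc in \<open>auto simp: cascade_solution_def\<close>)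
    moreover have "0 \<in> {0..T}" using T by simp
    ultimately show "u j 0 \<in> Hsp D A 1" unfolding wave_solution_def by blast
  qed
  have "energy D A (1 + int n - int n) (u n 0) (u' n 0) \<le> (\<Sum>i=1..n. energy D A (1 + int i - int n) (u i 0) (u' i 0))"
    using n by (intro member_le_sum[where f = "\<lambda>i. energy D A (1 + int i - int n) (u i 0) (u' i 0)"])
      (auto simp: energy_nonneg)
  then have "c * energy D A 1 (w 0) (w' 0) \<le> c * (\<Sum>i=1..n. energy D A (1 + int i - int n) (u i 0) (u' i 0))"
    using c by (intro mult_left_mono) (simp_all add: un)
  also have "\<dots> \<le> (LINT t:{0..T}|lebesgue. (norm (observation D A B T w w' t))^2)"
    using obs[OF H1 casc] by (simp add: un)
  finally show ?thesis .
qed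

end

theorem theorem2p6:
  fixes D :: "'h::{real_inner,complete_space} set"
    and A :: "'h \<Rightarrow> 'h"
    and C :: "nat \<Rightarrow> 'h \<Rightarrow> 'h"
    and B :: "'h \<times> 'h \<Rightarrow> 'g::{real_inner,complete_space}"
    and n :: nat
  assumes "abstract_setting D A"
    and "2 \<le> n"
    and "coupling_hyp D A n C C"
    and "admissibility_hyp D A B"
    and "\<not> observability_hyp D A B \<or> \<not> coupling_observability_hyp D A n C"
  shows "\<not> (\<exists>Tstar>0. \<forall>T>Tstar. \<exists>c>0. \<forall>u0 u1.
              (\<forall>i\<in>{1..n}. u0 i \<in> Hsp D A 1) \<longrightarrow>
              (\<forall>u u'. cascade_solution D A n C T u0 u1 u u' \<longrightarrow>
                 c * (\<Sum>i=1..n. energy D A (1 + int i - int n) (u i 0) (u' i 0))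
                   \<le> (LINT t:{0..T}|lebesgue. (norm (observation D A B T (u n) (u' n) t))^2)))"
proof (rule notI, elim exE conjE)
  define obs_ineq where "obs_ineq T c \<longleftrightarrow> (\<forall>u0 u1.
      (\<forall>i\<in>{1..n}. u0 i \<in> Hsp D A 1) \<longrightarrow>
      (\<forall>u u'. cascade_solution D A n C T u0 u1 u u' \<longrightarrow>
         c * (\<Sum>i=1..n. energy D A (1 + int i - int n) (u i 0) (u' i 0))
           \<le> (LINT t:{0..T}|lebesgue. (norm (observation D A B T (u n) (u' n) t))^2)))" for T c
  fix Tstar :: real
  assume Tstar: "0 < Tstar" and all: "\<forall>T>Tstar. \<exists>c>0. \<forall>u0 u1.
      (\<forall>i\<in>{1..n}. u0 i \<in> Hsp D A 1) \<longrightarrow>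
      (\<forall>u u'. cascade_solution D A n C T u0 u1 u u' \<longrightarrow>
         c * (\<Sum>i=1..n. energy D A (1 + int i - int n) (u i 0) (u' i 0))
           \<le> (LINT t:{0..T}|lebesgue. (norm (observation D A B T (u n) (u' n) t))^2))"
  have obs: "\<forall>T>Tstar. \<exists>c>0. obs_ineq T c"
    unfolding obs_ineq_def by (rule all)
  have obs_ineqD: "c * (\<Sum>i=1..n. energy D A (1 + int i - int n) (u i 0) (u' i 0))
      \<le> (LINT t:{0..T}|lebesgue. (norm (observation D A B T (u n) (u' n) t))^2)"
    if "obs_ineq T c" "\<forall>i\<in>{1..n}. u0 i \<in> Hsp D A 1" "cascade_solution D A n C T u0 u1 u u'"
    for T c u0 u1 u u'
    using that(1)[unfolded obs_ineq_def, THEN spec, THEN spec, THEN mp, OF that(2),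
        THEN spec, THEN spec, THEN mp, OF that(3)] .
  obtain E lam l0 where "wave_setting E D A lam l0"
    using abstract_setting_diagonalizable[OF assms(1)] .
  then interpret wave_setting E D A lam l0 .
  have bl: "bounded_linear (C j)" if "j \<in> {2..n}" for j
    using assms(3) that unfolding coupling_hyp_def by blast
  have "observability_hyp D A B"
    unfolding observability_hyp_def
  proof (rule exI[of _ Tstar], intro conjI Tstar allI impI)

    fix T assume T: "Tstar < T"
    obtain c where c: "0 < c" "obs_ineq T c" using obs T by blast
    have nT: "1 \<le> n" "0 < T" using assms(2) T Tstar by auto
    have "c * energy D A 1 (w 0) (w' 0) \<le> (LINT t:{0..T}|lebesgue. (norm (observation D A B T w w' t))^2)"
      if "wave_solution D A T (\<lambda>t. 0) w w'" for w w'
      by (rule cascade_observability_imp_observability[where C = C, OF nT(1) bl obs_ineqD[OF c(2)] c(1) nT(2) that])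
    then show "\<exists>R>0. \<forall>w w'. wave_solution D A T (\<lambda>t. 0) w w' \<longrightarrow>
        R * energy D A 1 (w 0) (w' 0) \<le> (LINT t:{0..T}|lebesgue. (norm (observation D A B T w w' t))^2)"
      using c(1) by blast
  qed
  moreover have "coupling_observability_hyp D A n C"
    unfolding coupling_observability_hyp_def
  proof (intro ballI conjI bl)
    fix i assume i: "i \<in> {2..n}"
    \<comment> \<open>A single admissible time is fixed. The resulting observation time is
      \<open>T + 2\<close>, and monotonicity in the length of the interval covers every larger
      time.\<close>
    define T where "T = Tstar + 1"
    have T: "Tstar < T" "0 < T" using Tstar by (auto simp: T_def)
    obtain c where c: "0 < c" "obs_ineq T c" using obs T(1) by blast
    \<comment> \<open>The bound \<open>Suc (n - i)\<close> uses the full range of the coupling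
      hypothesis for \<open>C i\<close>: index \<open>-(n - i)\<close> for the source and one more
      for the highest derivative in the interpolation.\<close>
    obtain K where K: "\<And>m x. m \<le> Suc (n - i) \<Longrightarrow> norm (neg_pow m (C i x)) \<le> K * norm (neg_pow m x)"
      using coupling_bounded[OF assms(3)] i by (metis Suc_eq_plus1)
    obtain M where M: "0 \<le> M" "\<And>F a b. finite F \<Longrightarrow> F \<subseteq> E \<Longrightarrow> (\<Sum>\<phi>\<in>F. (a \<phi>)^2 + (b \<phi>)^2)
      \<le> M * integral {0..T} (\<lambda>t. (norm (neg_pow (n - i) (C i (osc F a b (n - i) t))))^2)"
    proof (rule weak_observability[OF assms(3,4) T(2) c(1) obs_ineqD[OF c(2)] i])
    qed (assumption, assumption, rule that)
    obtain M' where M': "0 \<le> M'" "\<And>F a b. finite F \<Longrightarrow> F \<subseteq> E \<Longrightarrow> (\<Sum>\<phi>\<in>F. (a \<phi>)^2 + (b \<phi>)^2)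
      \<le> M' * integral {0..T + 2} (\<lambda>t. (norm (C i (osc F a b 0 t)))^2)"
      using strong_observability_osc[OF bl[OF i] T(2) K M] by blast
    show "\<exists>T0>0. \<forall>S>T0. \<exists>\<gamma>>0. \<forall>w w'. wave_solution D A S (\<lambda>t. 0) w w' \<longrightarrow>
        \<gamma> * energy D A 1 (w 0) (w' 0) \<le> (LINT t:{0..S}|lebesgue. (norm (C i (w' t)))^2)"
    \<comment> \<open>Adding 1 keeps the observability constant well defined and positive even if
      \<open>M'\<close> is 0.\<close>
    proof (rule exI[of _ "T + 2"], intro exI[of _ "1 / (M' + 1)"] conjI allI impI)
      fix S w w' assume S: "T + 2 < S" and w: "wave_solution D A S (\<lambda>t. 0) w w'"
      have I0: "0 \<le> (LINT t:{0..S}|lebesgue. (norm (C i (w' t)))^2)"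
        by (rule LINT_nonneg) simp
      have "energy D A 1 (w 0) (w' 0) \<le> M' * (LINT t:{0..S}|lebesgue. (norm (C i (w' t)))^2)"
        by (rule coupling_observability_of_osc[OF bl[OF i] M'(1) _ _ M'(2) w]) (use T S in auto)
      also have "\<dots> \<le> (M' + 1) * (LINT t:{0..S}|lebesgue. (norm (C i (w' t)))^2)"
        using I0 by (intro mult_right_mono) auto
      finally show "1 / (M' + 1) * energy D A 1 (w 0) (w' 0) \<le> (LINT t:{0..S}|lebesgue. (norm (C i (w' t)))^2)"
        using M'(1) by (simp add: field_simps)
    qed (use T M' in auto)
  qed
  ultimately show False using assms(5) by blast
qed

end
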